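(* Let $V=\coprod_{n\in\mathbb{Z}}V_{(n)}$ be a vertex operator algebra over $\mathbb{C}$, let $\sigma$ be an automorphism of $V$ of order $N$ (a positive integer), let $\omega_N=\exp(2\pi\sqrt{-1}/N)$, let $G=\langle\sigma\rangle\subset\mathrm{Aut}(V)$, and let $\phi:G\to\mathbb{C}^\times$ be the injective group homomorphism with $\phi(\sigma^j)=\omega_N^j$ for $j=0,\dots,N-1$. Let $(W,Y_W)$ be a weak $\sigma$-twisted $V$-module. For $u\in V$ set $$\tilde{Y}_W(u,x)=Y_W(\Phi(x)u,x^N)\in(\mathrm{End}\,W)[[x,x^{-1}]],$$ where $$\Phi(x)=(Nx^{N-1})^{L(0)}\exp\Big(-\sum_{n\ge 1}a_nx^{-n}L(n)\Big)\in\mathrm{Hom}(V,V[x,x^{-1}])$$ and the complex numbers $a_n$ ($n\ge1$) are defined by $$\exp\Big(-\sum_{n\ge 1}a_nx^{n+1}\frac{d}{dx}\Big)\cdot x=\frac1N(1+x)^N-\frac1N.$$ Then $(W,\tilde{Y}_W)$ carries the structure of a $(G,\phi)$-quasi $V$-module.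
   Context: Conventions. $V$ has vertex operator map $Y(\cdot,x)$, vacuum vector $\mathbf{1}$, and Virasoro operators $L(n)$, $n\in\mathbb{Z}$, where $L(0)$ acts on $V_{(n)}$ as the scalar $n$. Automorphisms of $V$ preserve $Y$, $\mathbf 1$ and the conformal vector. $\delta(x)=\sum_{n\in\mathbb{Z}}x^n$. For $\alpha\in\mathbb{R}$, $(x_1\pm x_2)^\alpha$ is always expanded in nonnegative integral powers of the second variable: $(x_1\pm x_2)^\alpha=\sum_{i\ge0}\binom{\alpha}{i}(\pm1)^ix_1^{\alpha-i}x_2^i$. For a nonzero scalar or formal monomial $c$, the operator $c^{L(0)}$ acts on $V_{(n)}$ as multiplication by $c^n$. Weak $\sigma$-twisted $V$-module: a vector space $W$ with a linear map $Y_W:V\to\mathrm{Hom}(W,W((x^{1/N})))\subset(\mathrm{End}\,W)[[x^{1/N},x^{-1/N}]]$, $v\mapsto Y_W(v,x)$, such that $Y_W(\mathbf{1},x)=1_W$ and for all $u,v\in V$ the twisted Jacobi identity holds: $$x_0^{-1}\delta\Big(\frac{x_1-x_2}{x_0}\Big)Y_W(u,x_1)Y_W(v,x_2)-x_0^{-1}\delta\Big(\frac{x_2-x_1}{-x_0}\Big)Y_W(v,x_2)Y_W(u,x_1)$$ $$=\frac1N\sum_{r=0}^{N-1}x_1^{-1}\delta\Big(\omega_N^r\Big(\frac{x_2+x_0}{x_1}\Big)^{1/N}\Big)Y_W(Y(\sigma^ru,x_0)v,x_2).$$ In the expression $Y_W(\Phi(x)u,x^N)$, the map $Y_W(\cdot,z)$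 is extended linearly over $\mathbb{C}[x,x^{-1}]$ to $V[x,x^{-1}]$, and then $z^{1/N}$ is replaced by $x$ (so $z$ by $x^N$). Quasi $V$-module: a vector space $W$ with a linear map $Y_W:V\to\mathrm{Hom}(W,W((x)))\subset(\mathrm{End}\,W)[[x,x^{-1}]]$, $v\mapsto Y_W(v,x)$, such that $Y_W(\mathbf{1},x)=1_W$ and for any $u,v\in V$ there exists a nonzero polynomial $p(x_1,x_2)$ such that the quasi Jacobi identity holds: $$x_0^{-1}\delta\Big(\frac{x_1-x_2}{x_0}\Big)p(x_1,x_2)Y_W(u,x_1)Y_W(v,x_2)-x_0^{-1}\delta\Big(\frac{x_2-x_1}{-x_0}\Big)p(x_1,x_2)Y_W(v,x_2)Y_W(u,x_1)$$ $$=x_2^{-1}\delta\Big(\frac{x_1-x_0}{x_2}\Big)p(x_1,x_2)Y_W(Y(u,x_0)v,x_2).$$ $(G,\phi)$-quasi $V$-module: a quasi $V$-module $(W,Y_W)$ such that for any $u,v\in V$ there is a nonnegative integer $k$ for which the quasi Jacobi identity holds with $p(x_1,x_2)=(x_1^N-x_2^N)^k$, and such that $$Y_W(\phi(g)^{-L(0)}g(u),x)=Y_W(u,\phi(g)x)\quad\text{for all }g\in G,\ u\in V.$$ *)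

theory Defs
  imports
    "HOL-Algebra.Multiplicative_Group"
    "HOL-Algebra.Generated_Groups"
    "HOL-Library.Product_Plus"
    "HOL-Library.Groups_Big_Fun"
    "HOL-Computational_Algebra.Formal_Power_Series"
    "HOL-Computational_Algebra.Polynomial"
    Complex_Main
begin

section \<open>Formal calculus\<close>

text \<open>
  A formal series, infinite in all directions, is the function mapping an exponent to its
  coefficient: \<open>f :: int \<Rightarrow> 'a\<close> stands for the sum of the \<open>f n x\<^sup>n\<close>, and
  \<open>f :: int \<times> int \<times> int \<Rightarrow> 'a\<close> for a series in three variables, with \<open>f (a, b, c)\<close> the
  coefficient of \<open>x0\<^sup>a x1\<^sup>b x2\<^sup>c\<close>.
  A series in \<open>x\<^sup>1\<^sup>/\<^sup>N\<close> is indexed by the exponent of \<open>x\<^sup>1\<^sup>/\<^sup>N\<close>, so \<open>f k\<close> is the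
  coefficient of \<open>x\<^sup>k\<^sup>/\<^sup>N\<close>.

  A series with operator coefficients is applied to a fixed vector before infinite sums are formed.
  Each sum is \<open>Sum_any\<close>, the sum over all indices with nonzero summand.  It is 0 if there are
  infinitely many of these, but lower truncation makes all the sums below finite.
\<close>

definition formal_prod ::
    "(complex \<Rightarrow> 'a \<Rightarrow> 'a) \<Rightarrow> ('e::ab_group_add \<Rightarrow> complex) \<Rightarrow> ('e \<Rightarrow> 'a::ab_group_add) \<Rightarrow> 'e \<Rightarrow> 'a" where
  "formal_prod scale f g e = Sum_any (\<lambda>d. scale (f d) (g (e - d)))"

text \<open>The coefficient of \<open>x\<^sup>p y\<^sup>q\<close> in \<open>(x + s y)\<^sup>n\<close>, expanded in nonnegative powers of \<open>y\<close>.\<close>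

definition binom_series :: "complex \<Rightarrow> int \<Rightarrow> int \<times> int \<Rightarrow> complex" where
  "binom_series s n = (\<lambda>(p, q).
     if q \<ge> 0 \<and> p + q = n then (of_int n gchoose nat q) * s ^ nat q else 0)"

text \<open>\<open>x0\<^sup>-\<^sup>1 \<delta>((x1 - x2)/x0)\<close>, the sum over all integers \<open>n\<close> of \<open>x0\<^sup>-\<^sup>n\<^sup>-\<^sup>1 (x1 - x2)\<^sup>n\<close>.\<close>

definition delta_12_0 :: "int \<times> int \<times> int \<Rightarrow> complex" where
  "delta_12_0 = (\<lambda>(a, b, c). binom_series (-1) (-a - 1) (b, c))"

text \<open>\<open>x0\<^sup>-\<^sup>1 \<delta>((x2 - x1)/(-x0))\<close>, the sum of \<open>(-1)\<^sup>n x0\<^sup>-\<^sup>n\<^sup>-\<^sup>1 (x2 - x1)\<^sup>n\<close>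
  (note that \<open>(-1)\<^sup>-\<^sup>n = (-1)\<^sup>n\<close>).\<close>

definition delta_21_0 :: "int \<times> int \<times> int \<Rightarrow> complex" where
  "delta_21_0 = (\<lambda>(a, b, c). (-1) powi (-a - 1) * binom_series (-1) (-a - 1) (c, b))"

text \<open>\<open>x2\<^sup>-\<^sup>1 \<delta>((x1 - x0)/x2)\<close>, the sum of \<open>x2\<^sup>-\<^sup>n\<^sup>-\<^sup>1 (x1 - x0)\<^sup>n\<close>.\<close>

definition delta_10_2 :: "int \<times> int \<times> int \<Rightarrow> complex" where
  "delta_10_2 = (\<lambda>(a, b, c). binom_series (-1) (-c - 1) (b, a))"

text \<open>A series in \<open>x0, x1, x2\<close>, regarded as a series in \<open>x0, x1\<^sup>1\<^sup>/\<^sup>N, x2\<^sup>1\<^sup>/\<^sup>N\<close>.\<close>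

definition ramify :: "nat \<Rightarrow> (int \<times> int \<times> int \<Rightarrow> complex) \<Rightarrow> int \<times> int \<times> int \<Rightarrow> complex" where
  "ramify N f = (\<lambda>(a, b, c).
     if int N dvd b \<and> int N dvd c then f (a, b div int N, c div int N) else 0)"

definition root_of_unity :: "nat \<Rightarrow> complex" where
  "root_of_unity N = exp (2 * of_real pi * \<i> / of_nat N)"

text \<open>
  \<open>x1\<^sup>-\<^sup>1 \<delta>(\<omega>\<^sup>r ((x2 + x0)/x1)\<^sup>1\<^sup>/\<^sup>N)\<close> as a series in \<open>x0, x1\<^sup>1\<^sup>/\<^sup>N, x2\<^sup>1\<^sup>/\<^sup>N\<close>: the sum over all
  integers \<open>n\<close> of \<open>\<omega>\<^sup>r\<^sup>n x1\<^sup>-\<^sup>1\<^sup>-\<^sup>n\<^sup>/\<^sup>N (x2 + x0)\<^sup>n\<^sup>/\<^sup>N\<close>.  The exponent of \<open>x1\<^sup>1\<^sup>/\<^sup>N\<close> in the \<open>n\<close>-th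
  summand is \<open>-N - n\<close>, and the coefficient of \<open>x0\<^sup>a\<close> in \<open>(x2 + x0)\<^sup>n\<^sup>/\<^sup>N\<close> is a multiple of
  \<open>x2\<^sup>n\<^sup>/\<^sup>N\<^sup>-\<^sup>a\<close>, of exponent \<open>n - N a\<close> in \<open>x2\<^sup>1\<^sup>/\<^sup>N\<close>.
\<close>

definition delta_twisted :: "nat \<Rightarrow> nat \<Rightarrow> int \<times> int \<times> int \<Rightarrow> complex" where
  "delta_twisted N r = (\<lambda>(a, b, c).
     let n = - b - int N in
     if a \<ge> 0 \<and> c = n - int N * a
     then root_of_unity N powi (int r * n) * ((of_int n / of_nat N) gchoose nat a)
     else 0)"

text \<open>Polynomials \<open>p(x1, x2)\<close>: the outer variable of \<open>complex poly poly\<close> is \<open>x2\<close>, the inner one \<open>x1\<close>.\<close>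

definition poly_series :: "complex poly poly \<Rightarrow> int \<times> int \<times> int \<Rightarrow> complex" where
  "poly_series p = (\<lambda>(a, b, c).
     if a = 0 \<and> b \<ge> 0 \<and> c \<ge> 0 then poly.coeff (poly.coeff p (nat c)) (nat b) else 0)"

definition poly_x1 :: "complex poly poly" where
  "poly_x1 = [:[:0, 1:]:]"

definition poly_x2 :: "complex poly poly" where
  "poly_x2 = [:0, 1:]"


section \<open>Vertex operator algebras\<close>

text \<open>
  A vertex operator map is a function \<open>Y :: 'v \<Rightarrow> int \<Rightarrow> 'w \<Rightarrow> 'w\<close>, where \<open>Y v n\<close> is the
  coefficient of \<open>x\<^sup>n\<close> (not of \<open>x\<^sup>-\<^sup>n\<^sup>-\<^sup>1\<close>) in \<open>Y(v, x)\<close>; for twisted modules it is the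
  coefficient of \<open>x\<^sup>n\<^sup>/\<^sup>N\<close>.  The next predicate says that \<open>Y\<close> is a linear map from \<open>V\<close> to
  \<open>Hom(W, W((x)))\<close>, respectively to \<open>Hom(W, W((x\<^sup>1\<^sup>/\<^sup>N)))\<close>.
\<close>

definition vertex_map ::
    "(complex \<Rightarrow> 'v::ab_group_add \<Rightarrow> 'v) \<Rightarrow> (complex \<Rightarrow> 'w::ab_group_add \<Rightarrow> 'w) \<Rightarrow>
     ('v \<Rightarrow> int \<Rightarrow> 'w \<Rightarrow> 'w) \<Rightarrow> bool" where
  "vertex_map sV sW Y \<longleftrightarrow>
     (\<forall>n w. Vector_Spaces.linear sV sW (\<lambda>v. Y v n w)) \<and>
     (\<forall>v n. Vector_Spaces.linear sW sW (Y v n)) \<and>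
     (\<forall>v w. \<exists>m. \<forall>n<m. Y v n w = 0)"

text \<open>\<open>Y(u, x1) Y(v, x2) w\<close>, \<open>Y(v, x2) Y(u, x1) w\<close> and \<open>Y\<^sub>W(Y(u, x0) v, x2) w\<close>\<close>

definition vprod_12 :: "('v \<Rightarrow> int \<Rightarrow> 'w \<Rightarrow> 'w::ab_group_add) \<Rightarrow> 'v \<Rightarrow> 'v \<Rightarrow> 'w \<Rightarrow> int \<times> int \<times> int \<Rightarrow> 'w" where
  "vprod_12 Y u v w = (\<lambda>(a, b, c). if a = 0 then Y u b (Y v c w) else 0)"

definition vprod_21 :: "('v \<Rightarrow> int \<Rightarrow> 'w \<Rightarrow> 'w::ab_group_add) \<Rightarrow> 'v \<Rightarrow> 'v \<Rightarrow> 'w \<Rightarrow> int \<times> int \<times> int \<Rightarrow> 'w" where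
  "vprod_21 Y u v w = (\<lambda>(a, b, c). if a = 0 then Y v c (Y u b w) else 0)"

definition viter :: "('v \<Rightarrow> int \<Rightarrow> 'v \<Rightarrow> 'v) \<Rightarrow> ('v \<Rightarrow> int \<Rightarrow> 'w \<Rightarrow> 'w::ab_group_add) \<Rightarrow>
    'v \<Rightarrow> 'v \<Rightarrow> 'w \<Rightarrow> int \<times> int \<times> int \<Rightarrow> 'w" where
  "viter Y YW u v w = (\<lambda>(a, b, c). if b = 0 then YW (Y u a v) c w else 0)"

definition quasi_jacobi ::
    "(complex \<Rightarrow> 'w::ab_group_add \<Rightarrow> 'w) \<Rightarrow> ('v \<Rightarrow> int \<Rightarrow> 'v \<Rightarrow> 'v) \<Rightarrow>
     ('v \<Rightarrow> int \<Rightarrow> 'w \<Rightarrow> 'w) \<Rightarrow> complex poly poly \<Rightarrow> 'v \<Rightarrow> 'v \<Rightarrow> bool" where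
  "quasi_jacobi sW Y YW p u v \<longleftrightarrow>
     (\<forall>w e. formal_prod sW delta_12_0 (formal_prod sW (poly_series p) (vprod_12 YW u v w)) e
          - formal_prod sW delta_21_0 (formal_prod sW (poly_series p) (vprod_21 YW u v w)) e
          = formal_prod sW delta_10_2 (formal_prod sW (poly_series p) (viter Y YW u v w)) e)"

text \<open>\<open>Y(\<omega>, x)\<close> is the sum of the \<open>L(n) x\<^sup>-\<^sup>n\<^sup>-\<^sup>2\<close>, for \<open>\<omega>\<close> the conformal vector.\<close>

definition virasoro :: "('v \<Rightarrow> int \<Rightarrow> 'w \<Rightarrow> 'w) \<Rightarrow> 'v \<Rightarrow> int \<Rightarrow> 'w \<Rightarrow> 'w" where
  "virasoro Y conf n = Y conf (- n - 2)"

definition homogeneous_decomposition ::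
    "(int \<Rightarrow> 'v::ab_group_add set) \<Rightarrow> 'v \<Rightarrow> (int \<Rightarrow> 'v) \<Rightarrow> bool" where
  "homogeneous_decomposition grade v f \<longleftrightarrow>
     finite {n. f n \<noteq> 0} \<and> (\<forall>n. f n \<in> grade n) \<and> v = Sum_any f"

text \<open>The untwisted Jacobi identity is the quasi Jacobi identity with \<open>p = 1\<close>.\<close>

locale vertex_operator_algebra = vector_space scale
  for scale :: "complex \<Rightarrow> 'v::ab_group_add \<Rightarrow> 'v" +
  fixes grade :: "int \<Rightarrow> 'v set"
    and Y :: "'v \<Rightarrow> int \<Rightarrow> 'v \<Rightarrow> 'v"
    and vac conf :: 'v
  assumes grade_subspace: "subspace (grade n)"
    and grade_direct_sum: "\<exists>!f. homogeneous_decomposition grade v f"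
    and grade_finite_dim: "\<exists>B. finite B \<and> grade n = span B"
    and grade_bounded_below: "\<exists>m. \<forall>n<m. grade n = {0}"
    and vac_grade: "vac \<in> grade 0"
    and conf_grade: "conf \<in> grade 2"
    and vertex_map: "vertex_map scale scale Y"
    and vacuum: "Y vac n v = (if n = 0 then v else 0)"
    and creation: "n < 0 \<Longrightarrow> Y v n vac = 0" "Y v 0 vac = v"
    and jacobi: "quasi_jacobi scale Y Y 1 u v"
    and virasoro_relations:
      "\<exists>central_charge. \<forall>m n v.
         virasoro Y conf m (virasoro Y conf n v) - virasoro Y conf n (virasoro Y conf m v)
         = scale (of_int (m - n)) (virasoro Y conf (m + n) v)
           + (if m + n = 0 then scale (of_int (m ^ 3 - m) / 12 * central_charge) v else 0)"
    and L0_grade: "v \<in> grade n \<Longrightarrow> virasoro Y conf 0 v = scale (of_int n) v"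
    and L_minus1_derivative:
      "Y (virasoro Y conf (-1) u) n v = scale (of_int (n + 1)) (Y u (n + 1) v)"

definition voa_automorphism ::
    "(complex \<Rightarrow> 'v::ab_group_add \<Rightarrow> 'v) \<Rightarrow> ('v \<Rightarrow> int \<Rightarrow> 'v \<Rightarrow> 'v) \<Rightarrow> 'v \<Rightarrow> 'v \<Rightarrow> ('v \<Rightarrow> 'v) \<Rightarrow> bool" where
  "voa_automorphism sV Y vac conf g \<longleftrightarrow>
     Vector_Spaces.linear sV sV g \<and> bij g \<and>
     (\<forall>u n v. g (Y u n v) = Y (g u) n (g v)) \<and> g vac = vac \<and> g conf = conf"

definition voa_Aut ::
    "(complex \<Rightarrow> 'v::ab_group_add \<Rightarrow> 'v) \<Rightarrow> ('v \<Rightarrow> int \<Rightarrow> 'v \<Rightarrow> 'v) \<Rightarrow> 'v \<Rightarrow> 'v \<Rightarrow> ('v \<Rightarrow> 'v) monoid" where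
  "voa_Aut sV Y vac conf =
     \<lparr>carrier = {g. voa_automorphism sV Y vac conf g}, monoid.mult = (\<circ>), one = id\<rparr>"

lemma (in vertex_operator_algebra) group_voa_Aut: "group (voa_Aut scale Y vac conf)"
proof (rule groupI)
  fix g assume g: "g \<in> carrier (voa_Aut scale Y vac conf)"
  then have lin: "Vector_Spaces.linear scale scale g" and bij: "bij g"
    and hom: "\<And>u n v. g (Y u n v) = Y (g u) n (g v)"
    and pts: "g vac = vac" "g conf = conf"
    by (auto simp: voa_Aut_def voa_automorphism_def)
  have inv: "g (Hilbert_Choice.inv g v) = v" "Hilbert_Choice.inv g (g v) = v" for v
    using bij by (simp_all add: bij_is_inj bij_is_surj surj_f_inv_f)
  interpret g: Vector_Spaces.linear scale scale g by (fact lin)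
  have "Vector_Spaces.linear scale scale (Hilbert_Choice.inv g)"
    by unfold_locales (metis inv g.add, metis inv g.scale)
  moreover have "Hilbert_Choice.inv g (Y u n v) =
      Y (Hilbert_Choice.inv g u) n (Hilbert_Choice.inv g v)" for u n v
    by (metis inv hom)
  ultimately have "voa_automorphism scale Y vac conf (Hilbert_Choice.inv g)"
    unfolding voa_automorphism_def using bij bij_imp_bij_inv pts inv by metis
  then show "\<exists>h\<in>carrier (voa_Aut scale Y vac conf).
      h \<otimes>\<^bsub>voa_Aut scale Y vac conf\<^esub> g = \<one>\<^bsub>voa_Aut scale Y vac conf\<^esub>"
    by (intro bexI[of _ "Hilbert_Choice.inv g"]) (auto simp: voa_Aut_def fun_eq_iff inv)
next
  show "\<one>\<^bsub>voa_Aut scale Y vac conf\<^esub> \<in> carrier (voa_Aut scale Y vac conf)"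
    by (simp add: voa_Aut_def voa_automorphism_def linear_id)
next
  fix g h assume "g \<in> carrier (voa_Aut scale Y vac conf)" "h \<in> carrier (voa_Aut scale Y vac conf)"
  then show "g \<otimes>\<^bsub>voa_Aut scale Y vac conf\<^esub> h \<in> carrier (voa_Aut scale Y vac conf)"
    by (auto simp: voa_Aut_def voa_automorphism_def bij_comp intro: Vector_Spaces.linear_compose)
qed (auto simp: voa_Aut_def)

definition complex_units :: "complex monoid" where
  "complex_units = \<lparr>carrier = UNIV - {0}, monoid.mult = (*), one = 1\<rparr>"


section \<open>Twisted modules and quasi modules\<close>

definition twisted_jacobi ::
    "nat \<Rightarrow> (complex \<Rightarrow> 'w::ab_group_add \<Rightarrow> 'w) \<Rightarrow> ('v \<Rightarrow> int \<Rightarrow> 'v \<Rightarrow> 'v) \<Rightarrow> ('v \<Rightarrow> 'v) \<Rightarrow>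
     ('v \<Rightarrow> int \<Rightarrow> 'w \<Rightarrow> 'w) \<Rightarrow> 'v \<Rightarrow> 'v \<Rightarrow> bool" where
  "twisted_jacobi N sW Y \<sigma> YW u v \<longleftrightarrow>
     (\<forall>w e. formal_prod sW (ramify N delta_12_0) (vprod_12 YW u v w) e
          - formal_prod sW (ramify N delta_21_0) (vprod_21 YW u v w) e
          = sW (1 / of_nat N)
              (\<Sum>r<N. formal_prod sW (delta_twisted N r) (viter Y YW ((\<sigma> ^^ r) u) v w) e))"

definition weak_twisted_module ::
    "(complex \<Rightarrow> 'v::ab_group_add \<Rightarrow> 'v) \<Rightarrow> ('v \<Rightarrow> int \<Rightarrow> 'v \<Rightarrow> 'v) \<Rightarrow> 'v \<Rightarrow> nat \<Rightarrow> ('v \<Rightarrow> 'v) \<Rightarrow>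
     (complex \<Rightarrow> 'w::ab_group_add \<Rightarrow> 'w) \<Rightarrow> ('v \<Rightarrow> int \<Rightarrow> 'w \<Rightarrow> 'w) \<Rightarrow> bool" where
  "weak_twisted_module sV Y vac N \<sigma> sW YW \<longleftrightarrow>
     vector_space sW \<and> vertex_map sV sW YW \<and>
     (\<forall>n w. YW vac n w = (if n = 0 then w else 0)) \<and>
     (\<forall>u v. twisted_jacobi N sW Y \<sigma> YW u v)"

definition quasi_module ::
    "(complex \<Rightarrow> 'v::ab_group_add \<Rightarrow> 'v) \<Rightarrow> ('v \<Rightarrow> int \<Rightarrow> 'v \<Rightarrow> 'v) \<Rightarrow> 'v \<Rightarrow>
     (complex \<Rightarrow> 'w::ab_group_add \<Rightarrow> 'w) \<Rightarrow> ('v \<Rightarrow> int \<Rightarrow> 'w \<Rightarrow> 'w) \<Rightarrow> bool" where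
  "quasi_module sV Y vac sW YW \<longleftrightarrow>
     vector_space sW \<and> vertex_map sV sW YW \<and>
     (\<forall>n w. YW vac n w = (if n = 0 then w else 0)) \<and>
     (\<forall>u v. \<exists>p. p \<noteq> 0 \<and> quasi_jacobi sW Y YW p u v)"

definition homogeneous_component ::
    "(int \<Rightarrow> 'v::ab_group_add set) \<Rightarrow> 'v \<Rightarrow> int \<Rightarrow> 'v" where
  "homogeneous_component grade v = (THE f. homogeneous_decomposition grade v f)"

text \<open>The operator \<open>c\<^sup>L\<^sup>(\<^sup>0\<^sup>)\<close> for a nonzero scalar \<open>c\<close>\<close>

definition scalar_pow_L0 ::
    "(complex \<Rightarrow> 'v::ab_group_add \<Rightarrow> 'v) \<Rightarrow> (int \<Rightarrow> 'v set) \<Rightarrow> complex \<Rightarrow> 'v \<Rightarrow> 'v" where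
  "scalar_pow_L0 sV grade c v = Sum_any (\<lambda>n. sV (c powi n) (homogeneous_component grade v n))"

text \<open>In the definition below, \<open>\<phi>(g)\<^sup>-\<^sup>L\<^sup>(\<^sup>0\<^sup>)\<close> is written as \<open>(\<phi>(g)\<^sup>-\<^sup>1)\<^sup>L\<^sup>(\<^sup>0\<^sup>)\<close>.\<close>

definition G_phi_quasi_module ::
    "(complex \<Rightarrow> 'v::ab_group_add \<Rightarrow> 'v) \<Rightarrow> (int \<Rightarrow> 'v set) \<Rightarrow> ('v \<Rightarrow> int \<Rightarrow> 'v \<Rightarrow> 'v) \<Rightarrow> 'v \<Rightarrow>
     nat \<Rightarrow> ('v \<Rightarrow> 'v) set \<Rightarrow> (('v \<Rightarrow> 'v) \<Rightarrow> complex) \<Rightarrow>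
     (complex \<Rightarrow> 'w::ab_group_add \<Rightarrow> 'w) \<Rightarrow> ('v \<Rightarrow> int \<Rightarrow> 'w \<Rightarrow> 'w) \<Rightarrow> bool" where
  "G_phi_quasi_module sV grade Y vac N G \<phi> sW YW \<longleftrightarrow>
     quasi_module sV Y vac sW YW \<and>
     (\<forall>u v. \<exists>k. quasi_jacobi sW Y YW ((poly_x1 ^ N - poly_x2 ^ N) ^ k) u v) \<and>
     (\<forall>g\<in>G. \<forall>u n w.
        YW (scalar_pow_L0 sV grade (inverse (\<phi> g)) (g u)) n w = sW (\<phi> g powi n) (YW u n w))"


section \<open>The change of variables\<close>

text \<open>The derivation \<open>- (a\<^sub>1 x\<^sup>2 + a\<^sub>2 x\<^sup>3 + \<dots>) d/dx\<close>\<close>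

definition vector_field :: "(nat \<Rightarrow> complex) \<Rightarrow> complex fps \<Rightarrow> complex fps" where
  "vector_field a f = - (Abs_fps (\<lambda>m. if m \<ge> 2 then a (m - 1) else 0) * fps_deriv f)"

text \<open>The exponential series of the derivation, applied to \<open>x\<close>, converges in the \<open>x\<close>-adic
  topology.\<close>

definition change_of_variable_coeffs :: "nat \<Rightarrow> (nat \<Rightarrow> complex) \<Rightarrow> bool" where
  "change_of_variable_coeffs N a \<longleftrightarrow>
     (\<lambda>k. fps_const (1 / fact k) * (vector_field a ^^ k) fps_X) sums
       (fps_const (1 / of_nat N) * (1 + fps_X) ^ N - fps_const (1 / of_nat N))"

text \<open>The action of \<open>- (a\<^sub>1 x\<^sup>-\<^sup>1 L(1) + a\<^sub>2 x\<^sup>-\<^sup>2 L(2) + \<dots>)\<close> on \<open>V[x, x\<^sup>-\<^sup>1]\<close>, and its exponential\<close>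

definition lowering_op ::
    "(complex \<Rightarrow> 'v::ab_group_add \<Rightarrow> 'v) \<Rightarrow> ('v \<Rightarrow> int \<Rightarrow> 'v \<Rightarrow> 'v) \<Rightarrow> 'v \<Rightarrow> (nat \<Rightarrow> complex) \<Rightarrow>
     (int \<Rightarrow> 'v) \<Rightarrow> int \<Rightarrow> 'v" where
  "lowering_op sV Y conf a f m =
     - Sum_any (\<lambda>n::nat. if n \<ge> 1 then sV (a n) (virasoro Y conf (int n) (f (m + int n))) else 0)"

definition exp_lowering_op ::
    "(complex \<Rightarrow> 'v::ab_group_add \<Rightarrow> 'v) \<Rightarrow> ('v \<Rightarrow> int \<Rightarrow> 'v \<Rightarrow> 'v) \<Rightarrow> 'v \<Rightarrow> (nat \<Rightarrow> complex) \<Rightarrow>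
     (int \<Rightarrow> 'v) \<Rightarrow> int \<Rightarrow> 'v" where
  "exp_lowering_op sV Y conf a f m =
     Sum_any (\<lambda>k::nat. sV (1 / fact k) ((lowering_op sV Y conf a ^^ k) f m))"

text \<open>The operator \<open>(c x\<^sup>d)\<^sup>L\<^sup>(\<^sup>0\<^sup>)\<close> on \<open>V[x, x\<^sup>-\<^sup>1]\<close>; it acts on \<open>V\<^sub>(\<^sub>n\<^sub>)\<close> as \<open>c\<^sup>n x\<^sup>d\<^sup>n\<close>.\<close>

definition monomial_pow_L0 ::
    "(complex \<Rightarrow> 'v::ab_group_add \<Rightarrow> 'v) \<Rightarrow> (int \<Rightarrow> 'v set) \<Rightarrow> complex \<Rightarrow> int \<Rightarrow>
     (int \<Rightarrow> 'v) \<Rightarrow> int \<Rightarrow> 'v" where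
  "monomial_pow_L0 sV grade c d f m =
     Sum_any (\<lambda>n. sV (c powi n) (homogeneous_component grade (f (m - d * n)) n))"

definition Phi ::
    "(complex \<Rightarrow> 'v::ab_group_add \<Rightarrow> 'v) \<Rightarrow> (int \<Rightarrow> 'v set) \<Rightarrow> ('v \<Rightarrow> int \<Rightarrow> 'v \<Rightarrow> 'v) \<Rightarrow> 'v \<Rightarrow>
     nat \<Rightarrow> (nat \<Rightarrow> complex) \<Rightarrow> 'v \<Rightarrow> int \<Rightarrow> 'v" where
  "Phi sV grade Y conf N a u =
     monomial_pow_L0 sV grade (of_nat N) (int N - 1)
       (exp_lowering_op sV Y conf a (\<lambda>m. if m = 0 then u else 0))"

text \<open>
  \<open>Y\<^sub>W(\<Phi>(x) u, x\<^sup>N)\<close>.  As \<open>YW v k\<close> is the coefficient of \<open>z\<^sup>k\<^sup>/\<^sup>N\<close> in \<open>Y\<^sub>W(v, z)\<close>, it is the coefficient of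
  \<open>x\<^sup>k\<close> after \<open>z\<^sup>1\<^sup>/\<^sup>N\<close> is replaced by \<open>x\<close>.
\<close>

definition Y_tilde ::
    "(complex \<Rightarrow> 'v::ab_group_add \<Rightarrow> 'v) \<Rightarrow> (int \<Rightarrow> 'v set) \<Rightarrow> ('v \<Rightarrow> int \<Rightarrow> 'v \<Rightarrow> 'v) \<Rightarrow> 'v \<Rightarrow>
     nat \<Rightarrow> (nat \<Rightarrow> complex) \<Rightarrow> ('v \<Rightarrow> int \<Rightarrow> 'w::ab_group_add \<Rightarrow> 'w) \<Rightarrow> 'v \<Rightarrow> int \<Rightarrow> 'w \<Rightarrow> 'w" where
  "Y_tilde sV grade Y conf N a YW u n w =
     Sum_any (\<lambda>m. YW (Phi sV grade Y conf N a u m) (n - m) w)"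

end

theory Submission
  imports
    Defs
    "HOL-Computational_Algebra.Formal_Laurent_Series"
    "HOL-Computational_Algebra.Polynomial_FPS"
begin

text \<open>
  Let \<open>E = exp (- \<Sum> a\<^sub>n L(n))\<close> and \<open>f(x) = ((1 + x)\<^sup>N - 1)/N\<close>.  The heart of the matter is the formula
  \<open>\<Phi>(x\<^sub>2) Y(u, x\<^sub>0) v = Y(\<Phi>(x\<^sub>2 + x\<^sub>0) u, (x\<^sub>2 + x\<^sub>0)\<^sup>N - x\<^sub>2\<^sup>N) \<Phi>(x\<^sub>2) v\<close>, which by homogeneity
  is a statement about \<open>E Y(u, x) v\<close>.  Exponentiating the commutator formula gives
  \<open>E Y(u, x) v = \<Sum> x\<^sup>p Y(m\<^sub>p, x) E v\<close> for a series \<open>m\<close> in \<open>V[[x]]\<close>; this series is determined by its action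
  on the vacuum, where both sides obey the same recursion, because conjugation by the formal
  diffeomorphism \<open>f\<close> turns the vector field \<open>(1 + x) d/dx\<close> into \<open>(1 + N x) d/dx\<close>, that is,
  \<open>E (L(-1) + L(0)) = (L(-1) + N L(0)) E\<close>.

  For the quasi Jacobi identity, \<open>(x\<^sub>1 - x\<^sub>2)\<^sup>n (x\<^sub>1\<^sup>N - x\<^sub>2\<^sup>N)\<^sup>k\<close> is a polynomial times a power of
  \<open>x\<^sub>1\<^sup>N - x\<^sub>2\<^sup>N\<close>, so that the left-hand side is a combination of left-hand sides of twisted Jacobi
  identities.  Of the \<open>N\<close> terms on the right, those with \<open>r \<noteq> 0\<close> vanish for large \<open>k\<close>, and the remaining
  one is matched by the change of variable \<open>y = (1 + x)\<^sup>N - 1\<close> in a residue.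
\<close>

unbundle Formal_Power_Series.fps_syntax
unbundle Formal_Laurent_Series.fps_syntax

text \<open>\<open>Sum_any\<close> is 0 on infinite support, so exchanging sums always requires a
  finiteness proof. Most of these rest on one fact: weights are bounded below, so a vector whose
  weights are all below \<open>min_weight\<close> is 0. Upper bounds on weights are therefore
  carried from the Virasoro operators to the series m. By homogeneity x2 can be set to 1. The
  coefficients \<open>kappa\<close> of (1 + x)^m ((1 + x)^N - 1)^d then serve twice: they expand
  powers of x2 + x0 and of (x2 + x0)^N - x2^N in the formula for \<Phi>, and as residues they
  replace the fractional binomials of the twisted delta function. The vacuum determines m because
  Y(m_p, x) applied to it starts with m_p, a triangular system; the recursion is the
  L(-1)-derivative property carried through E. A term with r \<noteq> 0 has x1/x2 equal to a
  nontrivial root of unity times 1 + x. There x1 - x2 is invertible, and a large k removes the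
  remaining pole. Equivariance of Y_W under \<sigma> is not among the axioms of a weak twisted
  module. It is derived from the twisted Jacobi identity with the vacuum as second vector, by
  Fourier inversion over Z/N.\<close>

lemma fls_deriv_power_int:
  fixes f :: "'a::field fls"
  assumes "f \<noteq> 0"
  shows "fls_deriv (f powi n) = of_int n * f powi (n - 1) * fls_deriv f"
proof (cases "n \<ge> 0")
  case True
  then obtain k where n: "n = int k" using nonneg_int_cases by blast
  show ?thesis
  proof (cases k)
    case (Suc l)
    then have "f powi n = f ^ Suc l" "f powi (n - 1) = f ^ l"
      using n by (simp_all flip: power_int_of_nat)
    then show ?thesis using Suc n by (simp add: fls_deriv_power del: power_Suc)
  qed (simp add: n)
next
  case False
  then obtain k where n: "n = - int k" "k > 0" by (metis linorder_not_le minus_minus neg_0_less_iff_less pos_int_cases)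
  have "fls_deriv (f powi n) = fls_deriv (inverse (f ^ k))"
    by (simp add: n power_int_minus)
  also have "\<dots> = - (of_nat k * f ^ (k - 1) * fls_deriv f) * (inverse (f ^ k))\<^sup>2"
    by (simp add: fls_inverse_deriv fls_deriv_power)
  also have "f ^ (k - 1) * (inverse (f ^ k))\<^sup>2 = f powi (n - 1)"
  proof -
    have "f ^ (k - 1) = f powi (int k - 1)" using n by (simp add: of_nat_diff flip: power_int_of_nat)
    moreover have "(inverse (f ^ k))\<^sup>2 = f powi (- int k - int k)"
    proof -
      have "inverse (f ^ k) = f powi (- int k)" by (simp add: power_int_minus)
      moreover have "f powi (- int k) * f powi (- int k) = f powi (- int k + - int k)"
        using assms by (subst power_int_add) auto
      ultimately show ?thesis by (simp add: power2_eq_square)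
    qed
    ultimately show ?thesis using assms by (simp add: n flip: power_int_add)
  qed
  then have "- (of_nat k * f ^ (k - 1) * fls_deriv f) * (inverse (f ^ k))\<^sup>2
     = of_int n * f powi (n - 1) * fls_deriv f"
    by (simp add: n mult_ac)
  finally show ?thesis .
qed

section \<open>Laurent coefficients in 1 + x, and their residues\<close>

definition one_plus_X :: "complex fls" where "one_plus_X = 1 + fls_X"
definition power_minus_1 :: "nat \<Rightarrow> complex fls" where "power_minus_1 N = one_plus_X ^ N - 1"

text \<open>By homogeneity, the coefficient of x0^a in (x2 + x0)^m ((x2 + x0)^N - x2^N)^d, up to the
  power x2^(m + N d - a). For negative \<open>d\<close> the expansion is still in powers of x0, with
  a pole of order -d.\<close>

definition kappa :: "nat \<Rightarrow> int \<Rightarrow> int \<Rightarrow> int \<Rightarrow> complex" where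
  "kappa N m d a = (one_plus_X powi m * power_minus_1 N powi d) $$ a"

lemma one_plus_X_nonzero [simp]: "one_plus_X \<noteq> 0"
proof
  assume "one_plus_X = 0"
  then have "one_plus_X $$ 0 = 0" by simp
  then show False by (simp add: one_plus_X_def)
qed

lemma one_plus_X_powi: "one_plus_X powi n = fps_to_fls (fps_binomial (of_int n))"
  by (simp add: one_plus_X_def one_plus_fls_X_powi_eq)

lemma one_plus_X_power: "one_plus_X ^ n = fps_to_fls (fps_binomial (of_nat n))"
  using one_plus_X_powi[of "int n"] by simp

lemma power_minus_1_nth: "power_minus_1 N $$ k = (if k \<le> 0 then 0 else of_nat N gchoose nat k)"
  by (simp add: power_minus_1_def one_plus_X_power)

lemma fls_subdegree_one_plus_X [simp]: "fls_subdegree one_plus_X = 0"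
  by (rule fls_subdegree_eqI) (auto simp: one_plus_X_def)

lemma fls_subdegree_power_minus_1 [simp]: "N > 0 \<Longrightarrow> fls_subdegree (power_minus_1 N) = 1"
  by (rule fls_subdegree_eqI) (auto simp: power_minus_1_nth)

lemma power_minus_1_nonzero [simp]: "N > 0 \<Longrightarrow> power_minus_1 N \<noteq> 0"
  using fls_subdegree_power_minus_1[of N] by (metis fls_zero_subdegree zero_neq_one)

lemma kappa_eq_0: "N > 0 \<Longrightarrow> a < d \<Longrightarrow> kappa N m d a = 0"
  by (simp add: kappa_def fls_eq0_below_subdegree)

text \<open>The product rule for (1 + x)^e ((1 + x)^N - 1)^d, coefficient by coefficient. At c = -1
  the left-hand side is 0, as a derivative has no residue; this drives the computation of residues
  below. For general \<open>c\<close> it is the recursion behind \<open>E_creation\<close>.\<close>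

lemma kappa_deriv:
  assumes N: "N > 0"
  shows "of_int (c + 1) * kappa N e d (c + 1) =
    of_int e * kappa N (e - 1) d c + of_int d * of_nat N * kappa N (e + int N - 1) (d - 1) c"
proof -
  have h': "fls_deriv (power_minus_1 N) = of_nat N * one_plus_X powi (int N - 1)"
  proof -
    have "int N - 1 = int (N - 1)" using N by (simp add: of_nat_diff)
    then have "one_plus_X powi (int N - 1) = one_plus_X ^ (N - 1)" by (metis power_int_of_nat)
    then show ?thesis by (simp add: power_minus_1_def fls_deriv_power) (simp add: one_plus_X_def)
  qed
  have "fls_deriv (one_plus_X powi e * power_minus_1 N powi d) = of_int e * (one_plus_X powi (e - 1) * power_minus_1 N powi d)
      + of_int d * (of_nat N * ((one_plus_X powi e * one_plus_X powi (int N - 1)) * power_minus_1 N powi (d - 1)))"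
    using N by (simp add: fls_deriv_power_int h') (simp add: one_plus_X_def algebra_simps)
  also have "one_plus_X powi e * one_plus_X powi (int N - 1) = one_plus_X powi (e + int N - 1)"
    by (simp add: add_diff_eq flip: power_int_add)
  finally have "fls_deriv (one_plus_X powi e * power_minus_1 N powi d) $$ c =
      of_int e * kappa N (e - 1) d c + of_int d * (of_nat N * kappa N (e + int N - 1) (d - 1) c)"
    by (simp only: kappa_def fls_plus_nth fls_mult_of_int_nth fls_mult_of_nat_nth)
  then show ?thesis by (simp only: fls_deriv_nth kappa_def mult.assoc)
qed

text \<open>With y = (1 + x)^N - 1 and dy = N (1 + x)^(N-1) dx, the residue of (1 + x)^e y^g dx is
  that of (1/N) (1 + y)^((e + 1 - N)/N) y^g dy, a binomial coefficient. The proof replaces the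
  substitution by induction on the order of the pole.\<close>

lemma residue_binomial_power:
  assumes N: "N > 0"
  shows "kappa N e g (-1) =
    (if g < 0 then (of_int (e + 1 - int N) / of_nat N gchoose nat (- g - 1)) / of_nat N else 0)"
proof (cases "g < 0")
  case False
  then show ?thesis by (simp add: kappa_eq_0 N)
next
  case True
  have "kappa N e (- int k - 1) (-1) = (of_int (e + 1 - int N) / of_nat N gchoose k) / of_nat N" for k
  proof (induction k arbitrary: e)
    case 0
    \<comment> \<open>A simple pole: its residue is the product of the leading coefficients, 1 and
      1/N.\<close>
    have "(one_plus_X powi e * inverse (power_minus_1 N)) $$ (fls_subdegree (one_plus_X powi e) + fls_subdegree (inverse (power_minus_1 N)))
        = (one_plus_X powi e) $$ 0 * inverse (power_minus_1 N) $$ (-1)"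
      using N by (subst fls_times_base) simp
    moreover have "(one_plus_X powi e) $$ 0 = 1" by (simp add: one_plus_X_powi)
    moreover have "inverse (power_minus_1 N) $$ (-1) = 1 / of_nat N"
      using N fls_inverse_subdegree_base[of "power_minus_1 N"] by (simp add: power_minus_1_nth divide_inverse)
    ultimately show ?case using N by (simp add: kappa_def power_int_minus)
  next
    case (Suc k)
    define g where "g = - int k - 1"
    \<comment> \<open>The exponent e - N + 1 makes the second term of \<open>kappa_deriv\<close>
      carry the exponent \<open>e\<close>, with a pole one order higher than in the first.\<close>
    have "of_int (e - int N + 1) * kappa N (e - int N) g (-1) + of_int g * of_nat N * kappa N e (g - 1) (-1) = 0"
      using kappa_deriv[OF N, of "- 1" "e - int N + 1" g] by (simp del: of_int_add of_int_diff)
    then have "of_int (e - int N + 1) * kappa N (e - int N) g (-1)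
        = of_nat (Suc k) * of_nat N * kappa N e (g - 1) (-1)"
      by (simp add: g_def algebra_simps)
    then have *: "kappa N e (g - 1) (-1) =
        (of_int (e - int N + 1) / of_nat N) * kappa N (e - int N) g (-1) / of_nat (Suc k)"
      using N by (simp add: field_simps del: of_nat_Suc)
    have IH: "kappa N (e - int N) g (-1) =
         ((of_int (e + 1 - int N) / of_nat N - 1) gchoose k) / of_nat N"
      using Suc.IH[of "e - int N"] N by (simp add: g_def diff_divide_distrib add_divide_distrib algebra_simps)
    define b :: complex where "b = of_int (e + 1 - int N) / of_nat N"
    have b': "of_int (e - int N + 1) / of_nat N = b" by (simp add: b_def algebra_simps)
    have "kappa N e (g - 1) (-1) = b * (((b - 1) gchoose k) / of_nat N) / of_nat (Suc k)"
      using * IH unfolding b' b_def[symmetric] by (simp only:)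
    then have "kappa N e (g - 1) (-1) = (b * ((b - 1) gchoose k)) / of_nat (Suc k) / of_nat N"
      unfolding b_def[symmetric] by (simp add: mult_ac del: of_nat_Suc)
    also have "b * ((b - 1) gchoose k) = of_nat (Suc k) * (b gchoose Suc k)"
      by (rule gbinomial_absorption[symmetric])
    finally have "kappa N e (g - 1) (-1) = (b gchoose Suc k) / of_nat N"
      by (simp del: of_nat_Suc)
    then show ?case by (simp add: g_def b_def)
  qed
  from this[of "nat (- g - 1)"] True show ?thesis by simp
qed

lemma kappa_conv_subset:
  assumes "N > 0"
  shows "{i. kappa N m d i * kappa N m' d' (a - i) \<noteq> 0} \<subseteq> {d..a - d'}"
proof
  fix i assume "i \<in> {i. kappa N m d i * kappa N m' d' (a - i) \<noteq> 0}"
  then have "\<not> i < d" "\<not> a - i < d'" using kappa_eq_0[OF assms] by auto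
  then show "i \<in> {d..a - d'}" by simp
qed

lemma kappa_add:
  assumes N: "N > 0"
  shows "kappa N (m + m') (d + d') a = Sum_any (\<lambda>i. kappa N m d i * kappa N m' d' (a - i))"
proof -
  let ?f = "one_plus_X powi m * power_minus_1 N powi d" and ?g = "one_plus_X powi m' * power_minus_1 N powi d'"
  have "kappa N (m + m') (d + d') a = (?f * ?g) $$ a"
    using N by (simp add: kappa_def power_int_add mult_ac)
  also have "\<dots> = (\<Sum>i = d..a - d'. kappa N m d i * kappa N m' d' (a - i))"
    using N by (simp add: fls_times_nth(2) kappa_def)
  also have "\<dots> = Sum_any (\<lambda>i. kappa N m d i * kappa N m' d' (a - i))"
    by (rule Sum_any.expand_superset[symmetric, OF _ kappa_conv_subset[OF N]]) simp
  finally show ?thesis .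
qed

section \<open>Trading powers of x1 - x2 for powers of x1^N - x2^N\<close>

definition fls_eval :: "complex poly \<Rightarrow> complex fls \<Rightarrow> complex fls" where
  "fls_eval p y = poly (map_poly fls_const p) y"

lemma fls_eval_pCons [simp]: "fls_eval (pCons a p) y = fls_const a + y * fls_eval p y"
  by (simp add: fls_eval_def map_poly_pCons)

lemma fls_eval_0 [simp]: "fls_eval 0 y = 0"
  by (simp add: fls_eval_def)

lemma fls_eval_1 [simp]: "fls_eval 1 y = 1"
  by (simp add: one_pCons)

lemma fls_eval_add: "fls_eval (p + q) y = fls_eval p y + fls_eval q y"
proof -
  have "map_poly fls_const (p + q) = map_poly fls_const p + map_poly fls_const q"
    by (rule poly_eqI) (simp add: coeff_map_poly fls_plus_const)
  then show ?thesis by (simp add: fls_eval_def)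
qed

lemma fls_eval_smult: "fls_eval (smult c p) y = fls_const c * fls_eval p y"
  by (induction p) (simp_all add: fls_const_mult_const algebra_simps)

lemma fls_eval_mult: "fls_eval (p * q) y = fls_eval p y * fls_eval q y"
  by (induction p) (simp_all add: fls_eval_add fls_eval_smult algebra_simps)

lemma fls_eval_power: "fls_eval (p ^ n) y = fls_eval p y ^ n"
  by (induction n) (simp_all add: fls_eval_mult)

lemma fls_eval_altdef: "fls_eval p y = (\<Sum>r\<le>degree p. fls_const (coeff p r) * y ^ r)"
proof -
  have "degree (map_poly fls_const p) = degree p"
    by (rule degree_map_poly) simp
  then show ?thesis by (simp add: fls_eval_def poly_altdef coeff_map_poly)
qed

lemma fls_eval_diff: "fls_eval (p - q) y = fls_eval p y - fls_eval q y"
  using fls_eval_add[of "p - q" q y] by simp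

definition geo_poly :: "nat \<Rightarrow> complex poly" where
  "geo_poly N = (\<Sum>i<N. [:0, 1:] ^ i)"

lemma geo_poly_mult: "geo_poly N * [:-1, 1:] = [:0, 1:] ^ N - 1"
proof -
  have "[:-1, 1:] = [:0, 1:] - (1 :: complex poly)" by (simp add: one_pCons)
  then show ?thesis by (simp add: geo_poly_def power_diff_1_eq mult.commute)
qed

text \<open>The polynomial \<open>Q\<close> with \<open>(x1 - x2)\<^sup>n = (x1\<^sup>N - x2\<^sup>N)\<^sup>-\<^sup>M Q(x1, x2)\<close>, where \<open>M = max 0 (-n)\<close>,
  dehomogenized by \<open>x2 = 1\<close>.\<close>

definition quot_poly :: "nat \<Rightarrow> int \<Rightarrow> complex poly" where
  "quot_poly N n = geo_poly N ^ nat (- n) * [:-1, 1:] ^ nat (n + int (nat (- n)))"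

text \<open>All branches y = \<zeta> (1 + x) with \<zeta>^N = 1 satisfy the hypothesis on y^N. Then
  (y - 1) times the value of \<open>geo_poly N\<close> is (1 + x)^N - 1, so each factor
  \<open>geo_poly N\<close> trades one power of y - 1 for one power of
  \<open>power_minus_1 N\<close>.\<close>

lemma fls_eval_quot_poly:
  assumes N: "N > 0" and y: "y \<noteq> 1" "y ^ N = one_plus_X ^ N"
  shows "fls_eval (quot_poly N n) y * power_minus_1 N powi (k - int (nat (- n))) = power_minus_1 N powi k * (y - 1) powi n"
proof -
  define M where "M = nat (- n)"
  have y1: "y - 1 \<noteq> 0" using y by simp
  have lin: "fls_eval [:-1, 1:] y = y - 1"
    by (simp add: fls_const_uminus)
  have geo: "fls_eval (geo_poly N) y * (y - 1) = power_minus_1 N"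
  proof -
    have "fls_eval (geo_poly N) y * (y - 1) = fls_eval ([:0, 1:] ^ N - 1) y"
      by (simp only: fls_eval_mult lin flip: geo_poly_mult)
    then show ?thesis by (simp add: fls_eval_diff fls_eval_power y power_minus_1_def)
  qed
  have "fls_eval (quot_poly N n) y = (fls_eval (geo_poly N) y) ^ M * (y - 1) ^ nat (n + int M)"
    by (simp only: quot_poly_def M_def fls_eval_mult fls_eval_power lin)
  also have "\<dots> = (fls_eval (geo_poly N) y) ^ M * ((y - 1) ^ M * (y - 1) powi n)"
  proof -
    have "int M + n \<ge> 0" by (simp add: M_def)
    then have "(y - 1) ^ nat (n + int M) = (y - 1) powi (int M + n)"
      by (simp add: power_int_def add.commute)
    then show ?thesis using y1 by (simp add: power_int_add)
  qed
  also have "\<dots> = power_minus_1 N powi int M * (y - 1) powi n"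
    by (simp add: geo power_mult_distrib flip: mult.assoc)
      (simp add: geo flip: power_mult_distrib)
  finally have "fls_eval (quot_poly N n) y = power_minus_1 N powi int M * (y - 1) powi n" .
  then show ?thesis using N by (simp add: power_int_diff flip: M_def)
qed

text \<open>On the branch y = \<zeta> (1 + x) the polynomial turns back into (y - 1)^n. For \<zeta>
  = 1 this is x^n, and the residue reads off the coefficient of x^\<alpha> because n = - \<alpha> -
  1. For \<zeta> \<noteq> 1 the series y - 1 has a nonzero constant term, so k + d \<ge> 0 leaves no
  pole.\<close>

lemma residue_quot_poly:
  fixes \<zeta> :: complex and \<alpha> d s :: int and k :: nat
  assumes N: "N > 0" and \<zeta>: "\<zeta> ^ N = 1" and kd: "\<zeta> = 1 \<or> int k + d \<ge> 0"
  defines "n \<equiv> - \<alpha> - 1"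
  shows "(\<Sum>r\<le>degree (quot_poly N n). coeff (quot_poly N n) r * \<zeta> ^ r *
      kappa N (int r + s) (d + int k - int (nat (- n))) (-1)) = (if \<zeta> = 1 then kappa N s (int k + d) \<alpha> else 0)"
    (is "?l = _")
proof -
  let ?Q = "quot_poly N n" and ?M = "int (nat (- n))"
  define y where "y = fls_const \<zeta> * one_plus_X"
  have \<zeta>0: "\<zeta> \<noteq> 0" using \<zeta> N by (auto simp: power_0_left)
  have y1: "y - 1 = fls_const (\<zeta> - 1) + fls_const \<zeta> * fls_X"
    by (rule fls_eqI) (simp add: y_def one_plus_X_def distrib_left)
  have nth0: "(y - 1) $$ 0 = \<zeta> - 1" and nth1: "(y - 1) $$ 1 = \<zeta>" and nthn: "\<And>k. k < 0 \<Longrightarrow> (y - 1) $$ k = 0"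
    by (simp_all add: y1)
  have yN: "y ^ N = one_plus_X ^ N" by (simp add: y_def power_mult_distrib \<zeta> flip: fls_const_power)
  have yne: "y - 1 \<noteq> 0" using nth1 \<zeta>0 by fastforce
  have "?l = (\<Sum>r\<le>degree ?Q. (fls_const (coeff ?Q r) * y ^ r * (one_plus_X powi s * power_minus_1 N powi (d + int k - ?M))) $$ (-1))"
  proof (rule sum.cong, goal_cases)
    case (2 r)
    have "fls_const (coeff ?Q r) * y ^ r * (one_plus_X powi s * power_minus_1 N powi (d + int k - ?M)) =
      fls_const (coeff ?Q r * \<zeta> ^ r) * (one_plus_X powi (int r + s) * power_minus_1 N powi (d + int k - ?M))"
      by (simp add: y_def power_mult_distrib power_int_add fls_const_mult_const fls_const_power mult_ac
        flip: fls_const_mult_const)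
    then show ?case by (simp only: kappa_def fls_mult_const_nth)
  qed simp
  also have "\<dots> = (fls_eval ?Q y * (one_plus_X powi s * power_minus_1 N powi (d + int k - ?M))) $$ (-1)"
    by (simp add: fls_eval_altdef sum_distrib_right fls_nth_sum)
  also have "fls_eval ?Q y * (one_plus_X powi s * power_minus_1 N powi (d + int k - ?M)) =
      (y - 1) powi n * (one_plus_X powi s * power_minus_1 N powi (int k + d))"
    using fls_eval_quot_poly[of N y n "d + int k"] N yN yne by (simp add: mult_ac add.commute)
  also have "\<dots> $$ (-1) = (if \<zeta> = 1 then kappa N s (int k + d) \<alpha> else 0)"
  proof (cases "\<zeta> = 1")
    case True
    then have "y - 1 = fls_X" by (simp add: y1)
    then show ?thesis using True by (simp add: kappa_def n_def fls_shifted_times_simps)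
  next
    case False
    have "fls_subdegree (y - 1) = 0"
      using False by (intro fls_subdegree_eqI) (simp_all add: nth0 nthn del: fls_minus_nth)
    then have "fls_subdegree ((y - 1) powi n * (one_plus_X powi s * power_minus_1 N powi (int k + d))) = int k + d"
      using yne N by simp
    then show ?thesis using False kd by (simp add: fls_eq0_below_subdegree)
  qed
  finally show ?thesis .
qed

lemma coeff_geo_poly: "coeff (geo_poly N) i = (if i < N then 1 else 0)"
proof -
  have "geo_poly N = (\<Sum>i<N. monom 1 i)" by (simp add: geo_poly_def monom_altdef)
  then show ?thesis by (simp add: coeff_sum)
qed

lemma degree_geo_poly: "N > 0 \<Longrightarrow> degree (geo_poly N) = N - 1"
  by (intro antisym degree_le le_degree) (auto simp: coeff_geo_poly)

lemma geo_poly_nonzero: "N > 0 \<Longrightarrow> geo_poly N \<noteq> 0"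
  using coeff_geo_poly[of N 0] by auto

lemma reflect_geo_poly: "N > 0 \<Longrightarrow> reflect_poly (geo_poly N) = geo_poly N"
  by (rule poly_eqI) (auto simp: coeff_reflect_poly coeff_geo_poly degree_geo_poly)

lemma degree_quot_poly: "N > 0 \<Longrightarrow> int (degree (quot_poly N n)) = n + int N * int (nat (- n))"
proof -
  assume N: "N > 0"
  have "degree (quot_poly N n) = nat (- n) * (N - 1) + nat (n + int (nat (- n)))"
    unfolding quot_poly_def using N
    by (simp add: degree_mult_eq degree_power_eq geo_poly_nonzero degree_geo_poly)
  then show ?thesis using N by (simp add: of_nat_diff algebra_simps)
qed

text \<open>Reversal passes from the dehomogenization at x2 = 1 to that at x1 = 1, as expansions in
  x2/x1 require. \<open>geo_poly\<close> is palindromic, so only the factors x1 - x2 change.\<close>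

lemma reflect_quot_poly:
  "N > 0 \<Longrightarrow> reflect_poly (quot_poly N n) = geo_poly N ^ nat (- n) * [:1, -1:] ^ nat (n + int (nat (- n)))"
  by (simp add: quot_poly_def reflect_poly_mult reflect_poly_power reflect_geo_poly reflect_poly_pCons Poly_snoc)

text \<open>This is (x1 - x2)^n without its factor x1^n, where \<open>fps_X\<close> stands for
  x2/x1. Expansions with negative \<open>n\<close> thus become ordinary power series that can be
  multiplied.\<close>

definition one_minus_X_powi :: "int \<Rightarrow> complex fps" where
  "one_minus_X_powi n = Abs_fps (\<lambda>q. (of_int n gchoose q) * (-1) ^ q)"

lemma one_minus_X_powi_altdef: "one_minus_X_powi n = fps_binomial (of_int n) oo (fps_const (-1) * fps_X)"
  by (rule fps_ext) (simp only: one_minus_X_powi_def fps_nth_compose_linear fps_binomial_nth fps_nth_Abs_fps, rule mult.commute)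

lemma one_minus_X_powi_add: "one_minus_X_powi (m + n) = one_minus_X_powi m * one_minus_X_powi n"
  by (simp add: one_minus_X_powi_altdef fps_binomial_add_mult fps_compose_mult_distrib)

lemma one_minus_X_powi_of_nat: "one_minus_X_powi (int k) = (1 - fps_X) ^ k"
proof -
  have "(1 + fps_X :: complex fps) ^ k oo (fps_const (-1) * fps_X) = ((1 + fps_X) oo (fps_const (-1) * fps_X)) ^ k"
    by (rule fps_compose_power[symmetric]) simp
  then show ?thesis by (simp add: one_minus_X_powi_altdef fps_binomial_of_nat fps_compose_add_distrib)
qed

definition one_minus_XN_powi :: "nat \<Rightarrow> int \<Rightarrow> complex fps" where
  "one_minus_XN_powi N n = one_minus_X_powi n oo fps_X ^ N"

lemma one_minus_XN_powi_add: "N > 0 \<Longrightarrow> one_minus_XN_powi N (m + n) = one_minus_XN_powi N m * one_minus_XN_powi N n"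
  by (simp add: one_minus_XN_powi_def one_minus_X_powi_add fps_compose_mult_distrib)

lemma one_minus_XN_powi_of_nat: "N > 0 \<Longrightarrow> one_minus_XN_powi N (int k) = (1 - fps_X ^ N) ^ k"
proof -
  assume "N > 0"
  then have "(1 - fps_X) ^ k oo fps_X ^ N = ((1 - fps_X) oo fps_X ^ N :: complex fps) ^ k"
    by (intro fps_compose_power[symmetric]) simp
  with \<open>N > 0\<close> show ?thesis by (simp add: one_minus_XN_powi_def one_minus_X_powi_of_nat fps_compose_sub_distrib fps_X_fps_compose_startby0)
qed

text \<open>The identity (x1 - x2)^n (x1^N - x2^N)^k = (x1^N - x2^N)^(k - M) Q(x1, x2) in the
  expansion by x2/x1. A factor (1 - X)^M clears the negative power of 1 - X and is cancelled at the
  end.\<close>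

lemma one_minus_X_powi_quot_poly:
  assumes N: "N > 0"
  shows "one_minus_X_powi n * (1 - fps_X ^ N) ^ k = one_minus_XN_powi N (int k - int (nat (- n))) * fps_of_poly (reflect_poly (quot_poly N n))"
proof -
  define M K where "M = nat (- n)" and "K = nat (n + int (nat (- n)))"
  have K: "n + int M = int K" by (simp add: M_def K_def)
  have lin: "fps_of_poly [:1, -1:] = (1 - fps_X :: complex fps)"
    by (simp add: fps_of_poly_pCons)
  have "fps_of_poly (geo_poly N) * (1 - fps_X) = - fps_of_poly (geo_poly N * [:-1, 1:])"
    by (simp add: fps_of_poly_mult fps_of_poly_pCons algebra_simps flip: fps_const_neg)
  also have "\<dots> = 1 - fps_X ^ N"
    by (simp only: geo_poly_mult) (simp add: fps_of_poly_diff fps_of_poly_power fps_of_poly_pCons)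
  finally have geo: "fps_of_poly (geo_poly N) * (1 - fps_X) = 1 - fps_X ^ N" .
  have 1: "one_minus_X_powi n * (1 - fps_X) ^ M = (1 - fps_X) ^ K"
    by (simp only: flip: one_minus_X_powi_add one_minus_X_powi_of_nat K)
  have 2: "(1 - fps_X ^ N) ^ k = one_minus_XN_powi N (int k - int M) * (fps_of_poly (geo_poly N) * (1 - fps_X)) ^ M"
    using one_minus_XN_powi_add[OF N, of "int k - int M" "int M"] N by (simp add: one_minus_XN_powi_of_nat geo)
  have "one_minus_X_powi n * (1 - fps_X ^ N) ^ k * (1 - fps_X) ^ M = (1 - fps_X) ^ K * (1 - fps_X ^ N) ^ k"
    by (simp only: 1[symmetric] mult_ac)
  also have "\<dots> = one_minus_XN_powi N (int k - int M) * fps_of_poly (reflect_poly (quot_poly N n)) * (1 - fps_X) ^ M"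
    unfolding reflect_quot_poly[OF N] 2 K_def[symmetric] unfolding M_def[symmetric]
    by (simp only: fps_of_poly_mult fps_of_poly_power lin power_mult_distrib mult_ac)
  finally have *: "one_minus_X_powi n * (1 - fps_X ^ N) ^ k * (1 - fps_X) ^ M =
      one_minus_XN_powi N (int k - int M) * fps_of_poly (reflect_poly (quot_poly N n)) * (1 - fps_X) ^ M" .
  have "(1 - fps_X :: complex fps) \<noteq> 0" 
      by (metis fps_X_neq_one eq_iff_diff_eq_0)
  with * show ?thesis by (simp add: M_def)
qed

text \<open>In the expansion by x1/x2 it is \<open>quot_poly\<close> itself that appears, and
  exchanging x1 and x2 gives a sign for each power of a difference.\<close>

lemma one_minus_X_powi_quot_poly':
  assumes N: "N > 0"
  shows "fps_const ((-1) powi n * (-1) ^ k) * (one_minus_X_powi n * (1 - fps_X ^ N) ^ k)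
    = fps_const ((-1) powi (int k - int (nat (- n)))) * (one_minus_XN_powi N (int k - int (nat (- n))) * fps_of_poly (quot_poly N n))"
proof -
  define M K where "M = nat (- n)" and "K = nat (n + int (nat (- n)))"
  have K: "int K = n + int M" by (simp add: M_def K_def)
  have "[:1, -1:] = smult (-1) [:-1, 1 :: complex:]" by simp
  then have "[:1, -1 :: complex:] ^ K = smult ((-1) ^ K) ([:-1, 1:] ^ K)"
    by (simp only: smult_power)
  then have r: "reflect_poly (quot_poly N n) = smult ((-1) ^ K) (quot_poly N n)"
    unfolding reflect_quot_poly[OF N] unfolding quot_poly_def K_def[symmetric] by simp
  have "(-1) powi n * (-1) ^ k * (-1) ^ K = (-1) powi n * (-1) powi int k * (-1 :: complex) powi int K"
    by simp
  also have "\<dots> = (-1) powi (n + int k + (n + int M))"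
    by (simp add: K power_int_add)
  also have "\<dots> = (-1 :: complex) powi (int k - int M)"
  proof -
    \<comment> \<open>The sign (-1)^K comes from the reversed factors x1 - x2; as K = n + M, the
      total exponent differs from k - M by an even number.\<close>
    have "n + int k + (n + int M) = (int k - int M) + 2 * (n + int M)" by simp
    moreover have "(-1 :: complex) powi (2 * j) = 1" for j
      by (simp add: power_int_mult)
    moreover have "(-1 :: complex) powi (i + 2 * j) = (-1) powi i * (-1) powi (2 * j)" for i j
      by (rule power_int_add) simp
    ultimately show ?thesis by (metis mult.right_neutral)
  qed
  finally have s: "(-1) powi n * (-1) ^ k * (-1) ^ K = (-1 :: complex) powi (int k - int M)" .
  show ?thesis
    unfolding one_minus_X_powi_quot_poly[OF N] r fps_of_poly_smult M_def[symmetric] s[symmetric]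
    by (simp add: mult_ac flip: fps_const_mult)
qed

text \<open>Taylor expansion of the d-th power at x: F^d is the sum of (d choose k) x^(d-k) (F -
  x)^k, which is the binomial series in P = (F - x)/x. As F = x + O(x^2), this P has no constant
  term.\<close>

lemma powi_taylor:
  fixes F A :: "complex fps"
  assumes F: "F $ 0 = 0" "F $ 1 = 1"
  shows "(fps_to_fls A * fps_to_fls F powi d) $$ c =
     (if c < d then 0 else \<Sum>k\<le>nat (c - d). (of_int d gchoose k) * (A * (F - fps_X) ^ k) $ (nat (c - d) + k))"
proof -
  define P where "P = fps_shift 1 (F - fps_X)"
  have P0: "P $ 0 = 0" using F by (simp add: P_def)
  have FP: "F - fps_X = fps_X * P"
    using F by (intro fps_ext) (auto simp: P_def)
  have "F = fps_X * (1 + P)"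
    using FP by (simp add: algebra_simps)
  then have Fl: "fps_to_fls F = fls_X * fps_to_fls (1 + P)"
    by (metis fls_times_fps_to_fls fps_X_to_fls)
  have comp: "fps_to_fls (1 + P) powi d = fps_to_fls (fps_binomial (of_int d) oo P)"
  \<comment> \<open>Composition of Laurent series is applied for nonzero \<open>P\<close> only; for
    P = 0 both sides are 1.\<close>
  proof (cases "P = 0")
    case False
    have "fls_compose_fps ((1 + fls_X) powi d) P = fls_compose_fps (1 + fls_X) P powi d"
      by (rule fls_compose_fps_powi) (use False P0 in auto)
    then show ?thesis
      using False P0 by (simp add: one_plus_fls_X_powi_eq fls_compose_fps_add)
  qed (simp add: fps_compose_0_right)
  have coef: "(A * (fps_binomial (of_int d) oo P)) $ j = (\<Sum>k\<le>j. (of_int d gchoose k) * (A * P ^ k) $ j)" for j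
  proof -
    have "(A * (fps_binomial (of_int d) oo P)) $ j
        = (\<Sum>i\<le>j. A $ i * (\<Sum>k\<le>j. (of_int d gchoose k) * P ^ k $ (j - i)))"
    proof -
      have "(\<Sum>k\<le>j - i. (of_int d gchoose k) * P ^ k $ (j - i))
          = (\<Sum>k\<le>j. (of_int d gchoose k) * P ^ k $ (j - i))" for i
        using P0 by (intro sum.mono_neutral_left) (auto simp: startsby_zero_power_prefix)
      then show ?thesis
        by (simp add: fps_mult_nth fps_compose_nth atLeast0AtMost)
    qed
    also have "\<dots> = (\<Sum>k\<le>j. (of_int d gchoose k) * (\<Sum>i\<le>j. A $ i * P ^ k $ (j - i)))"
      unfolding sum_distrib_left by (subst sum.swap) (simp add: mult_ac)
    finally show ?thesis by (simp add: fps_mult_nth atLeast0AtMost)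
  qed
  have "(fps_to_fls A * fps_to_fls F powi d) $$ c =
      fps_to_fls (A * (fps_binomial (of_int d) oo P)) $$ (c - d)"
    by (simp add: Fl power_int_mult_distrib comp fls_times_fps_to_fls fls_shifted_times_simps del: fps_to_fls_plus)
  moreover have "(A * (F - fps_X) ^ k) $ (j + k) = (A * P ^ k) $ j" for j k
  proof -
    have "A * (F - fps_X) ^ k = fps_X ^ k * (A * P ^ k)" by (simp add: FP power_mult_distrib mult_ac)
    then show ?thesis by (simp only: fps_X_power_mult_nth) simp
  qed
  ultimately show ?thesis by (simp add: coef)
qed

section \<open>Rearranging sums of finite support\<close>

lemma Sum_any_eq_sum:
  assumes "finite A" "\<And>a. a \<notin> A \<Longrightarrow> g a = 0"
  shows "Sum_any g = sum g A"
proof (rule Sum_any.expand_superset)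
  show "{a. g a \<noteq> 0} \<subseteq> A"
  proof
    fix a assume "a \<in> {a. g a \<noteq> 0}"
    then show "a \<in> A" using assms(2)[of a] by (cases "a \<in> A") simp_all
  qed
qed (rule assms)

lemma Sum_any_reindex_inj:
  assumes "inj \<iota>" "\<And>d. d \<notin> range \<iota> \<Longrightarrow> g d = 0"
  shows "Sum_any g = Sum_any (\<lambda>i. g (\<iota> i))"
proof -
  have "{d. g d \<noteq> 0} = \<iota> ` {i. g (\<iota> i) \<noteq> 0}"
  proof (intro equalityI subsetI)
    fix d assume "d \<in> {d. g d \<noteq> 0}"
    moreover from this have "d \<in> range \<iota>" using assms(2)[of d] by auto
    ultimately show "d \<in> \<iota> ` {i. g (\<iota> i) \<noteq> 0}" by auto
  qed auto
  then show ?thesis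
    unfolding Sum_any.expand_set
    using sum.reindex[OF inj_on_subset[OF assms(1)], of "{i. g (\<iota> i) \<noteq> 0}" g] by simp
qed

lemma Sum_any_additive:
  fixes f :: "'a::ab_group_add \<Rightarrow> 'b::ab_group_add"
  assumes add: "\<And>x y. f (x + y) = f x + f y" and fin: "finite {i. g i \<noteq> 0}"
  shows "f (Sum_any g) = Sum_any (\<lambda>i. f (g i))"
proof -
  have f0: "f 0 = 0" using add[of 0 0] by simp
  have "f (sum g A) = (\<Sum>i\<in>A. f (g i))" if "finite A" for A
    using that by (induction A) (simp_all add: f0 add)
  with fin have "f (Sum_any g) = (\<Sum>i\<in>{i. g i \<noteq> 0}. f (g i))" by (simp add: Sum_any.expand_set)
  also have "\<dots> = Sum_any (\<lambda>i. f (g i))"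
    by (rule Sum_any_eq_sum[symmetric]) (use fin f0 in auto)
  finally show ?thesis .
qed

lemma Sum_any_iterated:
  assumes fin: "finite {(a, b). g a b \<noteq> 0}"
  shows "Sum_any (\<lambda>a. Sum_any (g a)) = Sum_any (\<lambda>(a, b). g a b)"
proof -
  let ?S = "{(a, b). g a b \<noteq> 0}"
  have "finite ((fst ` ?S) \<times> (snd ` ?S))" using fin by blast
  moreover have "{a. \<exists>b. g a b \<noteq> 0} \<times> {b. \<exists>a. g a b \<noteq> 0} \<subseteq> (fst ` ?S) \<times> (snd ` ?S)"
    by force
  ultimately show ?thesis by (rule Sum_any.cartesian_product)
qed

lemma Sum_any_swap_finite:
  assumes fin: "finite {(a, b). g a b \<noteq> 0}"
  shows "Sum_any (\<lambda>a. Sum_any (g a)) = Sum_any (\<lambda>b. Sum_any (\<lambda>a. g a b))"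
proof -
  let ?S = "{(a, b). g a b \<noteq> 0}"
  have "finite ((fst ` ?S) \<times> (snd ` ?S))" using fin by blast
  moreover have "{a. \<exists>b. g a b \<noteq> 0} \<times> {b. \<exists>a. g a b \<noteq> 0} \<subseteq> (fst ` ?S) \<times> (snd ` ?S)"
    by force
  ultimately show ?thesis by (rule Sum_any.swap)
qed

lemma Sum_any_finite_image:
  assumes "finite {i. g i \<noteq> 0}" "\<And>i. g i = 0 \<Longrightarrow> f i = 0"
  shows "finite {i. f i \<noteq> 0}"
  by (rule finite_subset[OF _ assms(1)]) (use assms(2) in blast)

lemma finite_nonzero_sum:
  assumes "finite S" "\<And>n. n \<in> S \<Longrightarrow> finite {p. f n p \<noteq> 0}"
  shows "finite {p. (\<Sum>n\<in>S. f n p) \<noteq> 0}"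
proof (rule finite_subset)
  show "{p. (\<Sum>n\<in>S. f n p) \<noteq> 0} \<subseteq> (\<Union>n\<in>S. {p. f n p \<noteq> 0})"
    by (auto intro: ccontr sum.neutral)
qed (use assms in blast)

lemma Sum_any_sum:
  assumes "finite S" "\<And>n. n \<in> S \<Longrightarrow> finite {p. f n p \<noteq> 0}"
  shows "Sum_any (\<lambda>p. \<Sum>n\<in>S. f n p) = (\<Sum>n\<in>S. Sum_any (f n))"
  using assms
proof (induction S)
  case (insert x S)
  then show ?case by (simp add: Sum_any.distrib finite_nonzero_sum)
qed simp

text \<open>Summation by antidiagonals: a bound on i + j over the support reduces both sides to one
  finite triangle.\<close>

lemma Sum_any_diagonal:
  fixes b :: "nat \<Rightarrow> nat \<Rightarrow> 'a::comm_monoid_add"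
  assumes fin: "finite {(i, j). b i j \<noteq> 0}"
  shows "Sum_any (\<lambda>k. \<Sum>i\<le>k. b i (k - i)) = Sum_any (\<lambda>(i, j). b i j)"
proof -
  let ?S = "{(i, j). b i j \<noteq> 0}"
  obtain K where K: "\<And>i j. b i j \<noteq> 0 \<Longrightarrow> i + j < K"
  proof -
    have "finite ((\<lambda>(i, j). i + j) ` ?S)" using fin by blast
    then obtain K where "\<forall>x\<in>(\<lambda>(i, j). i + j) ` ?S. x < K"
      using finite_nat_set_iff_bounded by blast
    then show ?thesis using that by (auto simp: image_iff)
  qed
  have "Sum_any (\<lambda>k. \<Sum>i\<le>k. b i (k - i)) = (\<Sum>k<K. \<Sum>i\<le>k. b i (k - i))"
  proof (rule Sum_any_eq_sum)
    fix k assume "k \<notin> {..<K}"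
    then show "(\<Sum>i\<le>k. b i (k - i)) = 0"
      using K by (intro sum.neutral) (metis atMost_iff lessThan_iff le_add_diff_inverse)
  qed simp
  also have "\<dots> = (\<Sum>(i, j)\<in>{(i, j). i + j < K}. b i j)"
    by (rule sum.triangle_reindex[symmetric])
  also have "\<dots> = Sum_any (\<lambda>(i, j). b i j)"
  proof (rule Sum_any_eq_sum[symmetric])
    have "{(i, j). i + j < K} \<subseteq> {..<K} \<times> {..<K}" by auto
    then show "finite {(i, j). i + j < K}" by (rule finite_subset) simp
  qed (use K in auto)
  finally show ?thesis .
qed

context vector_space begin

text \<open>Holds for infinite support too: a nonzero scalar preserves the support, so both sides
  take the default value 0 together.\<close>

lemma scale_Sum_any: "scale c (Sum_any g) = Sum_any (\<lambda>i. scale c (g i))"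
proof (cases "c = 0")
  case False
  show ?thesis
  proof (cases "finite {i. g i \<noteq> 0}")
    case True
    then show ?thesis by (rule Sum_any_additive[OF scale_right_distrib])
  next
    case inf: False
    moreover have "{i. scale c (g i) \<noteq> 0} = {i. g i \<noteq> 0}" using False by simp
    ultimately show ?thesis by simp
  qed
qed simp

end

section \<open>Vertex operators, commutators and the grading\<close>

locale vertex_map_space = V: vector_space sV + W: vector_space sW
  for sV :: "complex \<Rightarrow> 'v::ab_group_add \<Rightarrow> 'v" and sW :: "complex \<Rightarrow> 'w::ab_group_add \<Rightarrow> 'w" +
  fixes YW :: "'v \<Rightarrow> int \<Rightarrow> 'w \<Rightarrow> 'w"
  assumes vmap: "vertex_map sV sW YW"
begin

lemma Y_add_left: "YW (u + v) n w = YW u n w + YW v n w"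
  and Y_scale_left: "YW (sV c u) n w = sW c (YW u n w)"
proof -
  have "Vector_Spaces.linear sV sW (\<lambda>v. YW v n w)"
    using vmap unfolding vertex_map_def by blast
  then interpret f: Vector_Spaces.linear sV sW "\<lambda>v. YW v n w" .
  show "YW (u + v) n w = YW u n w + YW v n w" "YW (sV c u) n w = sW c (YW u n w)"
    by (rule f.add, rule f.scale)
qed

lemma Y_add_right: "YW u n (w + w') = YW u n w + YW u n w'"
  and Y_scale_right: "YW u n (sW c w) = sW c (YW u n w)"
proof -
  have "Vector_Spaces.linear sW sW (YW u n)"
    using vmap unfolding vertex_map_def by blast
  then interpret f: Vector_Spaces.linear sW sW "YW u n" .
  show "YW u n (w + w') = YW u n w + YW u n w'" "YW u n (sW c w) = sW c (YW u n w)"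
    by (rule f.add, rule f.scale)
qed

lemma Y_zero_left [simp]: "YW 0 n w = 0"
  using Y_add_left[of 0 0 n w] by simp

lemma Y_zero_right [simp]: "YW u n 0 = 0"
  using Y_add_right[of u n 0 0] by simp

lemma Y_truncated: "\<exists>m. \<forall>n<m. YW u n w = 0"
  using vmap unfolding vertex_map_def by blast

lemma Y_sum_left: "YW (sum f A) n w = (\<Sum>i\<in>A. YW (f i) n w)"
  by (induction A rule: infinite_finite_induct) (simp_all add: Y_add_left)

lemma Y_sum_right: "YW u n (sum f A) = (\<Sum>i\<in>A. YW u n (f i))"
  by (induction A rule: infinite_finite_induct) (simp_all add: Y_add_right)

lemma Y_Sum_any_left: "finite {i. f i \<noteq> 0} \<Longrightarrow> YW (Sum_any f) n w = Sum_any (\<lambda>i. YW (f i) n w)"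
  by (rule Sum_any_additive[where f = "\<lambda>v. YW v n w"]) (rule Y_add_left)

lemma Y_Sum_any_right: "finite {i. f i \<noteq> 0} \<Longrightarrow> YW u n (Sum_any f) = Sum_any (\<lambda>i. YW u n (f i))"
  by (rule Sum_any_additive) (rule Y_add_right)

end

context vertex_operator_algebra begin

sublocale vertex_map_space scale scale Y
  by unfold_locales (rule vertex_map)

abbreviation L :: "int \<Rightarrow> 'v \<Rightarrow> 'v" where "L \<equiv> virasoro Y conf"

abbreviation comp :: "int \<Rightarrow> 'v \<Rightarrow> 'v" where "comp n v \<equiv> homogeneous_component grade v n"

lemma L_add: "L n (u + v) = L n u + L n v"
  by (simp add: virasoro_def Y_add_right)

lemma L_scale: "L n (scale c v) = scale c (L n v)"
  by (simp add: virasoro_def Y_scale_right)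

lemma L_zero [simp]: "L n 0 = 0"
  by (simp add: virasoro_def)

lemma L_Sum_any: "finite {i. f i \<noteq> 0} \<Longrightarrow> L n (Sum_any f) = Sum_any (\<lambda>i. L n (f i))"
  by (rule Sum_any_additive) (rule L_add)

lemma L_sum: "L n (sum f A) = (\<Sum>i\<in>A. L n (f i))"
  by (induction A rule: infinite_finite_induct) (simp_all add: L_add)

lemma L_truncated: "\<exists>M. \<forall>n>M. L n v = 0"
proof -
  obtain m where "\<forall>n<m. Y conf n v = 0" using Y_truncated by blast
  then have "\<forall>n>-m-2. L n v = 0" by (simp add: virasoro_def)
  then show ?thesis by blast
qed

text \<open>The coefficient of x0^-1 in the Jacobi identity. On the left it involves only (x1 -
  x2)^0 = 1, so each product collapses to a single term.\<close>

lemma commutator: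
  "Y u b (Y v c w) - Y v c (Y u b w) =
     Sum_any (\<lambda>i::nat. scale ((-1) ^ i * (of_int (b + int i) gchoose i)) (Y (Y u (- 1 - int i) v) (c + 1 + b + int i) w))"
proof -
  have p1: "formal_prod scale (poly_series 1) g = g" for g :: "int \<times> int \<times> int \<Rightarrow> 'v"
  proof
    fix e :: "int \<times> int \<times> int"
    have "poly_series 1 d = (if d = 0 then 1 else 0)" for d
      by (cases d) (auto simp: poly_series_def zero_prod_def coeff_1 split: prod.splits)
    then have "scale (poly_series 1 d) (g (e - d)) = (if d = 0 then g e else 0)" for d by simp
    then show "formal_prod scale (poly_series 1) g e = g e" by (simp add: formal_prod_def)
  qed
  have g0: "(0 :: complex) gchoose k = (if k = 0 then 1 else 0)" for k
    by (cases k) simp_all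
  have d12: "formal_prod scale delta_12_0 (vprod_12 Y u v w) (-1, b, c) = Y u b (Y v c w)"
  proof -
    have "scale (delta_12_0 d) (vprod_12 Y u v w ((-1, b, c) - d)) = (if d = (-1, 0, 0) then Y u b (Y v c w) else 0)" for d
      by (cases d) (auto simp: delta_12_0_def vprod_12_def binom_series_def g0)
    then show ?thesis by (simp add: formal_prod_def)
  qed
  have d21: "formal_prod scale delta_21_0 (vprod_21 Y u v w) (-1, b, c) = Y v c (Y u b w)"
  proof -
    have "scale (delta_21_0 d) (vprod_21 Y u v w ((-1, b, c) - d)) = (if d = (-1, 0, 0) then Y v c (Y u b w) else 0)" for d
      by (cases d) (auto simp: delta_21_0_def vprod_21_def binom_series_def g0)
    then show ?thesis by (simp add: formal_prod_def)
  qed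
  have d10: "formal_prod scale delta_10_2 (viter Y Y u v w) (-1, b, c) =
    Sum_any (\<lambda>i::nat. scale ((-1) ^ i * (of_int (b + int i) gchoose i)) (Y (Y u (- 1 - int i) v) (c + 1 + b + int i) w))"
    unfolding formal_prod_def
  proof (subst Sum_any_reindex_inj[where \<iota> = "\<lambda>i::nat. (int i, b, - 1 - int i - b)"])
    fix d assume "d \<notin> range (\<lambda>i::nat. (int i, b, - 1 - int i - b))"
    moreover have "d \<in> range (\<lambda>i::nat. (int i, b, - 1 - int i - b))"
      if "scale (delta_10_2 d) (viter Y Y u v w ((-1, b, c) - d)) \<noteq> 0"
    proof -
      obtain x y z where d: "d = (x, y, z)" by (cases d)
      have "y = b" "x \<ge> 0" "z = - 1 - x - b"
        using that by (auto simp: d delta_10_2_def viter_def binom_series_def split: if_splits)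
      then have "d = (int (nat x), b, - 1 - int (nat x) - b)" by (simp add: d)
      then show ?thesis by blast
    qed
    ultimately show "scale (delta_10_2 d) (viter Y Y u v w ((-1, b, c) - d)) = 0" by blast
  next
    have "delta_10_2 (int i, b, - 1 - int i - b) = (-1) ^ i * (of_int (b + int i) gchoose i)" for i
    proof -
      have "- (- 1 - int i - b) - 1 = b + int i" by simp
      then show ?thesis by (simp add: delta_10_2_def binom_series_def mult.commute)
    qed
    moreover have "viter Y Y u v w ((-1, b, c) - (int i, b, - 1 - int i - b)) =
        Y (Y u (- 1 - int i) v) (c + 1 + b + int i) w" for i
    proof -
      have e: "c - (- 1 - int i - b) = c + 1 + b + int i" by simp
      show ?thesis by (simp only: viter_def diff_Pair prod.case e) simp
    qed
    ultimately show "Sum_any (\<lambda>i. scale (delta_10_2 (int i, b, - 1 - int i - b))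
          (viter Y Y u v w ((-1, b, c) - (int i, b, - 1 - int i - b)))) =
        Sum_any (\<lambda>i::nat. scale ((-1) ^ i * (of_int (b + int i) gchoose i)) (Y (Y u (- 1 - int i) v) (c + 1 + b + int i) w))"
      by presburger
  qed (simp add: inj_def)
  show ?thesis
    using jacobi[of u v, unfolded quasi_jacobi_def p1, rule_format, of w "(-1, b, c)"]
    unfolding d12 d21 d10 .
qed

text \<open>The commutator formula for \<open>conf\<close>, where L(n - 1) sits at exponent -1 - n.
  For natural \<open>n\<close> the generalized binomials become (n choose i) and the sum stops at
  \<open>n\<close>. Indexing by n with L(n - 1) anticipates the pairing of L(n - 1) with
  x^n.\<close>

lemma L_Y_commutator:
  "L (int n - 1) (Y u c v) - Y u c (L (int n - 1) v) =
     (\<Sum>i\<le>n. scale (of_nat (n choose i)) (Y (L (int i - 1) u) (c - int n + int i) v))"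
proof -
  have binom: "(-1) ^ i * (of_int (- int n - 1 + int i) gchoose i) = (of_nat (n choose i) :: complex)" for i
    using gbinomial_negated_upper[of "of_nat n :: complex" i]
    by (simp add: binomial_gbinomial algebra_simps)
  have "L (int n - 1) (Y u c v) - Y u c (L (int n - 1) v) =
     Sum_any (\<lambda>i::nat. scale (of_nat (n choose i)) (Y (L (int i - 1) u) (c - int n + int i) v))"
  proof -
    have 1: "L (int m - 1) = Y conf (- 1 - int m)" for m
      by (simp add: virasoro_def)
    have 2: "c + 1 + (- 1 - int n) + int i = c - int n + int i" for i by simp
    have 3: "(-1) ^ i * (of_int (- 1 - int n + int i) gchoose i) = (of_nat (n choose i) :: complex)" for i
      using binom[of i] by (simp add: algebra_simps)
    show ?thesis using commutator[of conf "- 1 - int n" u c v] unfolding 1 2 3 .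
  qed
  also have "\<dots> = (\<Sum>i\<le>n. scale (of_nat (n choose i)) (Y (L (int i - 1) u) (c - int n + int i) v))"
    by (rule Sum_any_eq_sum) auto
  finally show ?thesis .
qed

subsection \<open>The grading\<close>

lemma decomposition: "homogeneous_decomposition grade v (homogeneous_component grade v)"
  using theI'[OF grade_direct_sum[of v]] by (simp add: homogeneous_component_def)

lemma comp_in_grade: "comp n v \<in> grade n"
  and finite_comp: "finite {n. comp n v \<noteq> 0}"
  and Sum_any_comp: "Sum_any (\<lambda>n. comp n v) = v"
  using decomposition[of v] unfolding homogeneous_decomposition_def by auto

lemma comp_eqI: "homogeneous_decomposition grade v f \<Longrightarrow> comp n v = f n"
  using grade_direct_sum decomposition by metis

lemma comp_add: "comp n (u + v) = comp n u + comp n v"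
proof (rule comp_eqI)
  have "finite {n. comp n u + comp n v \<noteq> 0}"
    by (rule finite_subset[of _ "{n. comp n u \<noteq> 0} \<union> {n. comp n v \<noteq> 0}"]) (auto simp: finite_comp)
  then show "homogeneous_decomposition grade (u + v) (\<lambda>n. comp n u + comp n v)"
    by (simp add: homogeneous_decomposition_def grade_subspace subspace_add comp_in_grade
      Sum_any.distrib finite_comp Sum_any_comp)
qed

lemma comp_scale: "comp n (scale c v) = scale c (comp n v)"
proof (rule comp_eqI)
  have "finite {n. scale c (comp n v) \<noteq> 0}"
    by (rule finite_subset[OF _ finite_comp[of v]]) auto
  then show "homogeneous_decomposition grade (scale c v) (\<lambda>n. scale c (comp n v))"
    by (simp add: homogeneous_decomposition_def grade_subspace subspace_scale comp_in_grade
      Sum_any_comp flip: scale_Sum_any)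
qed

lemma comp_grade: "v \<in> grade h \<Longrightarrow> comp n v = (if n = h then v else 0)"
  by (rule comp_eqI) (auto simp: homogeneous_decomposition_def grade_subspace subspace_0)

lemma comp_zero [simp]: "comp n 0 = 0"
  using comp_add[of 0 0 n] by simp

lemma comp_Sum_any: "finite {i. f i \<noteq> 0} \<Longrightarrow> comp n (Sum_any f) = Sum_any (\<lambda>i. comp n (f i))"
  by (rule Sum_any_additive) (rule comp_add)

lemma comp_sum: "comp n (sum f A) = (\<Sum>i\<in>A. comp n (f i))"
  by (induction A rule: infinite_finite_induct) (simp_all add: comp_add)

lemma comp_comp: "comp m (comp n v) = (if m = n then comp n v else 0)"
  by (rule comp_grade) (rule comp_in_grade)

lemma comp_L0: "comp n (L 0 v) = scale (of_int n) (comp n v)"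
proof -
  have "L 0 v = Sum_any (\<lambda>k. L 0 (comp k v))"
    using L_Sum_any[OF finite_comp, of 0 v] by (simp add: Sum_any_comp)
  also have "\<dots> = Sum_any (\<lambda>k. scale (of_int k) (comp k v))"
    using L0_grade[OF comp_in_grade] by simp
  finally have "comp n (L 0 v) = Sum_any (\<lambda>k. comp n (scale (of_int k) (comp k v)))"
    by (subst comp_Sum_any[symmetric]) (auto intro: finite_subset[OF _ finite_comp[of v]])
  then show ?thesis
    by (simp add: comp_scale comp_comp if_distrib[of "scale _"] cong: if_cong)
qed

text \<open>Weight spaces are eigenspaces of L(0) with distinct eigenvalues, so an eigenvector has a
  single component. This lets weights be computed from commutators with L(0).\<close>

lemma grade_eigen: "v \<in> grade n \<longleftrightarrow> L 0 v = scale (of_int n) v"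
proof
  assume eig: "L 0 v = scale (of_int n) v"
  have "comp m v = 0" if "m \<noteq> n" for m
  proof -
    have "comp m (L 0 v) = scale (of_int m) (comp m v)" by (rule comp_L0)
    moreover have "comp m (L 0 v) = scale (of_int n) (comp m v)"
      by (simp only: eig comp_scale)
    ultimately have "scale (of_int m - of_int n) (comp m v) = 0"
      by (simp only: scale_left_diff_distrib) simp
    moreover have "(of_int m - of_int n :: complex) \<noteq> 0" using that by simp
    ultimately show ?thesis by (simp only: scale_eq_0_iff) blast
  qed
  then have "v = comp n v"
    using Sum_any_comp[of v] Sum_any_eq_sum[of "{n}" "\<lambda>k. comp k v"] by auto
  then show "v \<in> grade n" using comp_in_grade by metis
qed (rule L0_grade)

text \<open>From [L(0), Y(u, x)] = x d/dx Y(u, x) + Y(L(0) u, x). Since \<open>c\<close> is an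
  exponent of x and not a mode number, the usual shift by 1 is absent.\<close>

lemma Y_in_grade:
  assumes "u \<in> grade h" "v \<in> grade s"
  shows "Y u c v \<in> grade (h + s + c)"
proof -
  have "L 0 (Y u c v) - Y u c (L 0 v) = scale (of_int c) (Y u c v) + Y (L 0 u) c v"
    using L_Y_commutator[of 1 u c v] L_minus1_derivative[of u "c - 1" v] by simp
  then have "L 0 (Y u c v) = scale (of_int c) (Y u c v) + scale (of_int h) (Y u c v) + scale (of_int s) (Y u c v)"
    using assms by (simp add: L0_grade Y_scale_left Y_scale_right algebra_simps)
  then show ?thesis by (simp add: grade_eigen scale_left_distrib algebra_simps)
qed

lemma L_in_grade: "v \<in> grade s \<Longrightarrow> L n v \<in> grade (s - n)"
  using Y_in_grade[OF conf_grade, of v s "- n - 2"] by (simp add: virasoro_def algebra_simps)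

lemma comp_L: "comp n (L k v) = L k (comp (n + k) v)"
proof -
  have fin: "finite {j. L k (comp j v) \<noteq> 0}"
    by (rule Sum_any_finite_image[OF finite_comp[of v]]) simp
  have "L k v = Sum_any (\<lambda>j. L k (comp j v))"
    using L_Sum_any[OF finite_comp, of k v] by (simp add: Sum_any_comp)
  then have "comp n (L k v) = Sum_any (\<lambda>j. comp n (L k (comp j v)))"
    by (simp only: comp_Sum_any[OF fin])
  also have "\<dots> = Sum_any (\<lambda>j. if j = n + k then L k (comp j v) else 0)"
    using comp_grade[OF L_in_grade[OF comp_in_grade]] by (intro Sum_any.cong) auto
  finally show ?thesis by simp
qed

text \<open>Infinite combinations of the L(n) mix weights, and only upper bounds survive. Such a
  bound below \<open>min_weight\<close> forces 0, which is the source of most finiteness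
  proofs.\<close>

definition weight_le :: "int \<Rightarrow> 'v \<Rightarrow> bool" where
  "weight_le h v \<longleftrightarrow> (\<forall>n>h. comp n v = 0)"

definition min_weight :: int where
  "min_weight = (SOME m. \<forall>n<m. grade n = {0})"

lemma comp_below_min_weight: "n < min_weight \<Longrightarrow> comp n v = 0"
proof -
  assume "n < min_weight"
  then have "grade n = {0}"
    using someI_ex[OF grade_bounded_below] unfolding min_weight_def by blast
  then show ?thesis using comp_in_grade[of v n] by simp
qed

lemma weight_le_zero [simp]: "weight_le h 0"
  by (simp add: weight_le_def)

lemma weight_le_add: "weight_le h u \<Longrightarrow> weight_le h v \<Longrightarrow> weight_le h (u + v)"
  by (simp add: weight_le_def comp_add)

lemma weight_le_scale: "weight_le h v \<Longrightarrow> weight_le h (scale c v)"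
  by (simp add: weight_le_def comp_scale)

lemma weight_le_mono: "weight_le h v \<Longrightarrow> h \<le> h' \<Longrightarrow> weight_le h' v"
  by (simp add: weight_le_def)

lemma weight_le_sum: "(\<And>i. i \<in> A \<Longrightarrow> weight_le h (f i)) \<Longrightarrow> weight_le h (sum f A)"
  by (induction A rule: infinite_finite_induct) (simp_all add: weight_le_add)

lemma weight_le_Sum_any: "(\<And>i. weight_le h (f i)) \<Longrightarrow> weight_le h (Sum_any f)"
  by (simp add: Sum_any.expand_set weight_le_sum)

lemma weight_le_grade: "v \<in> grade h \<Longrightarrow> weight_le h v"
  by (simp add: weight_le_def comp_grade)

lemma weight_le_exists: "\<exists>h. weight_le h v"
proof -
  have "\<exists>h. \<forall>n\<in>{n. comp n v \<noteq> 0}. n \<le> h"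
    using finite_comp[of v] by (meson bdd_above_def bdd_above_finite)
  then show ?thesis unfolding weight_le_def by (meson leD mem_Collect_eq)
qed

lemma weight_le_eq_0:
  assumes "weight_le h v" "h < min_weight"
  shows "v = 0"
proof -
  have "comp n v = 0" for n
    using assms comp_below_min_weight[of n v] unfolding weight_le_def by (cases "n > h") auto
  then show ?thesis using Sum_any_comp[of v] by simp
qed

lemma weight_le_Y:
  assumes "weight_le h u" "weight_le s v"
  shows "weight_le (h + s + c) (Y u c v)"
proof -
  have "Y u c v = Sum_any (\<lambda>i. Y (comp i u) c v)"
    using Y_Sum_any_left[OF finite_comp, of u c v] by (simp add: Sum_any_comp)
  also have "\<dots> = Sum_any (\<lambda>i. Sum_any (\<lambda>j. Y (comp i u) c (comp j v)))"
    using Y_Sum_any_right[OF finite_comp, of _ c v] by (simp add: Sum_any_comp)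
  finally have "Y u c v = Sum_any (\<lambda>i. Sum_any (\<lambda>j. Y (comp i u) c (comp j v)))" .
  moreover have "weight_le (h + s + c) (Y (comp i u) c (comp j v))" for i j
  proof (cases "i \<le> h \<and> j \<le> s")
    case True
    then show ?thesis
      by (intro weight_le_mono[OF weight_le_grade[OF Y_in_grade[OF comp_in_grade comp_in_grade]]]) simp
  next
    case False
    then have "comp i u = 0 \<or> comp j v = 0" using assms by (auto simp: weight_le_def)
    then show ?thesis by auto
  qed
  ultimately show ?thesis by (simp add: weight_le_Sum_any)
qed

lemma weight_le_L: "weight_le s v \<Longrightarrow> weight_le (s - n) (L n v)"
  using weight_le_Y[OF weight_le_grade[OF conf_grade], of s v "- n - 2"]
  by (simp add: virasoro_def algebra_simps)

end

section \<open>Leibniz expansions and locally finite families of power series\<close>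

lemma (in vector_space) pascal_sum:
  "(\<Sum>j\<le>k. scale (of_nat (k choose j)) (t (Suc j) (k - j) + t j (Suc (k - j))))
    = (\<Sum>j\<le>Suc k. scale (of_nat (Suc k choose j)) (t j (Suc k - j)))"
proof -
  have "(\<Sum>j\<le>k. scale (of_nat (k choose j)) (t j (Suc (k - j))))
      = (\<Sum>j\<le>k. scale (of_nat (k choose j)) (t j (Suc k - j)))"
    by (rule sum.cong) (simp_all add: Suc_diff_le)
  also have "\<dots> = (\<Sum>j\<le>Suc k. scale (of_nat (k choose j)) (t j (Suc k - j)))"
    by (simp add: binomial_eq_0)
  also have "\<dots> = t 0 (Suc k) + (\<Sum>j\<le>k. scale (of_nat (k choose Suc j)) (t (Suc j) (k - j)))"
    by (subst sum.atMost_Suc_shift) simp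
  finally have *: "(\<Sum>j\<le>k. scale (of_nat (k choose j)) (t j (Suc (k - j)))) = \<dots>" .
  show ?thesis
    by (subst sum.atMost_Suc_shift)
      (simp add: * scale_right_distrib scale_left_distrib sum.distrib algebra_simps)
qed

text \<open>The exponential Leibniz rule for Z acting through T on the first argument of
  \<open>B\<close> and through X on the second. The product rule is required only along the orbits
  of \<open>m\<close> and \<open>v\<close>, because \<open>series_action\<close> obeys it only for
  filtered series.\<close>

lemma leibniz_divided_power:
  fixes scale :: "complex \<Rightarrow> 'b::ab_group_add \<Rightarrow> 'b" and Z :: "'b \<Rightarrow> 'b" and B :: "'m \<Rightarrow> 'n \<Rightarrow> 'b"
  assumes "vector_space scale" and Z: "\<And>x y. Z (x + y) = Z x + Z y" "\<And>c x. Z (scale c x) = scale c (Z x)"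
    and B: "\<And>i j. Z (B ((T ^^ i) m) ((X ^^ j) v)) = B (T ((T ^^ i) m)) ((X ^^ j) v) + B ((T ^^ i) m) (X ((X ^^ j) v))"
  shows "scale (1 / fact k) ((Z ^^ k) (B m v)) =
    (\<Sum>j\<le>k. scale (1 / (fact j * fact (k - j))) (B ((T ^^ j) m) ((X ^^ (k - j)) v)))"
proof -
  interpret vector_space scale by fact
  have Z0: "Z 0 = 0" using Z(1)[of 0 0] by simp
  have Zsum: "Z (sum f A) = (\<Sum>i\<in>A. Z (f i))" for f :: "nat \<Rightarrow> 'b" and A
    by (induction A rule: infinite_finite_induct) (simp_all add: Z Z0)
  have "(Z ^^ k) (B m v) = (\<Sum>j\<le>k. scale (of_nat (k choose j)) (B ((T ^^ j) m) ((X ^^ (k - j)) v)))"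
  proof (induction k)
    case (Suc k)
    show ?case
      using pascal_sum[of k "\<lambda>j i. B ((T ^^ j) m) ((X ^^ i) v)"]
      by (simp only: funpow.simps comp_apply Suc.IH Zsum Z B)
  qed simp
  then show ?thesis
    by (simp add: scale_sum_right binomial_fact field_simps)
qed

definition locally_finite :: "(nat \<Rightarrow> 'a::zero fps) \<Rightarrow> bool" where
  "locally_finite c \<longleftrightarrow> (\<forall>n. finite {j. c j $ n \<noteq> 0})"

definition fps_Sum :: "(nat \<Rightarrow> 'a::comm_monoid_add fps) \<Rightarrow> 'a fps" where
  "fps_Sum c = Abs_fps (\<lambda>n. Sum_any (\<lambda>j. c j $ n))"

lemma fps_Sum_nth: "fps_Sum c $ n = Sum_any (\<lambda>j. c j $ n)"
  by (simp add: fps_Sum_def)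

lemma locally_finiteI: "(\<And>j n. n < j \<Longrightarrow> c j $ n = 0) \<Longrightarrow> locally_finite c"
  unfolding locally_finite_def
proof
  fix n assume c: "\<And>j n. n < j \<Longrightarrow> c j $ n = 0"
  have "j \<le> n" if "c j $ n \<noteq> 0" for j
    using c[of n j] that by (meson not_le)
  then have "{j. c j $ n \<noteq> 0} \<subseteq> {..n}" by blast
  then show "finite {j. c j $ n \<noteq> 0}" by (rule finite_subset) simp
qed

lemma locally_finite_mult:
  fixes c :: "nat \<Rightarrow> complex fps"
  assumes "locally_finite c"
  shows "locally_finite (\<lambda>j. p * c j)" "fps_Sum (\<lambda>j. p * c j) = p * fps_Sum c"
proof -
  have c: "finite {j. c j $ n \<noteq> 0}" for n using assms by (simp add: locally_finite_def)
  have fin: "finite {j. p $ i * c j $ m \<noteq> 0}" for i m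
    by (rule Sum_any_finite_image[OF c[of m]]) simp
  show "locally_finite (\<lambda>j. p * c j)"
    unfolding locally_finite_def fps_mult_nth by (intro allI finite_nonzero_sum fin) simp
  show "fps_Sum (\<lambda>j. p * c j) = p * fps_Sum c"
    by (rule fps_ext) (simp add: fps_Sum_nth fps_mult_nth Sum_any_sum[OF _ fin] Sum_any_right_distrib[OF c])
qed

lemma locally_finite_deriv:
  fixes c :: "nat \<Rightarrow> complex fps"
  assumes "locally_finite c"
  shows "locally_finite (\<lambda>j. fps_deriv (c j))" "fps_Sum (\<lambda>j. fps_deriv (c j)) = fps_deriv (fps_Sum c)"
proof -
  have "{j. fps_deriv (c j) $ n \<noteq> 0} \<subseteq> {j. c j $ (n + 1) \<noteq> 0}" for n by auto
  then show "locally_finite (\<lambda>j. fps_deriv (c j))"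
    using assms unfolding locally_finite_def by (meson finite_subset)
  show "fps_Sum (\<lambda>j. fps_deriv (c j)) = fps_deriv (fps_Sum c)"
    using assms by (intro fps_ext) (simp add: fps_Sum_nth locally_finite_def flip: Sum_any_right_distrib)
qed

text \<open>In the x-adic topology each coefficient of the partial sums is eventually constant. This
  turns the convergence statement defining the a_n into a coefficientwise sum.\<close>

lemma sums_imp_fps_Sum:
  fixes c :: "nat \<Rightarrow> complex fps"
  assumes "c sums f" "locally_finite c"
  shows "f = fps_Sum c"
proof (rule fps_ext)
  fix n
  have "eventually (\<lambda>m. (\<Sum>k<m. c k) $ n = f $ n) sequentially"
    using assms(1) unfolding sums_def tendsto_fps_iff by blast
  then obtain K where K: "\<And>m. m \<ge> K \<Longrightarrow> (\<Sum>k<m. c k) $ n = f $ n"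
    unfolding eventually_sequentially by blast
  have fin: "finite {j. c j $ n \<noteq> 0}" using assms(2) unfolding locally_finite_def by blast
  then obtain K' where K': "\<And>j. c j $ n \<noteq> 0 \<Longrightarrow> j < K'"
    using finite_nat_set_iff_bounded by auto
  have "f $ n = (\<Sum>k<max K K'. c k) $ n" using K by simp
  also have "\<dots> = (\<Sum>k<max K K'. c k $ n)" by (simp add: fps_sum_nth)
  also have "\<dots> = Sum_any (\<lambda>k. c k $ n)"
    by (rule Sum_any_eq_sum[symmetric]) (use K' in force)+
  finally show "f $ n = fps_Sum c $ n" by (simp add: fps_Sum_nth)
qed

subsection \<open>Formal vector fields\<close>

text \<open>Elements of \<open>\<complex>[[x]]\<close> stand for vector fields \<open>h d/dx\<close>; \<open>field_bracket g h\<close> is the coefficient of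
  the bracket \<open>[h d/dx, g d/dx]\<close>, in the order that makes \<open>x\<^sup>n\<^sup>+\<^sup>1 \<mapsto> L(n)\<close> a homomorphism.\<close>

definition field_bracket :: "complex fps \<Rightarrow> complex fps \<Rightarrow> complex fps" where
  "field_bracket g h = fps_deriv g * h - g * fps_deriv h"

definition field_act :: "complex fps \<Rightarrow> complex fps \<Rightarrow> complex fps" where
  "field_act \<xi> p = \<xi> * fps_deriv p"

definition field_exp :: "complex fps \<Rightarrow> complex fps \<Rightarrow> complex fps" where
  "field_exp \<xi> p = fps_Sum (\<lambda>k. fps_const (1 / fact k) * (field_act \<xi> ^^ k) p)"

definition field_Ad :: "complex fps \<Rightarrow> complex fps \<Rightarrow> complex fps" where
  "field_Ad \<xi> h = fps_Sum (\<lambda>j. fps_const (1 / fact j) * (field_bracket \<xi> ^^ j) h)"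

text \<open>\<open>\<xi>\<close> starts in degree 2: differentiation lowers the order by one and
  multiplication raises it by two. Each application gains a degree, which makes the exponentials
  locally finite.\<close>

lemma field_act_order:
  assumes "\<xi> $ 0 = 0" "\<xi> $ 1 = 0" "\<And>n. n < j \<Longrightarrow> p $ n = 0" "n < Suc j"
  shows "field_act \<xi> p $ n = 0"
  unfolding field_act_def fps_mult_nth
proof (rule sum.neutral, safe)
  fix i assume i: "i \<in> {0..n}"
  show "\<xi> $ i * fps_deriv p $ (n - i) = 0"
  proof (cases "i < 2")
    case True
    then show ?thesis using assms(1,2) by (auto simp: less_2_cases_iff)
  next
    case False
    then show ?thesis using assms(3)[of "n - i + 1"] assms(4) i by simp
  qed
qed

lemma field_bracket_order:
  assumes "\<xi> $ 0 = 0" "\<xi> $ 1 = 0" "\<And>n. n < j \<Longrightarrow> p $ n = 0" "n < Suc j"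
  shows "field_bracket \<xi> p $ n = 0"
proof -
  have "(fps_deriv \<xi> * p) $ n = 0"
    unfolding fps_mult_nth
  proof (rule sum.neutral, safe)
    fix i assume i: "i \<in> {0..n}"
    show "fps_deriv \<xi> $ i * p $ (n - i) = 0"
      using assms(2) assms(3)[of "n - i"] assms(4) i by (cases i) auto
  qed
  then show ?thesis using field_act_order[OF assms] by (simp add: field_bracket_def field_act_def)
qed

lemma field_act_power_order:
  assumes "\<xi> $ 0 = 0" "\<xi> $ 1 = 0" "\<And>n. n < j \<Longrightarrow> p $ n = 0" "n < j + k"
  shows "(field_act \<xi> ^^ k) p $ n = 0"
  using assms(4)
proof (induction k arbitrary: n)
  case (Suc k)
  then show ?case using field_act_order[OF assms(1,2), of "j + k" "(field_act \<xi> ^^ k) p" n] by simp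
qed (use assms in simp)

lemma field_bracket_power_order:
  assumes "\<xi> $ 0 = 0" "\<xi> $ 1 = 0" "n < k"
  shows "(field_bracket \<xi> ^^ k) p $ n = 0"
  using assms(3)
proof (induction k arbitrary: n)
  case (Suc k)
  then show ?case using field_bracket_order[OF assms(1,2), of k "(field_bracket \<xi> ^^ k) p" n] by simp
qed simp

lemma field_act_add: "field_act \<xi> (p + q) = field_act \<xi> p + field_act \<xi> q"
  by (simp add: field_act_def algebra_simps)

lemma field_act_const_mult: "field_act \<xi> (fps_const c * p) = fps_const c * field_act \<xi> p"
  by (simp add: field_act_def mult_ac)

lemma field_act_power_const_mult: "(field_act \<xi> ^^ k) (fps_const c * p) = fps_const c * (field_act \<xi> ^^ k) p"
  by (induction k) (simp_all add: field_act_const_mult)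

lemma field_act_Sum:
  assumes "locally_finite c"
  shows "locally_finite (\<lambda>j. field_act \<xi> (c j))" "field_act \<xi> (fps_Sum c) = fps_Sum (\<lambda>j. field_act \<xi> (c j))"
  using locally_finite_mult[OF locally_finite_deriv(1)[OF assms], of \<xi>] locally_finite_deriv(2)[OF assms]
  by (simp_all add: field_act_def)

lemma field_act_power_Sum:
  assumes "locally_finite c"
  shows "locally_finite (\<lambda>j. (field_act \<xi> ^^ k) (c j)) \<and>
    (field_act \<xi> ^^ k) (fps_Sum c) = fps_Sum (\<lambda>j. (field_act \<xi> ^^ k) (c j))"
proof (induction k)
  case (Suc k)
  then have lf: "locally_finite (\<lambda>j. (field_act \<xi> ^^ k) (c j))" by blast
  show ?case
    using Suc field_act_Sum[OF lf, of \<xi>] by simp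
qed (simp add: assms)

lemma field_exp_locally_finite:
  assumes "\<xi> $ 0 = 0" "\<xi> $ 1 = 0"
  shows "locally_finite (\<lambda>k. fps_const (1 / fact k) * (field_act \<xi> ^^ k) p)"
  using field_act_power_order[OF assms, of 0 p] by (intro locally_finiteI) simp

lemma field_Ad_locally_finite:
  assumes "\<xi> $ 0 = 0" "\<xi> $ 1 = 0"
  shows "locally_finite (\<lambda>k. fps_const (1 / fact k) * (field_bracket \<xi> ^^ k) p)"
  using field_bracket_power_order[OF assms] by (intro locally_finiteI) simp

text \<open>Let f = \<open>field_exp \<xi> fps_X\<close> and read \<open>field_exp \<xi>\<close> as
  composition with f. Then the claim Ad(h)(f) = h f' says that Ad transports h d/dx along f. It is
  the exponential of the relation (h d/dx) D = D (h d/dx) + ad(h) d/dx with D = \<xi> d/dx, applied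
  to x.\<close>

lemma field_exp_Ad:
  assumes \<xi>: "\<xi> $ 0 = 0" "\<xi> $ 1 = 0"
  shows "field_exp \<xi> (field_Ad \<xi> h) = h * fps_deriv (field_exp \<xi> fps_X)"
proof -
  let ?D = "field_act \<xi>" and ?ad = "field_bracket \<xi>"
  have comm: "g * fps_deriv (?D p) = ?D (g * fps_deriv p) + ?ad g * fps_deriv p" for g p
    by (simp add: field_act_def field_bracket_def algebra_simps)
  define t where "t j i = (?D ^^ i) ((?ad ^^ j) h)" for i j
  interpret F: vector_space "\<lambda>(c :: complex) (p :: complex fps). fps_const c * p"
    by unfold_locales (simp_all add: algebra_simps flip: fps_const_add)
  have pow: "g * fps_deriv ((?D ^^ k) p)
      = (\<Sum>j\<le>k. fps_const (of_nat (k choose j)) * (?D ^^ (k - j)) ((?ad ^^ j) g * fps_deriv p))" for k g p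
  proof (induction k arbitrary: g p)
    case (Suc k)
    have Dsum: "?D (sum f A) = (\<Sum>i\<in>A. ?D (f i))" for f :: "nat \<Rightarrow> complex fps" and A
      by (induction A rule: infinite_finite_induct) (simp_all add: field_act_add, simp_all add: field_act_def)
    have "g * fps_deriv ((?D ^^ Suc k) p) = ?D (g * fps_deriv ((?D ^^ k) p)) + ?ad g * fps_deriv ((?D ^^ k) p)"
      by (simp add: comm)
    also have "\<dots> = (\<Sum>j\<le>k. fps_const (of_nat (k choose j)) *
        ((?D ^^ (k - j)) ((?ad ^^ Suc j) g * fps_deriv p) + (?D ^^ Suc (k - j)) ((?ad ^^ j) g * fps_deriv p)))"
      unfolding Suc.IH Dsum
      by (simp add: field_act_const_mult sum.distrib distrib_left funpow_swap1)
    also have "\<dots> = (\<Sum>j\<le>Suc k. fps_const (of_nat (Suc k choose j)) * (?D ^^ (Suc k - j)) ((?ad ^^ j) g * fps_deriv p))"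
      by (rule F.pascal_sum[of k "\<lambda>j i. (?D ^^ i) ((?ad ^^ j) g * fps_deriv p)"])
    finally show ?case .
  qed simp
  have lfX: "locally_finite (\<lambda>k. fps_const (1 / fact k) * (?D ^^ k) fps_X)"
    by (rule field_exp_locally_finite[OF \<xi>])
  have "h * fps_deriv (field_exp \<xi> fps_X) = fps_Sum (\<lambda>k. h * fps_deriv (fps_const (1 / fact k) * (?D ^^ k) fps_X))"
    unfolding field_exp_def
    by (simp only: locally_finite_mult(2)[OF locally_finite_deriv(1)[OF lfX]] locally_finite_deriv(2)[OF lfX])
  also have "\<dots> = fps_Sum (\<lambda>k. \<Sum>j\<le>k. fps_const (1 / (fact j * fact (k - j))) * t j (k - j))"
  proof -
    have "h * fps_deriv (fps_const (1 / fact k) * (?D ^^ k) fps_X)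
        = (\<Sum>j\<le>k. fps_const (1 / (fact j * fact (k - j))) * t j (k - j))" for k
    proof -
      have "h * fps_deriv (fps_const (1 / fact k) * (?D ^^ k) fps_X)
          = fps_const (1 / fact k) * (h * fps_deriv ((?D ^^ k) fps_X))" by (simp add: mult_ac)
      also have "\<dots> = (\<Sum>j\<le>k. fps_const (1 / fact k) * (fps_const (of_nat (k choose j)) * t j (k - j)))"
        unfolding pow sum_distrib_left by (simp add: t_def)
      also have "\<dots> = (\<Sum>j\<le>k. fps_const (1 / (fact j * fact (k - j))) * t j (k - j))"
      proof (rule sum.cong)
        fix j assume "j \<in> {..k}"
        then have "1 / fact k * of_nat (k choose j) = (1 / (fact j * fact (k - j)) :: complex)"
          by (simp add: binomial_fact)
        then show "fps_const (1 / fact k) * (fps_const (of_nat (k choose j)) * t j (k - j)) =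
            fps_const (1 / (fact j * fact (k - j))) * t j (k - j)"
          by (simp only: fps_const_mult flip: mult.assoc)
      qed simp
      finally show ?thesis .
    qed
    then show ?thesis by simp
  qed
  finally have lhs: "h * fps_deriv (field_exp \<xi> fps_X) = \<dots>" .
  \<comment> \<open>Both D and ad raise the order, so only pairs with i + j \<le> n reach degree
    \<open>n\<close>; this justifies the rearrangement below.\<close>
  have t0: "t j i $ n = 0" if "n < i + j" for i j n
    unfolding t_def using field_act_power_order[OF \<xi>, of j "(?ad ^^ j) h" n i]
      field_bracket_power_order[OF \<xi>] that by simp
  have "field_exp \<xi> (field_Ad \<xi> h) $ n = (h * fps_deriv (field_exp \<xi> fps_X)) $ n" for n
  proof -
    define b where "b j i = 1 / (fact j * fact i) * t j i $ n" for i j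
    have b0: "i \<le> n \<and> j \<le> n" if "b j i \<noteq> 0" for i j
    proof (rule ccontr)
      assume "\<not> (i \<le> n \<and> j \<le> n)"
      then have "n < i + j" by auto
      then show False using that t0 by (simp add: b_def)
    qed
    have fin: "finite {(j, i). b j i \<noteq> 0}" "finite {(i, j). b j i \<noteq> 0}"
      by (rule finite_subset[of _ "{..n} \<times> {..n}"], use b0 in blast, simp)+
    have "field_exp \<xi> (field_Ad \<xi> h) $ n = Sum_any (\<lambda>i. Sum_any (\<lambda>j. b j i))"
    proof -
      have "1 / fact i * ((?D ^^ i) (field_Ad \<xi> h)) $ n = Sum_any (\<lambda>j. b j i)" for i
      proof -
        have "(?D ^^ i) (field_Ad \<xi> h) $ n = Sum_any (\<lambda>j. 1 / fact j * t j i $ n)"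
          unfolding field_Ad_def
          using field_act_power_Sum[OF field_Ad_locally_finite[OF \<xi>, of h]]
          by (simp add: fps_Sum_nth field_act_power_const_mult t_def)
        moreover have "finite {j. 1 / fact j * t j i $ n \<noteq> 0}"
          by (rule finite_subset[of _ "{..n}"]) (use b0[of _ i] in \<open>auto simp: b_def\<close>)
        ultimately have "1 / fact i * (?D ^^ i) (field_Ad \<xi> h) $ n = Sum_any (\<lambda>j. 1 / fact i * (1 / fact j * t j i $ n))"
          by (simp only: Sum_any_right_distrib)
        then show ?thesis by (simp add: b_def mult.commute)
      qed
      then show ?thesis by (simp add: field_exp_def fps_Sum_nth)
    qed
    also have "\<dots> = Sum_any (\<lambda>j. Sum_any (\<lambda>i. b j i))" by (rule Sum_any_swap_finite[OF fin(2)])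
    also have "\<dots> = Sum_any (\<lambda>(j, i). b j i)" by (rule Sum_any_iterated[OF fin(1)])
    also have "\<dots> = Sum_any (\<lambda>k. \<Sum>j\<le>k. b j (k - j))" by (rule Sum_any_diagonal[OF fin(1), symmetric])
    also have "\<dots> = (h * fps_deriv (field_exp \<xi> fps_X)) $ n"
      unfolding lhs by (simp add: fps_Sum_nth fps_sum_nth b_def)
    finally show ?thesis .
  qed
  then show ?thesis by (rule fps_ext)
qed

lemma field_exp_nth:
  assumes "\<xi> $ 0 = 0" "\<xi> $ 1 = 0"
  shows "field_exp \<xi> p $ n = (\<Sum>k\<le>n. (field_act \<xi> ^^ k) p $ n / fact k)"
  unfolding field_exp_def fps_Sum_nth
  by (subst Sum_any_eq_sum[of "{..n}"]) (use field_act_power_order[OF assms, of 0 p] in auto)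

text \<open>\<open>field_exp\<close> is unipotent: it adds to each coefficient only contributions of
  lower ones, so equality propagates by degree.\<close>

lemma field_exp_inj:
  assumes \<xi>: "\<xi> $ 0 = 0" "\<xi> $ 1 = 0" and eq: "field_exp \<xi> p = field_exp \<xi> q"
  shows "p = q"
proof (rule fps_ext)
  fix n
  show "p $ n = q $ n"
  proof (induction n rule: less_induct)
    case (less n)
    have diff: "(field_act \<xi> ^^ k) (p - q) = (field_act \<xi> ^^ k) p - (field_act \<xi> ^^ k) q" for k
      by (induction k) (simp_all add: field_act_def right_diff_distrib)
    have "(field_act \<xi> ^^ k) p $ n = (field_act \<xi> ^^ k) q $ n" if "k > 0" for k
      using field_act_power_order[OF \<xi>, of n "p - q" n k] less that by (simp add: diff)
    then have "field_exp \<xi> p $ n - field_exp \<xi> q $ n = (\<Sum>k\<le>n. if k = 0 then p $ n - q $ n else 0)"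
      unfolding field_exp_nth[OF \<xi>] sum_subtractf[symmetric] by (intro sum.cong) auto
    then show ?case using eq by simp
  qed
qed

text \<open>The map f is defined by 1 + N f = (1 + x)^N, whence (1 + x) f' = (1 + x)^N = 1 + N f. By
  \<open>field_exp_Ad\<close> both sides therefore have the same image under the injective
  \<open>field_exp\<close>.\<close>

lemma field_Ad_change_of_variable:
  assumes \<xi>: "\<xi> $ 0 = 0" "\<xi> $ 1 = 0" and N: "N > 0"
    and f: "field_exp \<xi> fps_X = fps_const (1 / of_nat N) * (1 + fps_X) ^ N - fps_const (1 / of_nat N)"
  shows "field_Ad \<xi> (1 + fps_X) = 1 + fps_const (of_nat N) * fps_X"
proof (rule field_exp_inj[OF \<xi>])
  have "(field_act \<xi> ^^ k) (1 + fps_const (of_nat N) * fps_X) =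
      (if k = 0 then 1 else 0) + fps_const (of_nat N) * (field_act \<xi> ^^ k) fps_X" for k
    by (induction k) (auto simp: field_act_add field_act_const_mult, auto simp: field_act_def)
  then have "field_exp \<xi> (1 + fps_const (of_nat N) * fps_X) = 1 + fps_const (of_nat N) * field_exp \<xi> fps_X"
    by (intro fps_ext) (simp add: field_exp_nth[OF \<xi>] add_divide_distrib sum.distrib sum_distrib_left
      if_distrib[of "\<lambda>p. p $ _"] if_distrib[of "\<lambda>c. c / _"] cong: if_cong)
  also have "\<dots> = (1 + fps_X) ^ N"
    using N by (simp add: f algebra_simps flip: mult.assoc)
  also have "\<dots> = (1 + fps_X) * fps_deriv (field_exp \<xi> fps_X)"
  proof -
    obtain m where m: "N = Suc m" using N by (cases N) auto
    have "fps_deriv (field_exp \<xi> fps_X) = fps_const (1 / of_nat N) * (fps_const (of_nat N) * (1 + fps_X) ^ m)"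
      by (simp add: f fps_deriv_power m del: of_nat_Suc power_Suc)
    also have "\<dots> = (1 + fps_X) ^ m"
      using N by (simp flip: mult.assoc)
    finally show ?thesis by (simp add: m)
  qed
  also have "\<dots> = field_exp \<xi> (field_Ad \<xi> (1 + fps_X))" by (rule field_exp_Ad[OF \<xi>, symmetric])
  finally show "field_exp \<xi> (field_Ad \<xi> (1 + fps_X)) = field_exp \<xi> (1 + fps_const (of_nat N) * fps_X)"
    by simp
qed

section \<open>Formal vector fields acting through Virasoro operators\<close>

context vertex_operator_algebra begin

text \<open>Only L(-1), L(0), L(1), ... occur. Among these the central term of the Virasoro algebra
  vanishes, and on each vector the sum is finite.\<close>

definition rho :: "complex fps \<Rightarrow> 'v \<Rightarrow> 'v" where
  "rho h v = Sum_any (\<lambda>n. scale (h $ n) (L (int n - 1) v))"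

lemma L_vanishes: obtains M where "\<forall>n\<ge>M. L (int n - 1) v = 0"
proof -
  obtain m where "\<forall>n>m. L n v = 0" using L_truncated by blast
  then show ?thesis by (intro that[of "nat (m + 2)"]) auto
qed

lemma rho_eq_sum:
  assumes "\<forall>n\<ge>M. L (int n - 1) v = 0"
  shows "rho h v = (\<Sum>n<M. scale (h $ n) (L (int n - 1) v))"
  unfolding rho_def by (rule Sum_any_eq_sum) (simp_all add: assms)

lemma rho_add: "rho h (u + v) = rho h u + rho h v"
proof -
  obtain M1 where M1: "\<forall>n\<ge>M1. L (int n - 1) u = 0" using L_vanishes by blast
  obtain M2 where M2: "\<forall>n\<ge>M2. L (int n - 1) v = 0" using L_vanishes by blast
  let ?M = "max M1 M2"
  have "rho h u = (\<Sum>n<?M. scale (h $ n) (L (int n - 1) u))"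
    "rho h v = (\<Sum>n<?M. scale (h $ n) (L (int n - 1) v))"
    "rho h (u + v) = (\<Sum>n<?M. scale (h $ n) (L (int n - 1) (u + v)))"
    using M1 M2 by (rule_tac rho_eq_sum, simp add: L_add)+
  then show ?thesis by (simp add: L_add scale_right_distrib sum.distrib)
qed

lemma rho_scale: "rho h (scale c v) = scale c (rho h v)"
  by (simp add: rho_def L_scale scale_Sum_any mult.commute)

lemma rho_const_mult: "rho (fps_const c * h) v = scale c (rho h v)"
  by (simp add: rho_def scale_Sum_any)

lemma rho_zero [simp]: "rho h 0 = 0"
  by (simp add: rho_def)

lemma rho_1_plus_X: "rho (1 + fps_const c * fps_X) v = L (- 1) v + scale c (L 0 v)"
proof -
  have "rho (1 + fps_const c * fps_X) v = (\<Sum>n<2. scale ((1 + fps_const c * fps_X) $ n) (L (int n - 1) v))"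
    unfolding rho_def by (rule Sum_any_eq_sum) auto
  then show ?thesis by (simp add: numeral_2_eq_2)
qed

lemma weight_le_rho:
  assumes "\<And>n. n < j \<Longrightarrow> h $ n = 0" "weight_le s v"
  shows "weight_le (s - int j + 1) (rho h v)"
  unfolding rho_def
proof (rule weight_le_Sum_any)
  fix n
  show "weight_le (s - int j + 1) (scale (h $ n) (L (int n - 1) v))"
  proof (cases "n < j")
    case False
    then show ?thesis
      by (intro weight_le_scale weight_le_mono[OF weight_le_L[OF assms(2)]]) simp
  qed (simp add: assms)
qed

lemma rho_Sum:
  assumes "locally_finite c"
  shows "rho (fps_Sum c) v = Sum_any (\<lambda>j. rho (c j) v)"
proof -
  obtain M where M: "\<forall>n\<ge>M. L (int n - 1) v = 0" using L_vanishes by blast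
  have "{(n, j). scale (c j $ n) (L (int n - 1) v) \<noteq> 0} \<subseteq> (SIGMA n:{..<M}. {j. c j $ n \<noteq> 0})"
  proof clarify
    fix n j assume "scale (c j $ n) (L (int n - 1) v) \<noteq> 0"
    then have "L (int n - 1) v \<noteq> 0" "c j $ n \<noteq> 0" by auto
    then show "n \<in> {..<M} \<and> j \<in> {j. c j $ n \<noteq> 0}" using M by (auto simp: not_le[symmetric])
  qed
  then have fin: "finite {(n, j). scale (c j $ n) (L (int n - 1) v) \<noteq> 0}"
    by (rule finite_subset) (use assms in \<open>auto simp: locally_finite_def\<close>)
  have "scale (fps_Sum c $ n) (L (int n - 1) v) = Sum_any (\<lambda>j. scale (c j $ n) (L (int n - 1) v))" for n
    using assms unfolding fps_Sum_nth locally_finite_def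
    by (intro Sum_any_additive[where f = "\<lambda>x. scale x (L (int n - 1) v)"] scale_left_distrib) blast
  then have "rho (fps_Sum c) v = Sum_any (\<lambda>n. Sum_any (\<lambda>j. scale (c j $ n) (L (int n - 1) v)))"
    by (simp add: rho_def)
  also have "\<dots> = Sum_any (\<lambda>j. Sum_any (\<lambda>n. scale (c j $ n) (L (int n - 1) v)))"
    by (rule Sum_any_swap_finite[OF fin])
  finally show ?thesis by (simp add: rho_def)
qed

text \<open>Summing [L(m - 1), L(n - 1)] = (m - n) L(m + n - 2) against the two series produces the
  coefficients of \<open>field_bracket\<close>, so \<open>rho\<close> is a representation. A common
  cutoff K makes all sums finite.\<close>

lemma rho_bracket: "rho g (rho h v) = rho h (rho g v) + rho (field_bracket g h) v"
proof -
  obtain M where M: "\<forall>n\<ge>M. L (int n - 1) v = 0" using L_vanishes by blast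
  have "\<exists>M'. \<forall>n<M. \<forall>m\<ge>M'. L (int m - 1) (L (int n - 1) v) = 0"
  proof -
    have "\<forall>n. \<exists>M'. \<forall>m\<ge>M'. L (int m - 1) (L (int n - 1) v) = 0"
      using L_vanishes by metis
    then obtain f where f: "\<And>n m. m \<ge> f n \<Longrightarrow> L (int m - 1) (L (int n - 1) v) = 0" by metis
    have "f n \<le> Max (f ` {..<M})" if "n < M" for n using that by simp
    then show ?thesis using f by (meson order_trans)
  qed
  then obtain M' where M': "\<And>n m. n < M \<Longrightarrow> m \<ge> M' \<Longrightarrow> L (int m - 1) (L (int n - 1) v) = 0" by blast
  define K where "K = max M M'"
  have K1: "\<forall>n\<ge>K. L (int n - 1) v = 0" using M by (simp add: K_def)
  have K2: "L (int m - 1) (L (int n - 1) v) = 0" if "m \<ge> K" for m n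
    using M M'[of n m] that by (cases "n < M") (simp_all add: K_def)
  have prod: "rho g (rho h v) = (\<Sum>m<K. \<Sum>n<K. scale (g $ m * h $ n) (L (int m - 1) (L (int n - 1) v)))" for g h
  proof -
    have "\<forall>m\<ge>K. L (int m - 1) (rho h v) = 0"
      unfolding rho_eq_sum[OF K1] L_sum L_scale using K2 by simp
    then have "rho g (rho h v) = (\<Sum>m<K. scale (g $ m) (L (int m - 1) (rho h v)))"
      by (rule rho_eq_sum)
    then show ?thesis
      unfolding rho_eq_sum[OF K1] by (simp add: L_sum L_scale scale_sum_right)
  qed
  obtain cc where cc: "\<And>m n v. L m (L n v) - L n (L m v) = scale (of_int (m - n)) (L (m + n) v)
       + (if m + n = 0 then scale (of_int (m ^ 3 - m) / 12 * cc) v else 0)"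
    using virasoro_relations by blast
  have comm: "L (int m - 1) (L (int n - 1) v) - L (int n - 1) (L (int m - 1) v)
      = scale (of_nat m - of_nat n) (L (int (m + n) - 2) v)" for m n
  proof -
    \<comment> \<open>Both indices are at least -1 and add up to 0, so they lie in -1, 0, 1, where
      the cubic of the central term vanishes.\<close>
    have "(int m - 1) ^ 3 - (int m - 1) = 0" if "int m - 1 + (int n - 1) = 0"
    proof -
      from that have "m = 0 \<or> m = 1 \<or> m = 2" by auto
      then show ?thesis by auto
    qed
    then show ?thesis using cc[of "int m - 1" "int n - 1" v] by (auto simp: algebra_simps)
  qed
  define t where "t m n = scale (g $ m * h $ n * (of_nat m - of_nat n)) (L (int (m + n) - 2) v)" for m n
  have t0: "t m n = 0" if "m + n > K" for m n
    using K1[rule_format, of "m + n - 1"] that by (simp add: t_def of_nat_diff algebra_simps)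
  have fin: "finite {(m, n). t m n \<noteq> 0}"
  proof (rule finite_subset)
    show "{(m, n). t m n \<noteq> 0} \<subseteq> {..K} \<times> {..K}"
    proof clarify
      fix m n assume "t m n \<noteq> 0"
      then have "\<not> m + n > K" using t0 by blast
      then show "m \<in> {..K} \<and> n \<in> {..K}" by auto
    qed
  qed simp
  have "rho g (rho h v) - rho h (rho g v) = (\<Sum>m<K. \<Sum>n<K. t m n)"
  proof -
    have "rho h (rho g v) = (\<Sum>m<K. \<Sum>n<K. scale (g $ m * h $ n) (L (int n - 1) (L (int m - 1) v)))"
      unfolding prod by (subst sum.swap) (simp add: mult.commute)
    moreover have "t m n = scale (g $ m * h $ n) (L (int m - 1) (L (int n - 1) v))
        - scale (g $ m * h $ n) (L (int n - 1) (L (int m - 1) v))" for m n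
      unfolding t_def scale_scale[symmetric, of "g $ m * h $ n"] comm[symmetric]
      by (rule scale_right_diff_distrib)
    ultimately show ?thesis
      unfolding prod[of g h] by (simp only: sum_subtractf)
  qed
  also have "\<dots> = Sum_any (\<lambda>m. Sum_any (t m))"
  proof -
    have tz: "t m n = 0" if "m \<ge> K \<or> n \<ge> K" for m n
    proof -
      have "L (int m - 1) (L (int n - 1) v) - L (int n - 1) (L (int m - 1) v) = 0"
        using that K1 K2 by auto
      then have "scale (of_nat m - of_nat n) (L (int (m + n) - 2) v) = 0" using comm by simp
      then show ?thesis unfolding t_def by (metis scale_scale scale_zero_right)
    qed
    have "Sum_any (t m) = (\<Sum>n<K. t m n)" for m
      by (rule Sum_any_eq_sum) (simp_all add: tz)
    moreover have "Sum_any (\<lambda>m. \<Sum>n<K. t m n) = (\<Sum>m<K. \<Sum>n<K. t m n)"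
      by (rule Sum_any_eq_sum) (simp_all add: tz)
    ultimately show ?thesis by simp
  qed
  also have "\<dots> = Sum_any (\<lambda>k. \<Sum>m\<le>k. t m (k - m))"
    unfolding Sum_any_iterated[OF fin] by (rule Sum_any_diagonal[OF fin, symmetric])
  \<comment> \<open>L(m + n - 2) belongs to x^(m + n - 1), so the antidiagonal m + n = k contributes
    in degree k - 1. The one for k = 0 has the factor m - n = 0.\<close>
  also have "\<dots> = Sum_any (\<lambda>j. \<Sum>m\<le>Suc j. t m (Suc j - m))"
  proof (rule Sum_any_reindex_inj)
    fix k :: nat assume "k \<notin> range Suc"
    then have "k = 0" by (metis not0_implies_Suc rangeI)
    then show "(\<Sum>m\<le>k. t m (k - m)) = 0" by (simp add: t_def)
  qed simp
  also have "\<dots> = rho (field_bracket g h) v"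
  proof -
    have "field_bracket g h $ j = (\<Sum>m\<le>Suc j. g $ m * h $ (Suc j - m) * (of_nat m - of_nat (Suc j - m)))" for j
    proof -
      have "(\<Sum>m\<le>Suc j. g $ m * h $ (Suc j - m) * of_nat m) = (fps_deriv g * h) $ j"
        unfolding fps_mult_nth atLeast0AtMost by (subst sum.atMost_Suc_shift) (simp add: mult_ac)
      moreover have "(\<Sum>m\<le>Suc j. g $ m * h $ (Suc j - m) * of_nat (Suc j - m)) = (g * fps_deriv h) $ j"
        unfolding fps_mult_nth atLeast0AtMost by (simp add: mult_ac Suc_diff_le add_diff_eq)
      ultimately show ?thesis
        by (simp only: field_bracket_def fps_sub_nth right_diff_distrib sum_subtractf)
    qed
    moreover have "(\<Sum>m\<le>Suc j. t m (Suc j - m)) =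
        scale (\<Sum>m\<le>Suc j. g $ m * h $ (Suc j - m) * (of_nat m - of_nat (Suc j - m))) (L (int j - 1) v)" for j
      unfolding scale_sum_left t_def by (rule sum.cong) auto
    ultimately show ?thesis by (simp add: rho_def)
  qed
  finally show ?thesis by (simp add: algebra_simps)
qed

end

section \<open>The exponential E of a vector field of order two\<close>

locale voa_flow = vertex_operator_algebra scale grade Y vac conf
  for scale :: "complex \<Rightarrow> 'v::ab_group_add \<Rightarrow> 'v" and grade Y vac conf +
  fixes \<xi> :: "complex fps"
  assumes \<xi>: "\<xi> $ 0 = 0" "\<xi> $ 1 = 0"
begin

abbreviation X :: "'v \<Rightarrow> 'v" where "X \<equiv> rho \<xi>"

definition E :: "'v \<Rightarrow> 'v" where
  "E v = Sum_any (\<lambda>k. scale (1 / fact k) ((X ^^ k) v))"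

text \<open>As \<open>\<xi>\<close> has order at least 2, X involves only L(1), L(2), ..., each of
  which lowers weights. Since weights are bounded below, X is locally nilpotent.\<close>

lemma weight_le_X_power: "weight_le s v \<Longrightarrow> weight_le (s - int k) ((X ^^ k) v)"
proof (induction k)
  case (Suc k)
  have "weight_le (s - int k - int 2 + 1) (X ((X ^^ k) v))"
    using \<xi> by (intro weight_le_rho Suc) (auto simp: less_2_cases_iff)
  then show ?case by (simp add: algebra_simps)
qed simp

lemma X_power_eq_0: "weight_le s v \<Longrightarrow> s - int k < min_weight \<Longrightarrow> (X ^^ k) v = 0"
  using weight_le_X_power weight_le_eq_0 by blast

lemma finite_X_power: "finite {k. (X ^^ k) v \<noteq> 0}"
proof -
  obtain s where s: "weight_le s v" using weight_le_exists by blast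
  have "{k. (X ^^ k) v \<noteq> 0} \<subseteq> {..nat (s - min_weight)}"
  proof
    fix k assume "k \<in> {k. (X ^^ k) v \<noteq> 0}"
    then have "\<not> s - int k < min_weight" using X_power_eq_0[OF s] by blast
    then show "k \<in> {..nat (s - min_weight)}" by simp
  qed
  then show ?thesis by (rule finite_subset) simp
qed

lemma finite_E: "finite {k. scale (1 / fact k) ((X ^^ k) v) \<noteq> 0}"
  by (rule finite_subset[OF _ finite_X_power[of v]]) auto

lemma X_power_add: "(X ^^ k) (u + v) = (X ^^ k) u + (X ^^ k) v"
  by (induction k) (simp_all add: rho_add)

lemma X_power_scale: "(X ^^ k) (scale c v) = scale c ((X ^^ k) v)"
  by (induction k) (simp_all add: rho_scale)

lemma E_add: "E (u + v) = E u + E v"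
  unfolding E_def X_power_add scale_right_distrib by (rule Sum_any.distrib[OF finite_E finite_E])

lemma E_scale: "E (scale c v) = scale c (E v)"
  by (simp add: E_def X_power_scale scale_Sum_any mult.commute)

lemma E_zero [simp]: "E 0 = 0"
  using E_add[of 0 0] by simp

lemma weight_le_E: "weight_le s v \<Longrightarrow> weight_le s (E v)"
  unfolding E_def
  by (intro weight_le_Sum_any weight_le_scale) (use weight_le_mono[OF weight_le_X_power] in simp)

text \<open>The operator counterpart of \<open>field_exp_Ad\<close>, by exponentiating
  \<open>rho_bracket\<close>. Powers of X and of the bracket both lower the weight of a term, which
  bounds the double sum.\<close>

lemma E_rho: "E (rho h v) = rho (field_Ad \<xi> h) (E v)"
proof -
  define c where "c j = fps_const (1 / fact j) * (field_bracket \<xi> ^^ j) h" for j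
  define p where "p i = scale (1 / fact i) ((X ^^ i) v)" for i
  define b where "b j i = rho (c j) (p i)" for j i
  obtain s where s: "weight_le s v" using weight_le_exists by blast
  have fin: "finite {(j, i). b j i \<noteq> 0}"
  proof (rule finite_subset)
    show "{(j, i). b j i \<noteq> 0} \<subseteq> {..nat (s + 1 - min_weight)} \<times> {..nat (s + 1 - min_weight)}"
    proof clarify
      fix j i assume nz: "b j i \<noteq> 0"
      have "weight_le (s - int i - int j + 1) (b j i)"
        unfolding b_def p_def c_def
        using field_bracket_power_order[OF \<xi>]
        by (intro weight_le_rho weight_le_scale weight_le_X_power s) simp
      then have "s - int i - int j + 1 \<ge> min_weight" using nz weight_le_eq_0 not_le by blast
      then show "j \<in> {..nat (s + 1 - min_weight)} \<and> i \<in> {..nat (s + 1 - min_weight)}" by auto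
    qed
  qed simp
  have "scale (1 / fact k) ((X ^^ k) (rho h v)) = (\<Sum>j\<le>k. b j (k - j))" for k
  proof -
    have "scale (1 / fact k) ((X ^^ k) (rho h v)) =
      (\<Sum>j\<le>k. scale (1 / (fact j * fact (k - j))) (rho ((field_bracket \<xi> ^^ j) h) ((X ^^ (k - j)) v)))"
      by (rule leibniz_divided_power[of scale X rho "field_bracket \<xi>" h X v])
        (unfold_locales, simp_all add: rho_add rho_scale rho_bracket[of \<xi>] add.commute)
    then show ?thesis by (simp add: b_def c_def p_def rho_const_mult rho_scale mult.commute)
  qed
  then have "E (rho h v) = Sum_any (\<lambda>k. \<Sum>j\<le>k. b j (k - j))"
    by (simp add: E_def)
  also have "\<dots> = Sum_any (\<lambda>j. Sum_any (b j))"
    unfolding Sum_any_iterated[OF fin] by (rule Sum_any_diagonal[OF fin])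
  also have "Sum_any (b j) = rho (c j) (E v)" for j
    unfolding b_def E_def p_def
    by (rule Sum_any_additive[symmetric, OF rho_add finite_E])
  then have "Sum_any (\<lambda>j. Sum_any (b j)) = Sum_any (\<lambda>j. rho (c j) (E v))" by simp
  also have "\<dots> = rho (field_Ad \<xi> h) (E v)"
    unfolding field_Ad_def using rho_Sum[OF field_Ad_locally_finite[OF \<xi>, of h]] by (simp add: c_def)
  finally show ?thesis .
qed

end

section \<open>Conjugating vertex operators by E\<close>

text \<open>The Taylor coefficient h^(l)/l!: h(x + y) is the sum over l of x^l times this series in
  y.\<close>

definition fps_divided_deriv :: "nat \<Rightarrow> complex fps \<Rightarrow> complex fps" where
  "fps_divided_deriv l h = Abs_fps (\<lambda>i. of_nat (l + i choose i) * h $ (l + i))"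

context vertex_operator_algebra begin

definition series_action :: "(nat \<Rightarrow> 'v) \<Rightarrow> 'v \<Rightarrow> int \<Rightarrow> 'v" where
  "series_action m v c = Sum_any (\<lambda>p. Y (m p) (c - int p) v)"

text \<open>\<open>theta \<xi>\<close> is multiplication by \<open>e\<^sup>-\<^sup>x\<^sup>L\<^sup>(\<^sup>-\<^sup>1\<^sup>) rho(\<xi>) e\<^sup>x\<^sup>L\<^sup>(\<^sup>-\<^sup>1\<^sup>)\<close> on \<open>V[[x]]\<close>; \<open>series_action m v\<close> is the
  sum of the \<open>x\<^sup>p Y(m\<^sub>p, x) v\<close>.\<close>

definition theta :: "complex fps \<Rightarrow> (nat \<Rightarrow> 'v) \<Rightarrow> nat \<Rightarrow> 'v" where
  "theta \<xi> m p = (\<Sum>l\<le>p. rho (fps_divided_deriv l \<xi>) (m (p - l)))"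

text \<open>The two bounds make \<open>series_action\<close> converge and let the powers of \<open>theta \<xi>\<close> tend to 0: the operator
  preserves \<open>q\<close> and raises \<open>r\<close>.\<close>

definition filtered :: "int \<Rightarrow> int \<Rightarrow> (nat \<Rightarrow> 'v) \<Rightarrow> bool" where
  "filtered q r m \<longleftrightarrow> (\<forall>p. weight_le ((int p + q) div 2) (m p) \<and> weight_le (int p - r) (m p))"

lemma Y_bounded_nonzero:
  assumes "weight_le h u" "weight_le s v" "Y u c v \<noteq> 0"
  shows "min_weight \<le> h + s + c"
  using weight_le_eq_0[OF weight_le_Y[OF assms(1,2)]] assms(3) not_le by blast

text \<open>The weight of m_p grows at most like p/2 while the exponent c - p falls like p, so the
  weight of the term eventually drops below \<open>min_weight\<close>.\<close>

lemma filtered_finite: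
  assumes "filtered q r m"
  shows "finite {p. Y (m p) (c - int p) v \<noteq> 0}"
proof -
  obtain s where s: "weight_le s v" using weight_le_exists by blast
  have "{p. Y (m p) (c - int p) v \<noteq> 0} \<subseteq> {..nat (q + 2 * s + 2 * c - 2 * min_weight)}"
  proof clarify
    fix p assume "Y (m p) (c - int p) v \<noteq> 0"
    then have "min_weight \<le> (int p + q) div 2 + s + (c - int p)"
      using assms s Y_bounded_nonzero unfolding filtered_def by blast
    then show "p \<le> nat (q + 2 * s + 2 * c - 2 * min_weight)" by linarith
  qed
  then show ?thesis by (rule finite_subset) simp
qed

text \<open>In the second bound of \<open>filtered\<close> the weight p - r cancels the p of the
  exponent c - p. The resulting bound is the same for all \<open>p\<close>, so a large
  \<open>r\<close> kills every term.\<close>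

lemma filtered_vanishes:
  assumes "filtered q r m" "weight_le s v" "c + s - r < min_weight"
  shows "Y (m p) (c - int p) v = 0"
proof (rule ccontr)
  assume "Y (m p) (c - int p) v \<noteq> 0"
  then have "min_weight \<le> (int p - r) + s + (c - int p)"
    using assms(1,2) Y_bounded_nonzero unfolding filtered_def by blast
  then show False using assms(3) by simp
qed

lemma series_action_add: "filtered q r m \<Longrightarrow> series_action m (v + w) c = series_action m v c + series_action m w c"
  unfolding series_action_def Y_add_right by (rule Sum_any.distrib) (rule filtered_finite, assumption)+

lemma series_action_scale: "series_action m (scale a v) c = scale a (series_action m v c)"
  by (simp add: series_action_def Y_scale_right scale_Sum_any)

lemma filtered_const: "weight_le h u \<Longrightarrow> filtered (2 * h) (- h) (\<lambda>p. if p = 0 then u else 0)"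
  by (auto simp: filtered_def)

lemma series_action_const: "series_action (\<lambda>p. if p = 0 then u else 0) v c = Y u c v"
  unfolding series_action_def by (subst Sum_any_eq_sum[of "{0}"]) auto

text \<open>The commutator of rho(h) with Y(u, x) is Y of rho(h(x + y)) u, where \<open>rho\<close>
  acts in the variable y. It is \<open>L_Y_commutator\<close> summed over n and regrouped by l = n -
  i. Truncation of the L(n) u bounds i, and weights bound l.\<close>

lemma rho_Y_commutator:
  shows "finite {(l, i). scale (of_nat (l + i choose i) * h $ (l + i)) (Y (L (int i - 1) u) (c - int l) v) \<noteq> 0}"
    and "rho h (Y u c v) = Y u c (rho h v) + Sum_any (\<lambda>l. Y (rho (fps_divided_deriv l h) u) (c - int l) v)"
proof -
  define b where "b l i = scale (of_nat (l + i choose i) * h $ (l + i)) (Y (L (int i - 1) u) (c - int l) v)" for l i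
  obtain M where M: "\<forall>n\<ge>M. L (int n - 1) u = 0" using L_vanishes by blast
  obtain s where s: "weight_le s v" using weight_le_exists by blast
  obtain w where w: "weight_le w u" using weight_le_exists by blast
  have nz: "i < M \<and> l < nat (w + 2 + s + c - min_weight)" if "b l i \<noteq> 0" for l i
  proof
    have Ynz: "Y (L (int i - 1) u) (c - int l) v \<noteq> 0" using that by (auto simp: b_def)
    show "i < M" using Ynz M by (metis Y_zero_left not_le)
    have "min_weight \<le> (w - (int i - 1)) + s + (c - int l)"
      using Y_bounded_nonzero[OF weight_le_L[OF w] s Ynz] .
    then show "l < nat (w + 2 + s + c - min_weight)" by linarith
  qed
  have fin: "finite {(l, i). b l i \<noteq> 0}"
  proof (rule finite_subset)
    show "{(l, i). b l i \<noteq> 0} \<subseteq> {..<nat (w + 2 + s + c - min_weight)} \<times> {..<M}"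
      using nz by blast
  qed simp
  then show "finite {(l, i). scale (of_nat (l + i choose i) * h $ (l + i)) (Y (L (int i - 1) u) (c - int l) v) \<noteq> 0}"
    by (simp add: b_def)
  have fin': "finite {(i, l). b l i \<noteq> 0}"
  proof (rule finite_subset)
    show "{(i, l). b l i \<noteq> 0} \<subseteq> {..<M} \<times> {..<nat (w + 2 + s + c - min_weight)}"
      using nz by blast
  qed simp
  obtain M1 where M1: "\<forall>n\<ge>M1. L (int n - 1) v = 0" using L_vanishes by blast
  obtain M2 where M2: "\<forall>n\<ge>M2. L (int n - 1) (Y u c v) = 0" using L_vanishes by blast
  define K where "K = max M1 M2"
  have K: "\<forall>n\<ge>K. L (int n - 1) v = 0" "\<forall>n\<ge>K. L (int n - 1) (Y u c v) = 0"
    using M1 M2 by (simp_all add: K_def)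
  have "scale (h $ n) (L (int n - 1) (Y u c v)) =
      Y u c (scale (h $ n) (L (int n - 1) v)) + (\<Sum>i\<le>n. b (n - i) i)" for n
  proof -
    have "L (int n - 1) (Y u c v) = Y u c (L (int n - 1) v) +
        (\<Sum>i\<le>n. scale (of_nat (n choose i)) (Y (L (int i - 1) u) (c - int n + int i) v))"
      using L_Y_commutator[of n u c v] by (simp add: algebra_simps)
    moreover have "scale (h $ n) (\<Sum>i\<le>n. scale (of_nat (n choose i)) (Y (L (int i - 1) u) (c - int n + int i) v))
        = (\<Sum>i\<le>n. b (n - i) i)"
      unfolding scale_sum_right b_def
      by (rule sum.cong) (auto simp: of_nat_diff mult.commute diff_diff_eq2 add_diff_eq diff_add_eq)
    ultimately show ?thesis by (simp add: scale_right_distrib Y_scale_right)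
  qed
  moreover have "(\<Sum>i\<le>n. b (n - i) i) = 0" if "n \<ge> K" for n
  proof -
    have "(\<Sum>i\<le>n. b (n - i) i) = scale (h $ n) (L (int n - 1) (Y u c v)) - Y u c (scale (h $ n) (L (int n - 1) v))"
      using calculation[of n] by simp
    then show ?thesis using K that by simp
  qed
  ultimately have "rho h (Y u c v) = Y u c (rho h v) + Sum_any (\<lambda>n. \<Sum>i\<le>n. b (n - i) i)"
    unfolding rho_eq_sum[OF K(1)] rho_eq_sum[OF K(2)]
    by (subst Sum_any_eq_sum[of "{..<K}" "\<lambda>n. \<Sum>i\<le>n. b (n - i) i"]) (auto simp: sum.distrib Y_sum_right)
  also have "Sum_any (\<lambda>n. \<Sum>i\<le>n. b (n - i) i) = Sum_any (\<lambda>i. Sum_any (\<lambda>l. b l i))"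
    unfolding Sum_any_iterated[OF fin'] using Sum_any_diagonal[OF fin'] by simp
  also have "\<dots> = Sum_any (\<lambda>l. Sum_any (b l))"
    by (rule Sum_any_swap_finite[OF fin'])
  also have "Sum_any (b l) = Y (rho (fps_divided_deriv l h) u) (c - int l) v" for l
  proof -
    have "finite {i. scale (fps_divided_deriv l h $ i) (L (int i - 1) u) \<noteq> 0}"
      by (rule finite_subset[of _ "{..<M}"]) (use M in \<open>auto simp: not_le[symmetric]\<close>)
    then show ?thesis
      unfolding rho_def by (subst Y_Sum_any_left) (simp_all add: b_def fps_divided_deriv_def Y_scale_left)
  qed
  then have "Sum_any (\<lambda>l. Sum_any (b l)) = Sum_any (\<lambda>l. Y (rho (fps_divided_deriv l h) u) (c - int l) v)" by simp
  finally show "rho h (Y u c v) = Y u c (rho h v) + Sum_any (\<lambda>l. Y (rho (fps_divided_deriv l h) u) (c - int l) v)" .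
qed

end

context voa_flow begin

text \<open>The l-th divided derivative of \<open>\<xi>\<close> has order at least 2 - l, and
  \<open>rho\<close> of a series of order j raises weights by at most 1 - j. The cases l = 0, l = 1
  and l \<ge> 2 give -1, 0 and 1.\<close>

lemma weight_le_divided:
  assumes "weight_le s v"
  shows "weight_le (s + min 1 (int l - 1)) (rho (fps_divided_deriv l \<xi>) v)"
proof -
  have "fps_divided_deriv l \<xi> $ n = 0" if "n < 2 - l" for n
  proof -
    from that have "l + n = 0 \<or> l + n = 1" by auto
    then show ?thesis using \<xi> by (auto simp: fps_divided_deriv_def)
  qed
  from weight_le_rho[OF this assms] show ?thesis
    by (rule weight_le_mono) (auto simp: min_def of_nat_diff)
qed

text \<open>Replacing p by p - l, the two bounds require min 1 (l - 1) to be at most l/2 and at most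
  l - 1. The first is sharp at l = 2, which explains the slope 1/2 in
  \<open>filtered\<close>.\<close>

lemma filtered_theta:
  assumes "filtered q r m"
  shows "filtered q (r + 1) (theta \<xi> m)"
  unfolding filtered_def theta_def
proof (intro allI conjI weight_le_sum)
  fix p l :: nat assume l: "l \<in> {..p}"
  have "weight_le ((int (p - l) + q) div 2) (m (p - l))" "weight_le (int (p - l) - r) (m (p - l))"
    using assms by (auto simp: filtered_def)
  note w = this[THEN weight_le_divided[of _ _ l]]
  show "weight_le ((int p + q) div 2) (rho (fps_divided_deriv l \<xi>) (m (p - l)))"
    by (rule weight_le_mono[OF w(1)]) (use l in \<open>simp add: of_nat_diff min_def; linarith\<close>)
  show "weight_le (int p - (r + 1)) (rho (fps_divided_deriv l \<xi>) (m (p - l)))"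
    by (rule weight_le_mono[OF w(2)]) (use l in \<open>simp add: of_nat_diff min_def; linarith\<close>)
qed

lemma filtered_theta_power: "filtered q r m \<Longrightarrow> filtered q (r + int k) ((theta \<xi> ^^ k) m)"
proof (induction k)
  case (Suc k)
  then show ?case using filtered_theta[of q "r + int k" "(theta \<xi> ^^ k) m"] by (simp add: algebra_simps)
qed simp

text \<open>Summing \<open>rho_Y_commutator\<close> over the series, with the powers x^l and x^p
  combined, gives a Leibniz rule with \<open>theta\<close> on the series and X on the
  vector.\<close>

lemma X_series_action:
  assumes m: "filtered q r m"
  shows "X (series_action m v c) = series_action (theta \<xi> m) v c + series_action m (X v) c"
proof -
  define b where "b l p = Y (rho (fps_divided_deriv l \<xi>) (m p)) (c - int p - int l) v" for l p
  obtain s where s: "weight_le s v" using weight_le_exists by blast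
  have "finite {(l, p). b l p \<noteq> 0}"
  proof (rule finite_subset)
    let ?K = "nat (q + 2 * s + 2 * c + 2 - 2 * min_weight)"
    show "{(l, p). b l p \<noteq> 0} \<subseteq> {..?K} \<times> {..?K}"
    proof clarify
      fix l p assume "b l p \<noteq> 0"
      moreover have "weight_le ((int p + q) div 2 + min 1 (int l - 1)) (rho (fps_divided_deriv l \<xi>) (m p))"
        using m by (intro weight_le_divided) (simp add: filtered_def)
      ultimately have "min_weight \<le> ((int p + q) div 2 + min 1 (int l - 1)) + s + (c - int p - int l)"
        using s Y_bounded_nonzero unfolding b_def by blast
      then have "min_weight \<le> (int p + q) div 2 + 1 + s + c - int p - int l" by linarith
      then show "l \<in> {..?K} \<and> p \<in> {..?K}" by auto
    qed
  qed simp
  note fin = this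
  then have fin': "finite {(p, l). b l p \<noteq> 0}"
    by (rule finite_subset[rotated, OF finite_imageI[of _ "\<lambda>(x, y). (y, x)"]]) force
  have "X (series_action m v c) = Sum_any (\<lambda>p. X (Y (m p) (c - int p) v))"
    unfolding series_action_def by (rule Sum_any_additive[OF rho_add filtered_finite[OF m]])
  also have "\<dots> = Sum_any (\<lambda>p. Y (m p) (c - int p) (X v) + Sum_any (\<lambda>l. b l p))"
    by (simp add: rho_Y_commutator(2) b_def)
  also have "\<dots> = Sum_any (\<lambda>p. Y (m p) (c - int p) (X v)) + Sum_any (\<lambda>p. Sum_any (\<lambda>l. b l p))"
  proof (rule Sum_any.distrib[OF filtered_finite[OF m]])
    have "{p. Sum_any (\<lambda>l. b l p) \<noteq> 0} \<subseteq> fst ` {(p, l). b l p \<noteq> 0}"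
    proof
      fix p assume "p \<in> {p. Sum_any (\<lambda>l. b l p) \<noteq> 0}"
      then have "Sum_any (\<lambda>l. b l p) \<noteq> 0" by simp
      then obtain l where "b l p \<noteq> 0" by (rule Sum_any.not_neutral_obtains_not_neutral)
      then show "p \<in> fst ` {(p, l). b l p \<noteq> 0}" by force
    qed
    then show "finite {p. Sum_any (\<lambda>l. b l p) \<noteq> 0}" by (rule finite_subset) (use fin' in blast)
  qed
  also have "Sum_any (\<lambda>p. Sum_any (\<lambda>l. b l p)) = Sum_any (\<lambda>l. Sum_any (b l))"
    by (rule Sum_any_swap_finite[OF fin'])
  also have "\<dots> = Sum_any (\<lambda>k. \<Sum>l\<le>k. b l (k - l))"
    unfolding Sum_any_iterated[OF fin] by (rule Sum_any_diagonal[OF fin, symmetric])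
  also have "\<dots> = series_action (theta \<xi> m) v c"
  proof -
    have "(\<Sum>l\<le>k. b l (k - l)) = Y (theta \<xi> m k) (c - int k) v" for k
      unfolding theta_def Y_sum_left b_def by (rule sum.cong) (auto simp: of_nat_diff)
    then show ?thesis by (simp add: series_action_def)
  qed
  finally show ?thesis by (simp add: series_action_def add.commute)
qed

text \<open>The series \<open>m\<close> is \<open>e\<^sup>-\<^sup>x\<^sup>L\<^sup>(\<^sup>-\<^sup>1\<^sup>) E e\<^sup>x\<^sup>L\<^sup>(\<^sup>-\<^sup>1\<^sup>) u\<close>.\<close>

lemma E_Y_series:
  "\<exists>q r m. filtered q r m \<and> (\<forall>v c. E (Y u c v) = series_action m (E v) c)"
proof -
  obtain h where h: "weight_le h u" using weight_le_exists by blast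
  define m0 where "m0 = (\<lambda>p::nat. if p = 0 then u else 0)"
  define q r where "q = 2 * h" and "r = - h"
  have filt: "filtered q (r + int k) ((theta \<xi> ^^ k) m0)" for k
    unfolding q_def r_def m0_def by (intro filtered_theta_power filtered_const h)
  \<comment> \<open>The exponential of \<open>theta\<close> applied to the constant series u. Each
    power of \<open>theta\<close> raises \<open>r\<close> by one, so for fixed p the bound p - r - k
    falls below \<open>min_weight\<close> and the sum over k is finite.\<close>
  define m where "m p = Sum_any (\<lambda>k. scale (1 / fact k) ((theta \<xi> ^^ k) m0 p))" for p
  have finm: "finite {k. scale (1 / fact k) ((theta \<xi> ^^ k) m0 p) \<noteq> 0}" for p
  proof -
    have "{k. scale (1 / fact k) ((theta \<xi> ^^ k) m0 p) \<noteq> 0} \<subseteq> {..nat (int p - r - min_weight)}"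
    proof clarify
      fix k assume "scale (1 / fact k) ((theta \<xi> ^^ k) m0 p) \<noteq> 0"
      then have "(theta \<xi> ^^ k) m0 p \<noteq> 0" by auto
      moreover have "weight_le (int p - (r + int k)) ((theta \<xi> ^^ k) m0 p)"
        using filt[of k] by (simp add: filtered_def)
      ultimately have "\<not> int p - (r + int k) < min_weight" using weight_le_eq_0 by blast
      then show "k \<le> nat (int p - r - min_weight)" by linarith
    qed
    then show ?thesis by (rule finite_subset) simp
  qed
  have "filtered q r m"
    unfolding filtered_def m_def
  proof (intro allI conjI weight_le_Sum_any weight_le_scale)
    fix p k
    show "weight_le ((int p + q) div 2) ((theta \<xi> ^^ k) m0 p)"
      using filt[of k] by (simp add: filtered_def)
    have "weight_le (int p - (r + int k)) ((theta \<xi> ^^ k) m0 p)"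
      using filt[of k] by (simp add: filtered_def)
    then show "weight_le (int p - r) ((theta \<xi> ^^ k) m0 p)" by (rule weight_le_mono) simp
  qed
  moreover have "E (Y u c v) = series_action m (E v) c" for v c
  proof -
    obtain s where s: "weight_le s v" using weight_le_exists by blast
    define pv where "pv i = scale (1 / fact i) ((X ^^ i) v)" for i
    define b where "b j i = scale (1 / fact j) (series_action ((theta \<xi> ^^ j) m0) (pv i) c)" for j i
    have vanish: "Y ((theta \<xi> ^^ j) m0 p) (c - int p) v' = 0"
      if "weight_le s' v'" "c + s' - r - int j < min_weight" for j p s' v'
      by (rule filtered_vanishes[OF filt[of j] that(1)]) (use that in simp)
    have fin: "finite {(j, i). b j i \<noteq> 0}"
    proof (rule finite_subset)
      let ?K = "nat (c + s - r - min_weight)"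
      show "{(j, i). b j i \<noteq> 0} \<subseteq> {..?K} \<times> {..?K}"
      proof clarify
        fix j i assume nz: "b j i \<noteq> 0"
        have "\<not> c + (s - int i) - r - int j < min_weight"
        proof
          assume "c + (s - int i) - r - int j < min_weight"
          then have "series_action ((theta \<xi> ^^ j) m0) (pv i) c = 0"
            unfolding series_action_def pv_def
            using vanish[OF weight_le_scale[OF weight_le_X_power[OF s]]] by simp
          then show False using nz by (simp add: b_def)
        qed
        then show "j \<in> {..?K} \<and> i \<in> {..?K}" by auto
      qed
    qed simp
    have "scale (1 / fact k) ((X ^^ k) (Y u c v)) = (\<Sum>j\<le>k. b j (k - j))" for k
    proof -
      have "scale (1 / fact k) ((X ^^ k) (series_action m0 v c)) =
        (\<Sum>j\<le>k. scale (1 / (fact j * fact (k - j))) (series_action ((theta \<xi> ^^ j) m0) ((X ^^ (k - j)) v) c))"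
        by (rule leibniz_divided_power[of scale X "\<lambda>m v. series_action m v c" "theta \<xi>" m0 X v])
          (unfold_locales, simp_all add: rho_add rho_scale X_series_action[OF filt])
      then show ?thesis
        by (simp add: b_def pv_def m0_def series_action_const series_action_scale mult.commute)
    qed
    then have "E (Y u c v) = Sum_any (\<lambda>k. \<Sum>j\<le>k. b j (k - j))"
      by (simp add: E_def)
    also have "\<dots> = Sum_any (\<lambda>j. Sum_any (b j))"
      unfolding Sum_any_iterated[OF fin] by (rule Sum_any_diagonal[OF fin])
    also have "\<dots> = Sum_any (\<lambda>j. scale (1 / fact j) (series_action ((theta \<xi> ^^ j) m0) (E v) c))"
    proof -
      have "Sum_any (b j) = scale (1 / fact j) (series_action ((theta \<xi> ^^ j) m0) (E v) c)" for j
        unfolding b_def scale_Sum_any[symmetric] E_def pv_def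
        by (subst Sum_any_additive[where f = "\<lambda>v. series_action ((theta \<xi> ^^ j) m0) v c"])
          (simp_all add: series_action_add[OF filt] finite_X_power)
      then show ?thesis by simp
    qed
    also have "\<dots> = Sum_any (\<lambda>j. Sum_any (\<lambda>p. scale (1 / fact j) (Y ((theta \<xi> ^^ j) m0 p) (c - int p) (E v))))"
      by (simp add: series_action_def scale_Sum_any)
    also have "\<dots> = Sum_any (\<lambda>p. Sum_any (\<lambda>j. scale (1 / fact j) (Y ((theta \<xi> ^^ j) m0 p) (c - int p) (E v))))"
    proof (rule Sum_any_swap_finite)
      let ?t = "\<lambda>j p. scale (1 / fact j) (Y ((theta \<xi> ^^ j) m0 p) (c - int p) (E v))"
      have "{(j, p). ?t j p \<noteq> 0} \<subseteq> (SIGMA j:{..nat (c + s - r - min_weight)}. {p. Y ((theta \<xi> ^^ j) m0 p) (c - int p) (E v) \<noteq> 0})"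
      proof clarify
        fix j p assume "?t j p \<noteq> 0"
        then have nz: "Y ((theta \<xi> ^^ j) m0 p) (c - int p) (E v) \<noteq> 0" by auto
        then have "\<not> c + s - r - int j < min_weight" using vanish[OF weight_le_E[OF s]] by blast
        then show "j \<in> {..nat (c + s - r - min_weight)} \<and> p \<in> {p. Y ((theta \<xi> ^^ j) m0 p) (c - int p) (E v) \<noteq> 0}"
          using nz by auto
      qed
      then show "finite {(j, p). ?t j p \<noteq> 0}"
        by (rule finite_subset) (use filtered_finite[OF filt] in blast)
    qed
    also have "\<dots> = series_action m (E v) c"
      unfolding series_action_def m_def by (simp add: Y_Sum_any_left[OF finm] Y_scale_left)
    finally show ?thesis .
  qed
  ultimately show ?thesis by blast
qed

end

section \<open>Taylor expansion in L(-1), and uniqueness on the vacuum\<close>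

context vertex_operator_algebra begin

text \<open>L(-1)^k acts as the k-th derivative, and differentiating x^(e + k) k times gives the
  factor k! (e + k choose k).\<close>

lemma Y_L_minus1_power:
  "Y ((L (-1) ^^ k) u) e v = scale (fact k * ((of_int e + of_nat k) gchoose k)) (Y u (e + int k) v)"
proof (induction k arbitrary: e)
  case (Suc k)
  have "of_nat (Suc k) * ((of_int e + of_nat (Suc k) :: complex) gchoose Suc k)
      = (of_int e + 1) * ((of_int e + of_nat (Suc k)) gchoose k)"
    using gbinomial_absorption[of k "of_int e + of_nat (Suc k) :: complex"]
      gbinomial_absorb_comp[of "of_int e + of_nat (Suc k) :: complex" k]
    by simp
  moreover have "fact (Suc k) * ((of_int e + of_nat (Suc k) :: complex) gchoose Suc k)
      = fact k * (of_nat (Suc k) * ((of_int e + of_nat (Suc k)) gchoose Suc k))"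
    by (simp only: fact_Suc mult_ac)
  moreover have "of_int (e + 1) + of_nat k = (of_int e + of_nat (Suc k) :: complex)" by simp
  ultimately have main: "of_int (e + 1) * (fact k * ((of_int (e + 1) + of_nat k) gchoose k)) =
      fact (Suc k) * ((of_int e + of_nat (Suc k) :: complex) gchoose Suc k)"
    by (simp only: of_int_add of_int_1 mult_ac)
  have 1: "e + 1 + int k = e + int (Suc k)" by simp
  show ?case
    by (simp only: funpow.simps comp_apply L_minus1_derivative Suc.IH[of "e + 1", unfolded 1] scale_scale main)
qed simp

text \<open>The coefficient of x^p in A(x) exp((F(x) - x) L(-1)) w. For F = x + O(x^2) the power (F
  - x)^k has order at least 2 k, so stopping at k = p is exact.\<close>

definition taylor_coeffs :: "complex fps \<Rightarrow> complex fps \<Rightarrow> 'v \<Rightarrow> nat \<Rightarrow> 'v" where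
  "taylor_coeffs A F w p = (\<Sum>k\<le>p. scale ((A * (F - fps_X) ^ k) $ p / fact k) ((L (-1) ^^ k) w))"

text \<open>Taylor's theorem A(x) Y(w, F(x)) = A(x) Y(exp((F(x) - x) L(-1)) w, x). It gives a
  substituted vertex operator the shape found in \<open>E_Y_series\<close>, so that the two become
  comparable.\<close>

lemma taylor_series:
  assumes F: "F $ 0 = 0" "F $ 1 = 1"
  shows "finite {p. Y (taylor_coeffs A F w p) (c - int p) v \<noteq> 0}"
    and "Sum_any (\<lambda>d. scale ((fps_to_fls A * fps_to_fls F powi d) $$ c) (Y w d v)) =
      series_action (taylor_coeffs A F w) v c"
proof -
  define b where "b k j = scale ((A * (F - fps_X) ^ k) $ (j + k) * (of_int (c - int j) gchoose k)) (Y w (c - int j) v)" for k j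
  obtain m where m: "\<forall>n<m. Y w n v = 0" using Y_truncated by blast
  have ord: "(A * (F - fps_X) ^ k) $ n = 0" if "n < 2 * k" for n k
  proof -
    have "F - fps_X = fps_X ^ 2 * fps_shift 2 (F - fps_X)"
    proof (rule fps_ext)
      fix i show "(F - fps_X) $ i = (fps_X ^ 2 * fps_shift 2 (F - fps_X)) $ i"
      proof (cases "i < 2")
        case True
        then have "i = 0 \<or> i = 1" by auto
        then show ?thesis using F by (auto simp: fps_X_power_mult_nth)
      next
        case False
        then have "i - 2 + 2 = i" by simp
        then show ?thesis using False by (simp only: fps_X_power_mult_nth fps_shift_nth) simp
      qed
    qed
    then have "A * (F - fps_X) ^ k = fps_X ^ (2 * k) * (A * fps_shift 2 (F - fps_X) ^ k)"
      by (metis mult.left_commute power_mult power_mult_distrib)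
    then show ?thesis using that by (simp only: fps_X_power_mult_nth) simp
  qed
  \<comment> \<open>The order 2 k of (F - x)^k against the degree j + k gives k \<le> j, and
    truncation of Y(w, x) v bounds j.\<close>
  have nz: "k \<le> j \<and> j \<le> nat (c - m)" if "b k j \<noteq> 0" for k j
  proof
    show "k \<le> j" using that ord[of "j + k" k] by (cases "j + k < 2 * k") (auto simp: b_def)
    have "\<not> c - int j < m" using that m by (auto simp: b_def)
    then show "j \<le> nat (c - m)" by linarith
  qed
  have fin: "finite {(k, j). b k j \<noteq> 0}"
  proof (rule finite_subset)
    show "{(k, j). b k j \<noteq> 0} \<subseteq> {..nat (c - m)} \<times> {..nat (c - m)}" using nz by fastforce
  qed simp
  have Yb: "Y (taylor_coeffs A F w p) (c - int p) v = (\<Sum>k\<le>p. b k (p - k))" for p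
    unfolding taylor_coeffs_def Y_sum_left
  proof (rule sum.cong)
    fix k assume k: "k \<in> {..p}"
    have e: "of_int (c - int p) + of_nat k = (of_int (c - int (p - k)) :: complex)" "c - int p + int k = c - int (p - k)"
      "p - k + k = p"
      using k by (auto simp: of_nat_diff)
    then show "Y (scale ((A * (F - fps_X) ^ k) $ p / fact k) ((L (-1) ^^ k) w)) (c - int p) v = b k (p - k)"
      unfolding Y_scale_left Y_L_minus1_power b_def e scale_scale by simp
  qed simp
  show "finite {p. Y (taylor_coeffs A F w p) (c - int p) v \<noteq> 0}"
  proof (rule finite_subset)
    show "{p. Y (taylor_coeffs A F w p) (c - int p) v \<noteq> 0} \<subseteq> (\<lambda>(k, j). k + j) ` {(k, j). b k j \<noteq> 0}"
    proof clarify
      fix p assume "Y (taylor_coeffs A F w p) (c - int p) v \<noteq> 0"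
      then obtain k where "k \<le> p" "b k (p - k) \<noteq> 0"
        unfolding Yb by (metis (mono_tags, lifting) atMost_iff sum.neutral)
      then show "p \<in> (\<lambda>(k, j). k + j) ` {(k, j). b k j \<noteq> 0}"
        by (intro image_eqI[of _ _ "(k, p - k)"]) auto
    qed
  qed (use fin in blast)
  have "Sum_any (\<lambda>d. scale ((fps_to_fls A * fps_to_fls F powi d) $$ c) (Y w d v)) =
      Sum_any (\<lambda>j::nat. scale ((fps_to_fls A * fps_to_fls F powi (c - int j)) $$ c) (Y w (c - int j) v))"
  proof (rule Sum_any_reindex_inj)
    fix d assume "d \<notin> range (\<lambda>j::nat. c - int j)"
    moreover have "d \<in> range (\<lambda>j::nat. c - int j)" if "d \<le> c"
      using that by (intro image_eqI[of _ _ "nat (c - d)"]) auto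
    ultimately have "c < d" by linarith
    then show "scale ((fps_to_fls A * fps_to_fls F powi d) $$ c) (Y w d v) = 0"
      by (simp add: powi_taylor[OF F])
  qed (simp add: inj_def)
  also have "\<dots> = Sum_any (\<lambda>j. Sum_any (\<lambda>k. b k j))"
  proof -
    have "scale ((fps_to_fls A * fps_to_fls F powi (c - int j)) $$ c) (Y w (c - int j) v) = (\<Sum>k\<le>j. b k j)" for j
      by (simp add: powi_taylor[OF F] b_def scale_sum_left mult.commute)
    moreover have "Sum_any (\<lambda>k. b k j) = (\<Sum>k\<le>j. b k j)" for j
      by (rule Sum_any_eq_sum) (use nz in auto)
    ultimately show ?thesis by simp
  qed
  also have "\<dots> = Sum_any (\<lambda>k. Sum_any (b k))" by (rule Sum_any_swap_finite[OF fin, symmetric])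
  also have "\<dots> = Sum_any (\<lambda>p. \<Sum>k\<le>p. b k (p - k))"
    unfolding Sum_any_iterated[OF fin] by (rule Sum_any_diagonal[OF fin, symmetric])
  finally show "Sum_any (\<lambda>d. scale ((fps_to_fls A * fps_to_fls F powi d) $$ c) (Y w d v)) =
      series_action (taylor_coeffs A F w) v c"
    by (simp add: series_action_def Yb)
qed

lemma series_action_vac: "series_action m vac (int c) = (\<Sum>p\<le>c. Y (m p) (int c - int p) vac)"
  unfolding series_action_def by (rule Sum_any_eq_sum) (simp_all add: creation)

text \<open>By the creation property the coefficient of x^p on the vacuum is m_p plus terms in the
  m_k with k < p, so the system is triangular.\<close>

lemma series_action_vac_inj:
  assumes "\<And>c. series_action m vac (int c) = series_action m' vac (int c)"
  shows "m = m'"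
proof
  fix p show "m p = m' p"
  proof (induction p rule: less_induct)
    case (less p)
    have "series_action n vac (int p) = (\<Sum>k<p. Y (n k) (int p - int k) vac) + n p" for n
      unfolding series_action_vac by (simp add: lessThan_Suc_atMost[symmetric] creation)
    then show ?case using assms[of p] less by simp
  qed
qed

lemma comp_diff: "comp n (u - v) = comp n u - comp n v"
  using comp_add[of "u - v" v n] by simp

lemma L_vac: "n \<ge> -1 \<Longrightarrow> L n vac = 0"
  by (simp add: virasoro_def creation)

end

section \<open>The formula for E Y(u, x) v\<close>

text \<open>x^m stands for L(m - 1), hence the coefficient -a_(m-1). With this shift
  \<open>rho\<close> gives minus the sum of the a_n L(n), while \<open>field_act\<close> gives
  \<open>vector_field a\<close>.\<close>

definition change_field :: "(nat \<Rightarrow> complex) \<Rightarrow> complex fps" where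
  "change_field a = - Abs_fps (\<lambda>m. if m \<ge> 2 then a (m - 1) else 0)"

locale voa_change = vertex_operator_algebra scale grade Y vac conf
  for scale :: "complex \<Rightarrow> 'v::ab_group_add \<Rightarrow> 'v" and grade Y vac conf +
  fixes N :: nat and a :: "nat \<Rightarrow> complex"
  assumes N: "N > 0" and coeffs: "change_of_variable_coeffs N a"
begin

sublocale voa_flow scale grade Y vac conf "change_field a"
  by unfold_locales (simp_all add: change_field_def)

definition F :: "complex fps" where
  "F = fps_const (1 / of_nat N) * (1 + fps_X) ^ N - fps_const (1 / of_nat N)"

lemma field_exp_X: "field_exp (change_field a) fps_X = F"
proof -
  have "vector_field a = field_act (change_field a)"
    by (rule ext) (simp add: vector_field_def field_act_def change_field_def)
  then show ?thesis
    using coeffs sums_imp_fps_Sum[OF _ field_exp_locally_finite[OF \<xi>]]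
    by (simp add: change_of_variable_coeffs_def field_exp_def F_def)
qed

text \<open>The case h = 1 + x of \<open>E_rho\<close>, solved for E L(-1), the form in which it
  meets the L(-1)-derivative property.\<close>

lemma E_L_minus1: "E (L (-1) v) = L (-1) (E v) + scale (of_nat N) (L 0 (E v)) - E (L 0 v)"
proof -
  have "field_Ad (change_field a) (1 + fps_X) = 1 + fps_const (of_nat N) * fps_X"
    by (rule field_Ad_change_of_variable[OF \<xi> N]) (simp add: field_exp_X F_def)
  then have "E (rho (1 + fps_const 1 * fps_X) v) = rho (1 + fps_const (of_nat N) * fps_X) (E v)"
    by (simp add: E_rho)
  then show ?thesis unfolding rho_1_plus_X by (simp add: E_add algebra_simps)
qed

lemma E_vac [simp]: "E vac = vac"
proof -
  have "scale (change_field a $ n) (L (int n - 1) vac) = 0" for n by (simp add: L_vac)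
  then have "X vac = 0" unfolding rho_def by (simp only: Sum_any.neutral)
  then have "(X ^^ k) vac = (if k = 0 then vac else 0)" for k by (induction k) auto
  then show ?thesis unfolding E_def by (subst Sum_any_eq_sum[of "{0}"]) auto
qed

lemma F_nth: "F $ 0 = 0" "F $ 1 = 1"
proof -
  have "(1 + fps_X) ^ N = fps_binomial (of_nat N :: complex)" by (simp add: fps_binomial_of_nat)
  then show "F $ 0 = 0" "F $ 1 = 1" using N by (simp_all add: F_def)
qed

lemma F_fls: "fps_to_fls F = fls_const (1 / of_nat N) * power_minus_1 N"
proof -
  have "fps_to_fls F = fps_to_fls (fps_const (1 / of_nat N) * ((1 + fps_X) ^ N - 1))"
    by (simp add: F_def right_diff_distrib)
  also have "\<dots> = fls_const (1 / of_nat N) * power_minus_1 N"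
    by (simp only: fls_times_fps_to_fls power_minus_1_def one_plus_X_def) (simp add: fps_to_fls_power)
  finally show ?thesis .
qed

definition E_coeff :: "int \<Rightarrow> int \<Rightarrow> int \<Rightarrow> complex" where
  "E_coeff e d c = kappa N e d c / of_nat N powi d"

lemma E_coeff_altdef: "E_coeff e d c = (fps_to_fls (fps_binomial (of_int e)) * fps_to_fls F powi d) $$ c"
proof -
  have "fps_to_fls F powi d = fls_const (1 / of_nat N powi d) * power_minus_1 N powi d"
    by (simp add: F_fls power_int_mult_distrib power_int_divide_distrib flip: fls_const_power_int)
  then have "fps_to_fls (fps_binomial (of_int e)) * fps_to_fls F powi d =
      fls_const (1 / of_nat N powi d) * (one_plus_X powi e * power_minus_1 N powi d)"
    by (simp add: one_plus_X_powi mult_ac)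
  then show ?thesis by (simp add: E_coeff_def kappa_def)
qed

lemma E_coeff_eq_0: "c < d \<Longrightarrow> E_coeff e d c = 0"
  using N by (simp add: E_coeff_def kappa_eq_0)

lemma E_coeff_0: "E_coeff e 0 0 = 1"
  by (simp add: E_coeff_def kappa_def one_plus_X_powi)

text \<open>F' = (1 + x)^(N-1), hence the exponent e + N - 1 and no factor N.\<close>

lemma E_coeff_deriv: "of_int (c + 1) * E_coeff e d (c + 1) = of_int e * E_coeff (e - 1) d c + of_int d * E_coeff (e + int N - 1) (d - 1) c"
proof -
  have "of_nat N / of_nat N powi d = (1 :: complex) / of_nat N powi (d - 1)"
    using N by (simp add: power_int_diff)
  moreover have "of_int (c + 1) * E_coeff e d (c + 1) = of_int e * kappa N (e - 1) d c / of_nat N powi d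
      + of_int d * kappa N (e + int N - 1) (d - 1) c * (of_nat N / of_nat N powi d)"
    using kappa_deriv[OF N, of c e d] by (simp add: E_coeff_def add_divide_distrib mult.assoc)
  ultimately show ?thesis by (simp add: E_coeff_def)
qed

text \<open>In closed form, E Y(u, x) vac = Y((1 + x)^(N L(0) - h) E u, F(x)) vac. The
  L(-1)-derivative property expresses degree c + 1 for u by degree c for L(-1) u, which has weight h
  + 1. \<open>E_L_minus1\<close> on the left and the product rule for (1 + x)^e F^d on the right
  then give the same recursion.\<close>

lemma E_creation:
  assumes "u \<in> grade h"
  shows "E (Y u (int c) vac) =
    Sum_any (\<lambda>n. \<Sum>d\<le>c. scale (E_coeff (int N * n - h) (int d) (int c)) (Y (comp n (E u)) (int d) vac))"
  using assms
proof (induction c arbitrary: u h)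
  case 0
  then show ?case by (simp add: creation E_coeff_0 Sum_any_comp)
next
  case (Suc c)
  define H where "H e w = (\<Sum>d\<le>c. scale (E_coeff e (int d) (int c)) (Y w (int d) vac))" for e w
  have H_add: "H e (w + w') = H e w + H e w'" and H_scale: "H e (scale r w) = scale r (H e w)" for e w w' r
    unfolding H_def by (simp_all add: Y_add_left Y_scale_left scale_right_distrib sum.distrib scale_sum_right mult.commute)
  have H0 [simp]: "H e 0 = 0" for e by (simp add: H_def)
  define e where "e n = int N * n - h" for n
  define un where "un n = comp n (E u)" for n
  \<comment> \<open>Differentiating (1 + x)^e gives the first term. Differentiating F^d gives a
    factor d, which the L(-1)-derivative property absorbs into L(-1) w.\<close>
  have step: "scale (of_nat (Suc c)) (\<Sum>d\<le>Suc c. scale (E_coeff (e n) (int d) (int (Suc c))) (Y w (int d) vac))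
      = scale (of_int (e n)) (H (e n - 1) w) + H (e n + int N - 1) (L (-1) w)" for n w
  proof -
    have "of_nat (Suc c) * E_coeff (e n) (int d) (int (Suc c)) =
        of_int (e n) * E_coeff (e n - 1) (int d) (int c) + of_nat d * E_coeff (e n + int N - 1) (int d - 1) (int c)" for d
      using E_coeff_deriv[of "int c" "e n" "int d"] by (simp add: add.commute)
    then have "scale (of_nat (Suc c)) (\<Sum>d\<le>Suc c. scale (E_coeff (e n) (int d) (int (Suc c))) (Y w (int d) vac)) =
        (\<Sum>d\<le>Suc c. scale (of_int (e n) * E_coeff (e n - 1) (int d) (int c)) (Y w (int d) vac))
        + (\<Sum>d\<le>Suc c. scale (of_nat d * E_coeff (e n + int N - 1) (int d - 1) (int c)) (Y w (int d) vac))"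
      by (simp only: scale_sum_right scale_scale scale_left_distrib sum.distrib)
    moreover have "(\<Sum>d\<le>Suc c. scale (of_int (e n) * E_coeff (e n - 1) (int d) (int c)) (Y w (int d) vac)) = scale (of_int (e n)) (H (e n - 1) w)"
      by (simp add: H_def scale_sum_right E_coeff_eq_0)
    moreover have "(\<Sum>d\<le>Suc c. scale (of_nat d * E_coeff (e n + int N - 1) (int d - 1) (int c)) (Y w (int d) vac)) = H (e n + int N - 1) (L (-1) w)"
      unfolding H_def L_minus1_derivative
      by (subst sum.atMost_Suc_shift) (simp add: mult.commute add.commute)
    ultimately show ?thesis by simp
  qed
  have fin_un: "finite {n. un n \<noteq> 0}" by (simp add: un_def finite_comp)
  have "L (-1) u \<in> grade (h + 1)" using L_in_grade[OF Suc.prems, of "-1"] by simp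
  from Suc.IH[OF this] have "E (Y (L (-1) u) (int c) vac) = Sum_any (\<lambda>n. H (int N * n - (h + 1)) (comp n (E (L (-1) u))))"
    by (simp add: H_def)
  also have "\<dots> = Sum_any (\<lambda>n. H (e n - 1) (L (-1) (un (n - 1))) + scale (of_int (e n)) (H (e n - 1) (un n)))"
  proof (rule Sum_any.cong)
    fix n
    \<comment> \<open>N L(0) acts on the n-th component as N n and E L(0) u contributes -h; together
      they form the factor e n.\<close>
    have "comp n (E (L (-1) u)) = L (-1) (un (n - 1)) + scale (of_int (e n)) (un n)"
      unfolding E_L_minus1 L0_grade[OF Suc.prems] E_scale
      by (simp add: comp_add comp_scale comp_L L0_grade[OF comp_in_grade] un_def e_def scale_left_diff_distrib
          comp_diff)
    moreover have "int N * n - (h + 1) = e n - 1" by (simp add: e_def)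
    ultimately show "H (int N * n - (h + 1)) (comp n (E (L (-1) u))) =
        H (e n - 1) (L (-1) (un (n - 1))) + scale (of_int (e n)) (H (e n - 1) (un n))"
      by (simp only: H_add H_scale)
  qed
  also have "\<dots> = Sum_any (\<lambda>n. H (e n - 1) (L (-1) (un (n - 1)))) + Sum_any (\<lambda>n. scale (of_int (e n)) (H (e n - 1) (un n)))"
  proof (rule Sum_any.distrib)
    show "finite {n. H (e n - 1) (L (-1) (un (n - 1))) \<noteq> 0}"
    proof (rule finite_subset[OF _ finite_imageI[OF fin_un, of "\<lambda>n. n + 1"]], rule subsetI)
      fix n assume "n \<in> {n. H (e n - 1) (L (-1) (un (n - 1))) \<noteq> 0}"
      then have "un (n - 1) \<noteq> 0" by auto
      then show "n \<in> (\<lambda>n. n + 1) ` {n. un n \<noteq> 0}" by (intro image_eqI[of _ _ "n - 1"]) auto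
    qed
    show "finite {n. scale (of_int (e n)) (H (e n - 1) (un n)) \<noteq> 0}"
      by (rule finite_subset[OF _ fin_un]) auto
  qed
  \<comment> \<open>L(-1) moves component n - 1 to n. Reindexing brings both sums to the same
    component, with e (n + 1) - 1 = e n + N - 1.\<close>
  also have "Sum_any (\<lambda>n. H (e n - 1) (L (-1) (un (n - 1)))) = Sum_any (\<lambda>n. H (e n + int N - 1) (L (-1) (un n)))"
  proof (rule Sum_any.reindex_cong[of "\<lambda>n. n + 1"])
    show "bij (\<lambda>n::int. n + 1)" by (rule bij_betwI[of _ _ _ "\<lambda>n. n - 1"]) auto
    have "e (n + 1) - 1 = e n + int N - 1" for n by (simp add: e_def distrib_left)
    then show "(\<lambda>n. H (e n - 1) (L (-1) (un (n - 1)))) \<circ> (\<lambda>n. n + 1) = (\<lambda>n. H (e n + int N - 1) (L (-1) (un n)))"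
      by (simp add: comp_def del: diff_add_eq)
  qed
  also have "Sum_any (\<lambda>n. H (e n + int N - 1) (L (-1) (un n))) + Sum_any (\<lambda>n. scale (of_int (e n)) (H (e n - 1) (un n)))
      = Sum_any (\<lambda>n. scale (of_int (e n)) (H (e n - 1) (un n)) + H (e n + int N - 1) (L (-1) (un n)))"
    by (subst Sum_any.distrib) (auto intro: finite_subset[OF _ fin_un])
  also have "\<dots> = scale (of_nat (Suc c)) (Sum_any (\<lambda>n. \<Sum>d\<le>Suc c. scale (E_coeff (e n) (int d) (int (Suc c))) (Y (un n) (int d) vac)))"
    unfolding scale_Sum_any step ..
  finally have *: "E (Y (L (-1) u) (int c) vac) = \<dots>" .
  have "scale (of_nat (Suc c)) (E (Y u (int (Suc c)) vac)) = E (Y (L (-1) u) (int c) vac)"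
    unfolding L_minus1_derivative E_scale by (simp add: add.commute)
  from trans[OF this *] have "of_nat (Suc c) = (0 :: complex) \<or> E (Y u (int (Suc c)) vac) =
      Sum_any (\<lambda>n. \<Sum>d\<le>Suc c. scale (E_coeff (e n) (int d) (int (Suc c))) (Y (un n) (int d) vac))"
    by (simp only: scale_cancel_left) blast
  then show ?case
    unfolding e_def un_def using of_nat_neq_0 by blast
qed

text \<open>\<open>E_Y_series\<close> and \<open>taylor_series\<close> write the two sides as
  \<open>series_action\<close> of series m and m' on E v. As E fixes the vacuum,
  \<open>E_creation\<close> shows that they agree there, and \<open>series_action_vac_inj\<close>
  gives m = m'.\<close>

theorem E_Y:
  assumes "u \<in> grade h"
  shows "E (Y u c v) =
    Sum_any (\<lambda>n. Sum_any (\<lambda>d. scale (E_coeff (int N * n - h) d c) (Y (comp n (E u)) d (E v))))"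
proof -
  define S where "S = {n. comp n (E u) \<noteq> 0}"
  have S: "finite S" by (simp add: S_def finite_comp)
  define mn where "mn n = taylor_coeffs (fps_binomial (of_int (int N * n - h))) F (comp n (E u))" for n
  define m' where "m' p = (\<Sum>n\<in>S. mn n p)" for p
  have taylor: "Sum_any (\<lambda>n. Sum_any (\<lambda>d. scale (E_coeff (int N * n - h) d c) (Y (comp n (E u)) d v))) = series_action m' v c" for c v
  proof -
    have "Sum_any (\<lambda>n. Sum_any (\<lambda>d. scale (E_coeff (int N * n - h) d c) (Y (comp n (E u)) d v)))
        = (\<Sum>n\<in>S. Sum_any (\<lambda>d. scale (E_coeff (int N * n - h) d c) (Y (comp n (E u)) d v)))"
      by (rule Sum_any_eq_sum[OF S]) (simp add: S_def)
    also have "\<dots> = (\<Sum>n\<in>S. series_action (mn n) v c)"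
      unfolding E_coeff_altdef mn_def by (simp only: taylor_series(2)[OF F_nth])
    also have "\<dots> = series_action m' v c"
      unfolding series_action_def m'_def Y_sum_left
      by (rule Sum_any_sum[symmetric, OF S]) (simp add: mn_def taylor_series(1)[OF F_nth])
    finally show ?thesis .
  qed
  obtain m where m: "\<And>v c. E (Y u c v) = series_action m (E v) c"
    using E_Y_series by blast
  have "m = m'"
  proof (rule series_action_vac_inj)
    fix c
    have "series_action m vac (int c) = E (Y u (int c) vac)" using m[of "int c" vac] by simp
    also have "\<dots> = Sum_any (\<lambda>n. Sum_any (\<lambda>d. scale (E_coeff (int N * n - h) d (int c)) (Y (comp n (E u)) d vac)))"
    proof -
      have "Sum_any (\<lambda>d. scale (E_coeff e d (int c)) (Y w d vac)) = (\<Sum>d\<le>c. scale (E_coeff e (int d) (int c)) (Y w (int d) vac))" for e w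
      proof -
        have "Sum_any (\<lambda>d. scale (E_coeff e d (int c)) (Y w d vac)) = Sum_any (\<lambda>d::nat. scale (E_coeff e (int d) (int c)) (Y w (int d) vac))"
        proof (rule Sum_any_reindex_inj)
          fix d assume "d \<notin> range int"
          then have "d < 0" by (metis nonneg_int_cases not_le rangeI)
          then show "scale (E_coeff e d (int c)) (Y w d vac) = 0" by (simp add: creation)
        qed simp
        also have "\<dots> = (\<Sum>d\<le>c. scale (E_coeff e (int d) (int c)) (Y w (int d) vac))"
          by (rule Sum_any_eq_sum) (simp_all add: E_coeff_eq_0)
        finally show ?thesis .
      qed
      then show ?thesis by (simp add: E_creation[OF assms])
    qed
    also have "\<dots> = series_action m' vac (int c)" by (rule taylor)
    finally show "series_action m vac (int c) = series_action m' vac (int c)" .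
  qed
  then show ?thesis by (simp add: m taylor)
qed

end

section \<open>The operator \<Phi>(x) in terms of E\<close>

context vertex_operator_algebra begin

lemma additive_eqI:
  fixes f g :: "'v \<Rightarrow> 'b::ab_group_add"
  assumes "\<And>u v. f (u + v) = f u + f v" "\<And>u v. g (u + v) = g u + g v"
    and "\<And>h u. u \<in> grade h \<Longrightarrow> f u = g u"
  shows "f u = g u"
proof -
  have "f (Sum_any (\<lambda>n. comp n u)) = Sum_any (\<lambda>n. f (comp n u))"
    by (rule Sum_any_additive[OF assms(1) finite_comp])
  also have "\<dots> = Sum_any (\<lambda>n. g (comp n u))"
    using assms(3)[OF comp_in_grade] by simp
  also have "\<dots> = g (Sum_any (\<lambda>n. comp n u))"
    by (rule Sum_any_additive[OF assms(2) finite_comp, symmetric])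
  finally show ?thesis by (simp add: Sum_any_comp)
qed

end

context voa_change begin

lemma lowering_op_sum:
  assumes "finite S" "\<And>h. h \<in> S \<Longrightarrow> finite {m. f h m \<noteq> 0}"
  shows "lowering_op scale Y conf a (\<lambda>m. \<Sum>h\<in>S. f h m) m = (\<Sum>h\<in>S. lowering_op scale Y conf a (f h) m)"
proof -
  have "(if n \<ge> 1 then scale (a n) (L (int n) (\<Sum>h\<in>S. f h (m + int n))) else 0)
      = (\<Sum>h\<in>S. if n \<ge> 1 then scale (a n) (L (int n) (f h (m + int n))) else 0)" for n
    by (simp add: L_sum scale_sum_right)
  moreover have "finite {n. (if n \<ge> 1 then scale (a n) (L (int n) (f h (m + int n))) else 0) \<noteq> 0}" if "h \<in> S" for h
  proof (rule Sum_any_finite_image)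
    have "inj (\<lambda>n. m + int n)" by (simp add: inj_def)
    from finite_vimageI[OF assms(2)[OF that] this]
    show "finite {n. f h (m + int n) \<noteq> 0}" by (simp add: vimage_def)
  qed simp
  ultimately show ?thesis
    unfolding lowering_op_def by (simp add: Sum_any_sum[OF assms(1)] sum_negf)
qed

text \<open>x^-n L(n) lowers weight and exponent by the same n, so their difference is preserved.
  Starting from weight h, the coefficient of x^m is always the component of weight h + m.\<close>

lemma lowering_op_comp: "lowering_op scale Y conf a (\<lambda>m. comp (h + m) w) m = comp (h + m) (X w)"
proof -
  have fin: "finite {n. scale (change_field a $ n) (L (int n - 1) w) \<noteq> 0}"
  proof -
    obtain M where "\<forall>n\<ge>M. L (int n - 1) w = 0" using L_vanishes by blast
    then have "{n. scale (change_field a $ n) (L (int n - 1) w) \<noteq> 0} \<subseteq> {..<M}"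
      by (auto simp: not_le[symmetric])
    then show ?thesis by (rule finite_subset) simp
  qed
  have "comp (h + m) (X w) = Sum_any (\<lambda>n. comp (h + m) (scale (change_field a $ n) (L (int n - 1) w)))"
    unfolding rho_def by (rule comp_Sum_any[OF fin])
  also have "\<dots> = Sum_any (\<lambda>n. scale (change_field a $ n) (L (int n - 1) (comp (h + m + (int n - 1)) w)))"
    by (simp add: comp_scale comp_L)
  also have "\<dots> = Sum_any (\<lambda>n. scale (change_field a $ Suc n) (L (int n) (comp (h + (m + int n)) w)))"
  proof (subst Sum_any_reindex_inj[where \<iota> = Suc])
    fix n assume "n \<notin> range Suc"
    then have "n = 0" by (metis not0_implies_Suc rangeI)
    then show "scale (change_field a $ n) (L (int n - 1) (comp (h + m + (int n - 1)) w)) = 0"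
      using \<xi> by simp
  qed (simp_all add: add.assoc)
  also have "\<dots> = Sum_any (\<lambda>n. - (if n \<ge> 1 then scale (a n) (L (int n) (comp (h + (m + int n)) w)) else 0))"
    by (rule Sum_any.cong) (simp add: change_field_def)
  also have "\<dots> = - Sum_any (\<lambda>n. if n \<ge> 1 then scale (a n) (L (int n) (comp (h + (m + int n)) w)) else 0)"
    by (simp add: Sum_any.expand_set sum_negf)
  finally show ?thesis by (simp add: lowering_op_def)
qed

definition supp :: "'v \<Rightarrow> int set" where "supp u = {h. comp h u \<noteq> 0}"

lemma finite_supp: "finite (supp u)"
  by (simp add: supp_def finite_comp)

lemma finite_comp_shift: "finite {m. comp (h + m) w \<noteq> 0}"
proof -
  have "inj (\<lambda>m. h + m)" by (simp add: inj_def)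
  from finite_vimageI[OF finite_comp[of w] this] show ?thesis by (simp add: vimage_def)
qed

lemma lowering_op_power:
  "(lowering_op scale Y conf a ^^ k) (\<lambda>m. if m = 0 then u else 0)
    = (\<lambda>m. \<Sum>h\<in>supp u. comp (h + m) ((X ^^ k) (comp h u)))"
proof (induction k)
  case 0
  have "(if m = 0 then u else 0) = (\<Sum>h\<in>supp u. comp (h + m) (comp h u))" for m
  proof -
    have "(\<Sum>h\<in>supp u. comp (h + m) (comp h u)) = (\<Sum>h\<in>supp u. if m = 0 then comp h u else 0)"
      by (rule sum.cong) (auto simp: comp_comp)
    also have "\<dots> = (if m = 0 then u else 0)"
      using Sum_any_comp[of u] by (simp add: Sum_any.expand_set supp_def)
    finally show ?thesis by simp
  qed
  then show ?case by simp
next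
  case (Suc k)
  show ?case
  proof
    fix m
    have "(lowering_op scale Y conf a ^^ Suc k) (\<lambda>m. if m = 0 then u else 0) m
        = lowering_op scale Y conf a (\<lambda>m. \<Sum>h\<in>supp u. comp (h + m) ((X ^^ k) (comp h u))) m"
      by (simp add: Suc)
    also have "\<dots> = (\<Sum>h\<in>supp u. comp (h + m) (X ((X ^^ k) (comp h u))))"
      by (subst lowering_op_sum[OF finite_supp finite_comp_shift]) (simp only: lowering_op_comp)
    finally show "(lowering_op scale Y conf a ^^ Suc k) (\<lambda>m. if m = 0 then u else 0) m =
      (\<Sum>h\<in>supp u. comp (h + m) ((X ^^ Suc k) (comp h u)))" by simp
  qed
qed

lemma exp_lowering_op_eq:
  "exp_lowering_op scale Y conf a (\<lambda>m. if m = 0 then u else 0) m = (\<Sum>h\<in>supp u. comp (h + m) (E (comp h u)))"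
proof -
  have "exp_lowering_op scale Y conf a (\<lambda>m. if m = 0 then u else 0) m =
      Sum_any (\<lambda>k. \<Sum>h\<in>supp u. scale (1 / fact k) (comp (h + m) ((X ^^ k) (comp h u))))"
    by (simp add: exp_lowering_op_def lowering_op_power scale_sum_right)
  also have "\<dots> = (\<Sum>h\<in>supp u. Sum_any (\<lambda>k. scale (1 / fact k) (comp (h + m) ((X ^^ k) (comp h u)))))"
  proof (rule Sum_any_sum[OF finite_supp])
    fix h show "finite {k. scale (1 / fact k) (comp (h + m) ((X ^^ k) (comp h u))) \<noteq> 0}"
      by (rule Sum_any_finite_image[OF finite_X_power[of "comp h u"]]) simp
  qed
  also have "\<dots> = (\<Sum>h\<in>supp u. comp (h + m) (E (comp h u)))"
    unfolding E_def by (simp add: comp_Sum_any[OF finite_E] comp_scale)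
  finally show ?thesis .
qed

definition change_op :: "'v \<Rightarrow> int \<Rightarrow> 'v" where "change_op = Phi scale grade Y conf N a"

text \<open>A component of weight n coming from weight h carries x^(n - h) from the exponential and
  x^((N - 1) n) from (N x^(N-1))^L(0). So m = N n - h, which determines h.\<close>

lemma change_op_eq: "change_op u m = Sum_any (\<lambda>n. scale (of_nat N powi n) (comp n (E (comp (int N * n - m) u))))"
  unfolding change_op_def Phi_def monomial_pow_L0_def exp_lowering_op_eq
proof (rule Sum_any.cong)
  fix n
  have "comp n (\<Sum>h\<in>supp u. comp (h + (m - (int N - 1) * n)) (E (comp h u)))
      = (\<Sum>h\<in>supp u. if h = int N * n - m then comp n (E (comp h u)) else 0)"
    unfolding comp_sum
  proof (rule sum.cong)
    fix h
    have "n = h + (m - (int N - 1) * n) \<longleftrightarrow> h = int N * n - m" by (auto simp: algebra_simps)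
    then show "comp n (comp (h + (m - (int N - 1) * n)) (E (comp h u))) = (if h = int N * n - m then comp n (E (comp h u)) else 0)"
      unfolding comp_comp by (auto simp del: mult_minus_left)
  qed simp
  also have "\<dots> = comp n (E (comp (int N * n - m) u))"
    using finite_supp[of u] by (auto simp: supp_def)
  finally show "scale (of_nat N powi n) (comp n (\<Sum>h\<in>supp u. comp (h + (m - (int N - 1) * n)) (E (comp h u))))
      = scale (of_nat N powi n) (comp n (E (comp (int N * n - m) u)))" by simp
qed

lemma change_op_finite_sum: "finite {n. scale (of_nat N powi n) (comp n (E (comp (int N * n - m) u))) \<noteq> 0}"
proof (rule Sum_any_finite_image)
  have "inj (\<lambda>n. int N * n - m)" using N by (simp add: inj_def)
  from finite_vimageI[OF finite_comp[of u] this]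
  show "finite {n. comp (int N * n - m) u \<noteq> 0}" by (simp add: vimage_def)
qed simp

lemma change_op_add: "change_op (u + v) m = change_op u m + change_op v m"
  unfolding change_op_eq comp_add E_add scale_right_distrib by (rule Sum_any.distrib[OF change_op_finite_sum change_op_finite_sum])

lemma change_op_scale: "change_op (scale c u) m = scale c (change_op u m)"
  unfolding change_op_eq comp_scale E_scale scale_Sum_any by (simp add: mult.commute)

lemma change_op_grade:
  assumes "u \<in> grade h"
  shows "change_op u (int N * n - h) = scale (of_nat N powi n) (comp n (E u))"
    and "m \<notin> range (\<lambda>n. int N * n - h) \<Longrightarrow> change_op u m = 0"
proof -
  have eq: "int N * k - (int N * n - h) = h \<longleftrightarrow> k = n" for k n using N by simp
  show "change_op u (int N * n - h) = scale (of_nat N powi n) (comp n (E u))"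
    unfolding change_op_eq comp_grade[OF assms] eq
    by (simp add: if_distrib[of E] if_distrib[of "comp _"] if_distrib[of "scale _"] cong: if_cong)
  assume "m \<notin> range (\<lambda>n. int N * n - h)"
  have "int N * k - m \<noteq> h" for k
  proof
    assume "int N * k - m = h"
    then have "m = int N * k - h" by simp
    with \<open>m \<notin> range (\<lambda>n. int N * n - h)\<close> show False by blast
  qed
  then show "change_op u m = 0" unfolding change_op_eq comp_grade[OF assms] by simp
qed

lemma finite_change_op: "finite {m. change_op u m \<noteq> 0}"
proof -
  have "{m. change_op u m \<noteq> 0} \<subseteq> (\<lambda>(h, n). int N * n - h) ` (SIGMA h:supp u. {n. comp n (E (comp h u)) \<noteq> 0})"
  proof
    fix m assume "m \<in> {m. change_op u m \<noteq> 0}"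
    then have "change_op u m \<noteq> 0" by simp
    then obtain n where n: "scale (of_nat N powi n) (comp n (E (comp (int N * n - m) u))) \<noteq> 0"
      unfolding change_op_eq by (rule Sum_any.not_neutral_obtains_not_neutral)
    then have "int N * n - m \<in> supp u" "comp n (E (comp (int N * n - m) u)) \<noteq> 0"
      by (auto simp: supp_def)
    then show "m \<in> (\<lambda>(h, n). int N * n - h) ` (SIGMA h:supp u. {n. comp n (E (comp h u)) \<noteq> 0})"
      by (intro image_eqI[of _ _ "(int N * n - m, n)"]) auto
  qed
  then show ?thesis by (rule finite_subset) (simp add: finite_supp finite_comp)
qed

lemma change_op_vac: "change_op vac m = (if m = 0 then vac else 0)"
proof -
  have "scale (of_nat N powi n) (comp n (E (comp (int N * n - m) vac))) =
      (if n = 0 then (if m = 0 then vac else 0) else 0)" for n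
    by (auto simp: comp_grade[OF vac_grade])
  then show ?thesis unfolding change_op_eq by simp
qed

end

section \<open>The iterate formula for the new vertex operators\<close>

locale voa_change_module = voa_change scale grade Y vac conf N a + W: vertex_map_space scale sW YW
  for scale :: "complex \<Rightarrow> 'v::ab_group_add \<Rightarrow> 'v" and grade Y vac conf N a
    and sW :: "complex \<Rightarrow> 'w::ab_group_add \<Rightarrow> 'w" and YW
begin

definition Yt :: "'v \<Rightarrow> int \<Rightarrow> 'w \<Rightarrow> 'w" where
  "Yt u n w = Sum_any (\<lambda>m. YW (change_op u m) (n - m) w)"

lemma Yt_eq: "Y_tilde scale grade Y conf N a YW = Yt"
  by (intro ext) (simp add: Y_tilde_def Yt_def change_op_def)

lemma finite_Yt: "finite {m. YW (change_op u m) (n - m) w \<noteq> 0}"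
  by (rule Sum_any_finite_image[OF finite_change_op[of u]]) simp

lemma Yt_add: "Yt (u + v) n w = Yt u n w + Yt v n w"
  unfolding Yt_def change_op_add W.Y_add_left by (rule Sum_any.distrib[OF finite_Yt finite_Yt])

lemma Yt_add_right: "Yt u n (w + w') = Yt u n w + Yt u n w'"
  unfolding Yt_def W.Y_add_right by (rule Sum_any.distrib[OF finite_Yt finite_Yt])

lemma Yt_scale: "Yt (scale c u) n w = sW c (Yt u n w)"
  unfolding Yt_def change_op_scale W.Y_scale_left W.W.scale_Sum_any ..

lemma Yt_scale_right: "Yt u n (sW c w) = sW c (Yt u n w)"
  unfolding Yt_def W.Y_scale_right W.W.scale_Sum_any ..

lemma Yt_vertex_map: "vertex_map scale sW Yt"
  unfolding vertex_map_def
proof (intro conjI allI)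
  show "Vector_Spaces.linear scale sW (\<lambda>v. Yt v n w)" for n w
    by unfold_locales (simp_all add: Yt_add Yt_scale)
  show "Vector_Spaces.linear sW sW (Yt v n)" for v n
    by unfold_locales (simp_all add: Yt_add_right Yt_scale_right)
  fix u w
  have "\<forall>m. \<exists>k. \<forall>n<k. YW (change_op u m) n w = 0" using W.Y_truncated by blast
  from choice[OF this] obtain f where f: "\<forall>m. \<forall>n<f m. YW (change_op u m) n w = 0" by blast
  define S where "S = {m. change_op u m \<noteq> 0}"
  define m0 where "m0 = Min (insert 0 ((\<lambda>m. f m + m) ` S))"
  have "finite S" by (simp add: S_def finite_change_op)
  have "Yt u n w = 0" if "n < m0" for n
  proof -
    have "YW (change_op u m) (n - m) w = 0" for m
    proof (cases "m \<in> S")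
      case True
      then have "m0 \<le> f m + m" using \<open>finite S\<close> unfolding m0_def by (intro Min_le) auto
      then have "n - m < f m" using that by simp
      then show ?thesis using f by blast
    qed (simp add: S_def)
    then show ?thesis by (simp add: Yt_def)
  qed
  then show "\<exists>m. \<forall>n<m. Yt u n w = 0" by blast
qed

text \<open>The coefficient of x0^c x2^(e - c) in (x2 + x0)^b x2^(m - b) Y_W(Y(x, (x2 + x0)^N -
  x2^N) y, x2^N) w; so \<open>e\<close> is the total degree in x0 and x2.\<close>

definition iterate_term :: "int \<Rightarrow> int \<Rightarrow> int \<Rightarrow> 'w \<Rightarrow> int \<Rightarrow> 'v \<Rightarrow> 'v \<Rightarrow> 'w" where
  "iterate_term m b c w e x y = Sum_any (\<lambda>d. sW (kappa N b d c) (YW (Y x d y) (e - m - int N * d) w))"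

lemma finite_kappa_Y: "finite {d. sW (kappa N b d c) (YW (Y x d y) (f d) w) \<noteq> 0}"
proof -
  obtain d0 where d0: "\<forall>d<d0. Y x d y = 0" using Y_truncated by blast
  have "{d. sW (kappa N b d c) (YW (Y x d y) (f d) w) \<noteq> 0} \<subseteq> {d0..c}"
  proof clarify
    fix d assume nz: "sW (kappa N b d c) (YW (Y x d y) (f d) w) \<noteq> 0"
    then have "\<not> c < d" using kappa_eq_0[OF N, of c d b] by auto
    moreover have "\<not> d < d0" using nz d0 by auto
    ultimately show "d \<in> {d0..c}" by simp
  qed
  then show ?thesis by (rule finite_subset) simp
qed

lemma iterate_term_add1: "iterate_term m b c w e (x + x') y = iterate_term m b c w e x y + iterate_term m b c w e x' y"
  unfolding iterate_term_def Y_add_left W.Y_add_left W.W.scale_right_distrib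
  by (rule Sum_any.distrib[OF finite_kappa_Y finite_kappa_Y])

lemma iterate_term_add2: "iterate_term m b c w e x (y + y') = iterate_term m b c w e x y + iterate_term m b c w e x y'"
  unfolding iterate_term_def Y_add_right W.Y_add_left W.W.scale_right_distrib
  by (rule Sum_any.distrib[OF finite_kappa_Y finite_kappa_Y])

lemma iterate_term_zero [simp]: "iterate_term m b c w e 0 y = 0" "iterate_term m b c w e x 0 = 0"
  by (simp_all add: iterate_term_def)

lemma Yt_iterate_homogeneous:
  assumes u: "u \<in> grade h" and v: "v \<in> grade s"
  shows "Yt (Y u c v) e w = Sum_any (\<lambda>m. Sum_any (\<lambda>m'. iterate_term (m + m') m c w (e + c) (change_op u m) (change_op v m')))"
proof -
  define t where "t = h + s + c"
  have z: "Y u c v \<in> grade t" unfolding t_def by (rule Y_in_grade[OF u v])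
  \<comment> \<open>\<open>\<tau>\<close> applies N^L(0), the powers of x and then
    \<open>YW\<close>, so that the left-hand side becomes \<open>\<tau>\<close> of E (Y u c v) and
    \<open>E_Y\<close> can be inserted.\<close>
  define \<tau> where "\<tau> x = Sum_any (\<lambda>n. sW (of_nat N powi n) (YW (comp n x) (e - int N * n + t) w))" for x
  have fin\<tau>: "finite {n. sW (of_nat N powi n) (YW (comp n x) (e - int N * n + t) w) \<noteq> 0}" for x
    by (rule Sum_any_finite_image[OF finite_comp[of x]]) simp
  have \<tau>_add: "\<tau> (x + y) = \<tau> x + \<tau> y" for x y
    unfolding \<tau>_def comp_add W.Y_add_left W.W.scale_right_distrib by (rule Sum_any.distrib[OF fin\<tau> fin\<tau>])
  have \<tau>_scale: "\<tau> (scale r x) = sW r (\<tau> x)" for r x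
    unfolding \<tau>_def comp_scale W.Y_scale_left W.W.scale_Sum_any by (simp add: mult.commute)
  have \<tau>_grade: "\<tau> x = sW (of_nat N powi n) (YW x (e - int N * n + t) w)" if "x \<in> grade n" for x n
    unfolding \<tau>_def comp_grade[OF that]
    by (simp add: if_distrib[of "\<lambda>x. YW x _ _"] if_distrib[of "sW _"] cong: if_cong)
  have inj: "inj (\<lambda>n. int N * n - k)" for k using N by (simp add: inj_def)
  have "Yt (Y u c v) e w = Sum_any (\<lambda>n. YW (change_op (Y u c v) (int N * n - t)) (e - (int N * n - t)) w)"
    unfolding Yt_def by (rule Sum_any_reindex_inj[OF inj]) (simp add: change_op_grade(2)[OF z])
  also have "\<dots> = \<tau> (E (Y u c v))"
    by (simp add: change_op_grade(1)[OF z] W.Y_scale_left \<tau>_def diff_diff_eq2 diff_add_eq)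
  also have "E (Y u c v) = Sum_any (\<lambda>i. Sum_any (\<lambda>d. scale (E_coeff (int N * i - h) d c) (Y (comp i (E u)) d (E v))))"
    by (rule E_Y[OF u])
  also have "\<tau> \<dots> = Sum_any (\<lambda>i. \<tau> (Sum_any (\<lambda>d. scale (E_coeff (int N * i - h) d c) (Y (comp i (E u)) d (E v)))))"
    by (rule Sum_any_additive[OF \<tau>_add]) (rule Sum_any_finite_image[OF finite_comp[of "E u"]], simp)
  also have "\<dots> = Sum_any (\<lambda>i. Sum_any (\<lambda>j. iterate_term (int N * i - h + (int N * j - s)) (int N * i - h) c w (e + c)
      (change_op u (int N * i - h)) (change_op v (int N * j - s))))"
  proof (rule Sum_any.cong)
    fix i
    let ?x = "comp i (E u)"
    have fd: "finite {d. scale (E_coeff b d c) (Y x d y) \<noteq> 0}" for b x y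
    proof -
      obtain d0 where d0: "\<forall>d<d0. Y x d y = 0" using Y_truncated by blast
      have "{d. scale (E_coeff b d c) (Y x d y) \<noteq> 0} \<subseteq> {d0..c}"
      proof clarify
        fix d assume nz: "scale (E_coeff b d c) (Y x d y) \<noteq> 0"
        then have "\<not> c < d" using E_coeff_eq_0[of c d b] by auto
        moreover have "\<not> d < d0" using nz d0 by auto
        ultimately show "d \<in> {d0..c}" by simp
      qed
      then show ?thesis by (rule finite_subset) simp
    qed
    define G where "G y = \<tau> (Sum_any (\<lambda>d. scale (E_coeff (int N * i - h) d c) (Y ?x d y)))" for y
    have G_add: "G (y + y') = G y + G y'" for y y'
      unfolding G_def Y_add_right scale_right_distrib Sum_any.distrib[OF fd fd] \<tau>_add ..
    have "\<tau> (Sum_any (\<lambda>d. scale (E_coeff (int N * i - h) d c) (Y ?x d (E v)))) = G (Sum_any (\<lambda>j. comp j (E v)))"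
      by (simp add: G_def Sum_any_comp)
    also have "\<dots> = Sum_any (\<lambda>j. G (comp j (E v)))"
      by (rule Sum_any_additive[OF G_add finite_comp])
    also have "\<dots> = Sum_any (\<lambda>j. iterate_term (int N * i - h + (int N * j - s)) (int N * i - h) c w (e + c)
      (change_op u (int N * i - h)) (change_op v (int N * j - s)))"
    proof (rule Sum_any.cong)
      fix j
      let ?y = "comp j (E v)"
      have "G ?y = Sum_any (\<lambda>d. \<tau> (scale (E_coeff (int N * i - h) d c) (Y ?x d ?y)))"
        unfolding G_def by (rule Sum_any_additive[OF \<tau>_add fd])
      also have "\<dots> = iterate_term (int N * i - h + (int N * j - s)) (int N * i - h) c w (e + c)
        (change_op u (int N * i - h)) (change_op v (int N * j - s))"
        unfolding iterate_term_def
      proof (rule Sum_any.cong)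
        fix d
        have xy: "Y ?x d ?y \<in> grade (i + j + d)" by (rule Y_in_grade[OF comp_in_grade comp_in_grade])
        have e: "e - int N * (i + j + d) + t = e + c - (int N * i - h + (int N * j - s)) - int N * d"
          by (simp add: t_def algebra_simps)
        \<comment> \<open>The vector Y ?x d ?y has weight i + j + d. Its N^d cancels the N^-d in
          \<open>E_coeff\<close>, and N^i, N^j belong to the two values of
          \<open>change_op\<close>.\<close>
        have k: "E_coeff (int N * i - h) d c * of_nat N powi (i + j + d) =
            kappa N (int N * i - h) d c * (of_nat N powi i * of_nat N powi j)"
          using N by (simp add: E_coeff_def power_int_add)
        have "\<tau> (scale (E_coeff (int N * i - h) d c) (Y ?x d ?y)) =
            sW (E_coeff (int N * i - h) d c * of_nat N powi (i + j + d)) (YW (Y ?x d ?y) (e - int N * (i + j + d) + t) w)"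
          unfolding \<tau>_scale \<tau>_grade[OF xy] by simp
        also have "\<dots> = sW (kappa N (int N * i - h) d c) (YW (Y (change_op u (int N * i - h)) d (change_op v (int N * j - s)))
            (e + c - (int N * i - h + (int N * j - s)) - int N * d) w)"
          unfolding k e change_op_grade(1)[OF u] change_op_grade(1)[OF v]
          by (simp add: Y_scale_left Y_scale_right W.Y_scale_left)
        finally show "\<tau> (scale (E_coeff (int N * i - h) d c) (Y ?x d ?y)) = sW (kappa N (int N * i - h) d c) (YW (Y (change_op u (int N * i - h)) d (change_op v (int N * j - s)))
            (e + c - (int N * i - h + (int N * j - s)) - int N * d) w)" .
      qed
      finally show "G ?y = iterate_term (int N * i - h + (int N * j - s)) (int N * i - h) c w (e + c)
        (change_op u (int N * i - h)) (change_op v (int N * j - s))" .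
    qed
    finally show "\<tau> (Sum_any (\<lambda>d. scale (E_coeff (int N * i - h) d c) (Y ?x d (E v)))) =
      Sum_any (\<lambda>j. iterate_term (int N * i - h + (int N * j - s)) (int N * i - h) c w (e + c)
      (change_op u (int N * i - h)) (change_op v (int N * j - s)))" .
  qed
  also have "\<dots> = Sum_any (\<lambda>i. Sum_any (\<lambda>m'. iterate_term (int N * i - h + m') (int N * i - h) c w (e + c)
      (change_op u (int N * i - h)) (change_op v m')))"
    by (rule Sum_any.cong, rule Sum_any_reindex_inj[OF inj, symmetric]) (simp add: change_op_grade(2)[OF v])
  also have "\<dots> = Sum_any (\<lambda>m. Sum_any (\<lambda>m'. iterate_term (m + m') m c w (e + c) (change_op u m) (change_op v m')))"
    by (rule Sum_any_reindex_inj[OF inj, symmetric]) (simp add: change_op_grade(2)[OF u])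
  finally show ?thesis .
qed

text \<open>\<open>\<Phi>(x\<^sub>2) Y(u, x\<^sub>0) v = Y(\<Phi>(x\<^sub>2 + x\<^sub>0) u, (x\<^sub>2 + x\<^sub>0)\<^sup>N - x\<^sub>2\<^sup>N) \<Phi>(x\<^sub>2) v\<close>, inserted into \<open>Y\<^sub>W(\<cdot>, x\<^sub>2\<^sup>N)\<close>\<close>

lemma Yt_iterate:
  "Yt (Y u c v) e w = Sum_any (\<lambda>m. Sum_any (\<lambda>m'. iterate_term (m + m') m c w (e + c) (change_op u m) (change_op v m')))"
proof -
  define R where "R u v = Sum_any (\<lambda>m. Sum_any (\<lambda>m'. iterate_term (m + m') m c w (e + c) (change_op u m) (change_op v m')))" for u v
  have fin2: "finite {m'. iterate_term (m + m') m c w (e + c) x (change_op v m') \<noteq> 0}" for m x v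
    by (rule Sum_any_finite_image[OF finite_change_op[of v]]) simp
  have fin1: "finite {m. Sum_any (\<lambda>m'. iterate_term (m + m') m c w (e + c) (change_op u m) (change_op v m')) \<noteq> 0}" for u v
    by (rule Sum_any_finite_image[OF finite_change_op[of u]]) simp
  have R1: "R (u + u') v = R u v + R u' v" for u u' v
    unfolding R_def change_op_add iterate_term_add1 Sum_any.distrib[OF fin2 fin2]
    by (rule Sum_any.distrib[OF fin1 fin1])
  have R2: "R u (v + v') = R u v + R u v'" for u v v'
    unfolding R_def change_op_add iterate_term_add2 Sum_any.distrib[OF fin2 fin2]
    by (rule Sum_any.distrib[OF fin1 fin1])
  have "Yt (Y u c v) e w = R u v"
  proof (rule additive_eqI[of "\<lambda>u. Yt (Y u c v) e w" "\<lambda>u. R u v"])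
    fix h u assume u: "u \<in> grade h"
    show "Yt (Y u c v) e w = R u v"
      by (rule additive_eqI[of "\<lambda>v. Yt (Y u c v) e w" "\<lambda>v. R u v"])
        (simp_all add: R2 Y_add_right Yt_add, simp add: R_def Yt_iterate_homogeneous[OF u])
  qed (simp_all add: R1 Y_add_left Yt_add)
  then show ?thesis by (simp add: R_def)
qed

end

section \<open>Formal delta functions as multiplication by power series\<close>

lemma one_minus_XN_powi_nth:
  assumes "N > 0"
  shows "one_minus_XN_powi N n $ s = (if N dvd s then (of_int n gchoose (s div N)) * (-1) ^ (s div N) else 0)"
proof -
  have "one_minus_XN_powi N n $ s = (\<Sum>i=0..s. one_minus_X_powi n $ i * (if s = N * i then 1 else 0))"
    unfolding one_minus_XN_powi_def fps_compose_nth by (simp add: fps_X_power_nth flip: power_mult)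
  also have "\<dots> = (\<Sum>i=0..s. if i = s div N then (if N dvd s then one_minus_X_powi n $ i else 0) else 0)"
    using assms by (intro sum.cong) auto
  also have "\<dots> = (if N dvd s then one_minus_X_powi n $ (s div N) else 0)"
    using assms by simp
  finally show ?thesis by (simp add: one_minus_X_powi_def)
qed

lemma one_minus_XN_powi_1: "one_minus_XN_powi 1 n = one_minus_X_powi n"
  by (simp add: one_minus_XN_powi_def)

locale complex_vector_space = vector_space scale
  for scale :: "complex \<Rightarrow> 'w::ab_group_add \<Rightarrow> 'w"
begin

text \<open>\<open>act P F\<close> is the product of \<open>P(x\<^sub>2/x\<^sub>1)\<close> with the series \<open>F\<close> in \<open>x\<^sub>1, x\<^sub>2\<close>.\<close>

definition act :: "complex fps \<Rightarrow> (int \<Rightarrow> int \<Rightarrow> 'w) \<Rightarrow> int \<Rightarrow> int \<Rightarrow> 'w" where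
  "act P F b c = Sum_any (\<lambda>s. scale (P $ s) (F (b + int s) (c - int s)))"

text \<open>The bound must be uniform in the first exponent because \<open>act\<close> raises it
  while lowering the second.\<close>

definition truncated :: "(int \<Rightarrow> int \<Rightarrow> 'w) \<Rightarrow> bool" where
  "truncated F \<longleftrightarrow> (\<exists>c0. \<forall>b c. c < c0 \<longrightarrow> F b c = 0)"

lemma finite_act:
  assumes "truncated F"
  shows "finite {s. scale (P $ s) (F (b + int s) (c - int s)) \<noteq> 0}"
proof -
  from assms obtain c0 where c0: "\<forall>b c. c < c0 \<longrightarrow> F b c = 0" by (auto simp: truncated_def)
  have "{s. scale (P $ s) (F (b + int s) (c - int s)) \<noteq> 0} \<subseteq> {..nat (c - c0)}"
  proof clarify
    fix s assume "scale (P $ s) (F (b + int s) (c - int s)) \<noteq> 0"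
    then have "\<not> c - int s < c0" using c0 by auto
    then show "s \<le> nat (c - c0)" by linarith
  qed
  then show ?thesis by (rule finite_subset) simp
qed

lemma act_shift: "act P (\<lambda>b c. F (b + k) (c + l)) b c = act P F (b + k) (c + l)"
  by (simp add: act_def algebra_simps)

lemma act_mult:
  assumes F: "truncated F"
  shows "act (P * Q) F b c = act P (act Q F) b c"
proof -
  obtain c0 where c0: "\<forall>b c. c < c0 \<longrightarrow> F b c = 0" using F by (auto simp: truncated_def)
  define t where "t i j = scale (P $ i * Q $ j) (F (b + int (i + j)) (c - int (i + j)))" for i j
  have "finite {(i, j). t i j \<noteq> 0}"
  proof (rule finite_subset)
    show "{(i, j). t i j \<noteq> 0} \<subseteq> {..nat (c - c0)} \<times> {..nat (c - c0)}"
    proof clarify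
      fix i j assume "t i j \<noteq> 0"
      then have "\<not> c - int (i + j) < c0" using c0 by (auto simp: t_def)
      then show "i \<in> {..nat (c - c0)} \<and> j \<in> {..nat (c - c0)}" by auto
    qed
  qed simp
  note fin = this
  have "act P (act Q F) b c = Sum_any (\<lambda>i. Sum_any (t i))"
    unfolding act_def t_def scale_Sum_any by (simp add: algebra_simps)
  also have "\<dots> = Sum_any (\<lambda>k. \<Sum>i\<le>k. t i (k - i))"
    unfolding Sum_any_iterated[OF fin] by (rule Sum_any_diagonal[OF fin, symmetric])
  also have "\<dots> = act (P * Q) F b c"
  proof -
    have "(\<Sum>i\<le>k. t i (k - i)) = scale ((P * Q) $ k) (F (b + int k) (c - int k))" for k
      unfolding fps_mult_nth scale_sum_left atLeast0AtMost t_def by (rule sum.cong) auto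
    then show ?thesis by (simp add: act_def)
  qed
  finally show ?thesis by simp
qed

lemma act_const_mult: "act (fps_const k * P) F b c = scale k (act P F b c)"
  by (simp add: act_def scale_Sum_any)

lemma act_poly:
  assumes "\<And>r. r > D \<Longrightarrow> coeff p r = 0"
  shows "act (fps_of_poly p) F b c = (\<Sum>r\<le>D. scale (coeff p r) (F (b + int r) (c - int r)))"
  unfolding act_def by (subst Sum_any_eq_sum[of "{..D}"]) (use assms in auto)

lemma act_sum:
  assumes "finite S" "\<And>i. i \<in> S \<Longrightarrow> truncated (F i)"
  shows "act P (\<lambda>b c. \<Sum>i\<in>S. F i b c) b c = (\<Sum>i\<in>S. act P (F i) b c)"
  unfolding act_def scale_sum_right by (rule Sum_any_sum) (use assms finite_act in auto)

lemma truncated_shift: "truncated F \<Longrightarrow> truncated (\<lambda>b c. F (b + k) (c + l))"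
proof -
  assume "truncated F"
  then obtain c0 where c0: "\<forall>b c. c < c0 \<longrightarrow> F b c = 0" by (auto simp: truncated_def)
  then have "F (b + k) (c + l) = 0" if "c < c0 - l" for b c using that by simp
  then show ?thesis unfolding truncated_def by blast
qed

lemma truncated_sum: "finite S \<Longrightarrow> (\<And>i. i \<in> S \<Longrightarrow> truncated (F i)) \<Longrightarrow> truncated (\<lambda>b c. \<Sum>i\<in>S. F i b c)"
proof (induction S rule: finite_induct)
  case (insert x S)
  have "truncated (F x)" "truncated (\<lambda>b c. \<Sum>i\<in>S. F i b c)" using insert by auto
  then obtain c0 c1 where "\<forall>b c. c < c0 \<longrightarrow> F x b c = 0" "\<forall>b c. c < c1 \<longrightarrow> (\<Sum>i\<in>S. F i b c) = 0"
    unfolding truncated_def by blast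
  then have "\<forall>b c. c < min c0 c1 \<longrightarrow> (\<Sum>i\<in>insert x S. F i b c) = 0" using insert by simp
  then show ?case unfolding truncated_def by blast
qed (simp add: truncated_def)

lemma act_one_minus_XN_powi:
  assumes N: "N > 0"
  shows "act (one_minus_XN_powi N n) F b c =
    Sum_any (\<lambda>q. scale ((of_int n gchoose q) * (-1) ^ q) (F (b + int N * int q) (c - int N * int q)))"
  unfolding act_def
proof (subst Sum_any_reindex_inj[where \<iota> = "\<lambda>q. N * q"])
  show "inj (\<lambda>q. N * q)" using N by (simp add: inj_def)
  fix s assume "s \<notin> range (\<lambda>q. N * q)"
  then have "\<not> N dvd s" by (auto simp: dvd_def)
  then show "scale (one_minus_XN_powi N n $ s) (F (b + int s) (c - int s)) = 0" by (simp add: one_minus_XN_powi_nth[OF N])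
qed (simp add: one_minus_XN_powi_nth[OF N] N)

text \<open>The exponent of x0 selects the single power n = - \<alpha> - 1 of x1 - x2. In terms of
  N-th roots of the variables this is (x1^N - x2^N)^n, whose factor x1^(N n) shifts
  \<open>\<beta>\<close>.\<close>

lemma formal_prod_ramified_12:
  assumes N: "N > 0" and n: "n = - \<alpha> - 1"
  shows "formal_prod scale (ramify N delta_12_0) (\<lambda>(a, b, c). if a = 0 then g b c else 0) (\<alpha>, \<beta>, \<gamma>)
    = act (one_minus_XN_powi N n) g (\<beta> - int N * n) \<gamma>"
  unfolding act_one_minus_XN_powi[OF N] formal_prod_def
proof (subst Sum_any_reindex_inj[where \<iota> = "\<lambda>q::nat. (\<alpha>, int N * (n - int q), int N * int q)"])
  show "inj (\<lambda>q::nat. (\<alpha>, int N * (n - int q), int N * int q))" using N by (simp add: inj_def)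
  fix d :: "int \<times> int \<times> int" assume d: "d \<notin> range (\<lambda>q::nat. (\<alpha>, int N * (n - int q), int N * int q))"
  obtain x y z where xyz: "d = (x, y, z)" by (cases d)
  show "scale (ramify N delta_12_0 d) (case (\<alpha>, \<beta>, \<gamma>) - d of (a, b, c) \<Rightarrow> if a = 0 then g b c else 0) = 0"
  proof (rule ccontr)
    assume nz: "\<not> ?thesis"
    then have "x = \<alpha>" "int N dvd y" "int N dvd z" "z div int N \<ge> 0" "y div int N + z div int N = n"
      by (auto simp: xyz ramify_def delta_12_0_def binom_series_def n split: if_splits)
    then have "d = (\<alpha>, int N * (n - int (nat (z div int N))), int N * int (nat (z div int N)))"
      using xyz by (auto simp: dvd_def)
    then show False using d by blast
  qed
next
  have "ramify N delta_12_0 (\<alpha>, int N * (n - int q), int N * int q) = (of_int n gchoose q) * (-1) ^ q" for q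
    using N by (simp add: ramify_def delta_12_0_def binom_series_def n)
  moreover have "\<beta> - int N * (n - int q) = \<beta> - int N * n + int N * int q" for q
    by (simp add: algebra_simps)
  ultimately show "Sum_any (\<lambda>q. scale (ramify N delta_12_0 (\<alpha>, int N * (n - int q), int N * int q))
      (case (\<alpha>, \<beta>, \<gamma>) - (\<alpha>, int N * (n - int q), int N * int q) of (a, b, c) \<Rightarrow> if a = 0 then g b c else 0))
    = Sum_any (\<lambda>q. scale ((of_int n gchoose q) * (-1) ^ q) (g (\<beta> - int N * n + int N * int q) (\<gamma> - int N * int q)))"
    by (simp only: diff_Pair prod.case) simp
qed

lemma formal_prod_ramified_21:
  assumes N: "N > 0" and n: "n = - \<alpha> - 1"
  shows "formal_prod scale (ramify N delta_21_0) (\<lambda>(a, b, c). if a = 0 then g c b else 0) (\<alpha>, \<beta>, \<gamma>)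
    = scale ((-1) powi n) (act (one_minus_XN_powi N n) g (\<gamma> - int N * n) \<beta>)"
  unfolding act_one_minus_XN_powi[OF N] formal_prod_def scale_Sum_any
proof (subst Sum_any_reindex_inj[where \<iota> = "\<lambda>q::nat. (\<alpha>, int N * int q, int N * (n - int q))"])
  show "inj (\<lambda>q::nat. (\<alpha>, int N * int q, int N * (n - int q)))" using N by (simp add: inj_def)
  fix d :: "int \<times> int \<times> int" assume d: "d \<notin> range (\<lambda>q::nat. (\<alpha>, int N * int q, int N * (n - int q)))"
  obtain x y z where xyz: "d = (x, y, z)" by (cases d)
  show "scale (ramify N delta_21_0 d) (case (\<alpha>, \<beta>, \<gamma>) - d of (a, b, c) \<Rightarrow> if a = 0 then g c b else 0) = 0"
  proof (rule ccontr)
    assume nz: "\<not> ?thesis"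
    then have "x = \<alpha>" "int N dvd y" "int N dvd z" "y div int N \<ge> 0" "z div int N + y div int N = n"
      by (auto simp: xyz ramify_def delta_21_0_def binom_series_def n split: if_splits)
    then have "d = (\<alpha>, int N * int (nat (y div int N)), int N * (n - int (nat (y div int N))))"
      using xyz by (auto simp: dvd_def)
    then show False using d by blast
  qed
next
  have "ramify N delta_21_0 (\<alpha>, int N * int q, int N * (n - int q)) = (-1) powi n * ((of_int n gchoose q) * (-1) ^ q)" for q
    using N by (simp add: ramify_def delta_21_0_def binom_series_def n)
  moreover have "\<gamma> - int N * (n - int q) = \<gamma> - int N * n + int N * int q" for q
    by (simp add: algebra_simps)
  ultimately show "Sum_any (\<lambda>q. scale (ramify N delta_21_0 (\<alpha>, int N * int q, int N * (n - int q)))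
      (case (\<alpha>, \<beta>, \<gamma>) - (\<alpha>, int N * int q, int N * (n - int q)) of (a, b, c) \<Rightarrow> if a = 0 then g c b else 0))
    = Sum_any (\<lambda>q. scale ((-1) powi n) (scale ((of_int n gchoose q) * (-1) ^ q) (g (\<gamma> - int N * n + int N * int q) (\<beta> - int N * int q))))"
    by (simp only: diff_Pair prod.case scale_scale) simp
qed

lemma ramify_1: "ramify 1 f = f"
  by (auto simp: ramify_def fun_eq_iff)

lemmas formal_prod_12 = formal_prod_ramified_12[of 1, unfolded ramify_1 one_minus_XN_powi_1, simplified]
lemmas formal_prod_21 = formal_prod_ramified_21[of 1, unfolded ramify_1 one_minus_XN_powi_1, simplified]

definition difference_power :: "nat \<Rightarrow> nat \<Rightarrow> complex poly poly" where
  "difference_power N k = (poly_x1 ^ N - poly_x2 ^ N) ^ k"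

lemma coeff_difference_power: "coeff (coeff (difference_power N k) c) b =
  (\<Sum>r\<le>k. if c = N * r \<and> b = N * (k - r) then (-1) ^ r * of_nat (k choose r) else 0)"
proof -
  have x1: "poly_x1 ^ i = monom (monom 1 i) 0" for i
    by (induction i) (simp_all add: poly_x1_def monom_0 monom_Suc one_pCons)
  have x2: "poly_x2 ^ i = monom 1 i" for i
    by (simp add: poly_x2_def monom_altdef)
  have x2': "(- (poly_x2 ^ N)) ^ r = monom ((-1) ^ r) (N * r)" for r
    by (simp add: x2 minus_monom monom_power)
  have "difference_power N k = (- (poly_x2 ^ N) + poly_x1 ^ N) ^ k" by (simp add: difference_power_def)
  also have "\<dots> = (\<Sum>r\<le>k. of_nat (k choose r) * (- (poly_x2 ^ N)) ^ r * (poly_x1 ^ N) ^ (k - r))"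
    by (rule binomial_ring)
  also have "\<dots> = (\<Sum>r\<le>k. monom (monom ((-1) ^ r * of_nat (k choose r)) (N * (k - r))) (N * r))"
  proof (rule sum.cong)
    fix r
    have c: "of_nat (k choose r) = monom (monom (of_nat (k choose r) :: complex) 0) 0"
      by (simp add: of_nat_poly monom_0)
    have s: "(-1 :: complex poly) ^ r = monom ((-1) ^ r) 0"
      by (induction r) (simp_all add: monom_0 one_pCons)
    show "of_nat (k choose r) * (- (poly_x2 ^ N)) ^ r * (poly_x1 ^ N) ^ (k - r) =
        monom (monom ((-1) ^ r * of_nat (k choose r)) (N * (k - r))) (N * r)"
      by (simp add: c x2' x1 s mult_monom monom_power mult.commute flip: power_mult)
  qed simp
  finally show ?thesis
    by (simp add: coeff_sum if_distrib[of "\<lambda>p. coeff p _"] conj_commute cong: if_cong)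
       (intro sum.cong, auto)
qed

lemma formal_prod_poly:
  assumes N: "N > 0"
  shows "formal_prod scale (poly_series (difference_power N k)) G (a, b, c) =
    (\<Sum>r\<le>k. scale ((-1) ^ r * of_nat (k choose r)) (G (a, b - int N * int (k - r), c - int N * int r)))"
proof -
  define \<iota> where "\<iota> r = (0 :: int, int N * int (k - r), int N * int r)" for r
  have inj: "inj_on \<iota> {..k}" using N by (auto simp: inj_on_def \<iota>_def)
  have coef: "poly_series (difference_power N k) (\<iota> r) = (-1) ^ r * of_nat (k choose r)" if "r \<le> k" for r
  proof -
    have "(\<Sum>r'\<le>k. if N * r = N * r' \<and> N * (k - r) = N * (k - r') then (-1) ^ r' * of_nat (k choose r') else 0 :: complex)
        = (\<Sum>r'\<le>k. if r' = r then (-1) ^ r * of_nat (k choose r) else 0)"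
      using N by (intro sum.cong) auto
    moreover have "nat (int N * int j) = N * j" for j
      by (simp flip: of_nat_mult)
    then have "poly_series (difference_power N k) (\<iota> r) =
        (\<Sum>r'\<le>k. if N * r = N * r' \<and> N * (k - r) = N * (k - r') then (-1) ^ r' * of_nat (k choose r') else 0)"
      unfolding poly_series_def \<iota>_def coeff_difference_power by simp
    ultimately show ?thesis using that by simp
  qed
  have outside: "poly_series (difference_power N k) d = 0" if "d \<notin> \<iota> ` {..k}" for d
  proof (cases d)
    case (fields x y z)
    have "(if nat z = N * r \<and> nat y = N * (k - r) then (-1) ^ r * of_nat (k choose r) else 0 :: complex) = 0"
      if "x = 0" "y \<ge> 0" "z \<ge> 0" "r \<le> k" for r
    proof (rule ccontr)
      assume "\<not> ?thesis"
      then have "nat z = N * r" "nat y = N * (k - r)" by (auto split: if_splits)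
      then have "z = int (N * r)" "y = int (N * (k - r))" using that by linarith+
      then have "d = \<iota> r" using fields that by (simp add: \<iota>_def)
      then show False using \<open>d \<notin> \<iota> ` {..k}\<close> that by blast
    qed
    then show ?thesis unfolding fields by (auto simp: poly_series_def coeff_difference_power intro!: sum.neutral)
  qed
  have "formal_prod scale (poly_series (difference_power N k)) G (a, b, c) =
      (\<Sum>d\<in>\<iota> ` {..k}. scale (poly_series (difference_power N k) d) (G ((a, b, c) - d)))"
    unfolding formal_prod_def by (rule Sum_any_eq_sum) (simp_all add: outside)
  also have "\<dots> = (\<Sum>r\<le>k. scale (poly_series (difference_power N k) (\<iota> r)) (G ((a, b, c) - \<iota> r)))"
    by (simp add: sum.reindex[OF inj])
  also have "\<dots> = (\<Sum>r\<le>k. scale ((-1) ^ r * of_nat (k choose r)) (G (a, b - int N * int (k - r), c - int N * int r)))"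
    by (rule sum.cong) (auto simp: coef, simp add: \<iota>_def)
  finally show ?thesis .
qed

lemma act_one_minus_XN_powi_nat:
  assumes N: "N > 0"
  shows "act (one_minus_XN_powi N (int k)) F b c =
    (\<Sum>r\<le>k. scale ((-1) ^ r * of_nat (k choose r)) (F (b + int N * int r) (c - int N * int r)))"
  unfolding act_one_minus_XN_powi[OF N]
  by (subst Sum_any_eq_sum[of "{..k}"]) (auto simp: binomial_eq_0 mult.commute simp flip: binomial_gbinomial)

lemma formal_prod_poly_12:
  assumes N: "N > 0"
  shows "formal_prod scale (poly_series (difference_power N k)) (\<lambda>(a, b, c). if a = 0 then g b c else 0) =
    (\<lambda>(a, b, c). if a = 0 then act (one_minus_XN_powi N (int k)) g (b - int N * int k) c else 0)"
proof (intro ext, clarify)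
  fix a b c
  have "b - int N * int (k - r) = b - int N * int k + int N * int r" if "r \<le> k" for r
    using that by (simp add: of_nat_diff algebra_simps)
  then have "(\<Sum>r\<le>k. scale ((-1) ^ r * of_nat (k choose r)) (g (b - int N * int (k - r)) (c - int N * int r)))
      = (\<Sum>r\<le>k. scale ((-1) ^ r * of_nat (k choose r)) (g (b - int N * int k + int N * int r) (c - int N * int r)))"
    by (intro sum.cong refl) (simp only: atMost_iff)
  then show "formal_prod scale (poly_series (difference_power N k)) (\<lambda>(a, b, c). if a = 0 then g b c else 0) (a, b, c) =
    (if a = 0 then act (one_minus_XN_powi N (int k)) g (b - int N * int k) c else 0)"
    unfolding formal_prod_poly[OF N] act_one_minus_XN_powi_nat[OF N] prod.case by (cases "a = 0") (simp_all only: simp_thms if_True if_False scale_zero_right sum.neutral_const)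
qed

text \<open>Here x2^(N k) is extracted from the polynomial instead of x1^(N k), whence the sign
  (-1)^k and the reversed summation.\<close>

lemma formal_prod_poly_21:
  assumes N: "N > 0"
  shows "formal_prod scale (poly_series (difference_power N k)) (\<lambda>(a, b, c). if a = 0 then g c b else 0) =
    (\<lambda>(a, b, c). if a = 0 then scale ((-1) ^ k) (act (one_minus_XN_powi N (int k)) g (c - int N * int k) b) else 0)"
proof (intro ext, clarify)
  fix a b c
  have "(\<Sum>r\<le>k. scale ((-1) ^ r * of_nat (k choose r)) (g (c - int N * int r) (b - int N * int (k - r)))) =
      (\<Sum>r\<le>k. scale ((-1) ^ (k - r) * of_nat (k choose (k - r))) (g (c - int N * int (k - r)) (b - int N * int (k - (k - r)))))"
    by (rule sum.reindex_bij_witness[of _ "\<lambda>r. k - r" "\<lambda>r. k - r"]) auto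
  also have "\<dots> = (\<Sum>r\<le>k. scale ((-1) ^ k) (scale ((-1) ^ r * of_nat (k choose r)) (g (c - int N * int k + int N * int r) (b - int N * int r))))"
  proof (rule sum.cong)
    fix r assume "r \<in> {..k}"
    then have r: "r \<le> k" by simp
    have "(-1 :: complex) ^ k = (-1) ^ (k - r) * (-1) ^ r" using r by (simp flip: power_add)
    moreover have "(-1) ^ r * (-1) ^ r = (1 :: complex)" by (simp flip: power_mult_distrib)
    ultimately have "(-1) ^ (k - r) = ((-1) ^ k * (-1) ^ r :: complex)" by (simp only: mult.assoc mult_1_right)
    moreover have "c - int N * int (k - r) = c - int N * int k + int N * int r"
      using r by (simp add: of_nat_diff algebra_simps)
    ultimately show "scale ((-1) ^ (k - r) * of_nat (k choose (k - r))) (g (c - int N * int (k - r)) (b - int N * int (k - (k - r)))) =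
      scale ((-1) ^ k) (scale ((-1) ^ r * of_nat (k choose r)) (g (c - int N * int k + int N * int r) (b - int N * int r)))"
      by (simp only: scale_scale mult.assoc diff_diff_cancel[OF r] binomial_symmetric[OF r, symmetric])
  qed simp
  finally show "formal_prod scale (poly_series (difference_power N k)) (\<lambda>(a, b, c). if a = 0 then g c b else 0) (a, b, c) =
    (if a = 0 then scale ((-1) ^ k) (act (one_minus_XN_powi N (int k)) g (c - int N * int k) b) else 0)"
    unfolding formal_prod_poly[OF N] act_one_minus_XN_powi_nat[OF N] scale_sum_right prod.case
    by (cases "a = 0") (simp_all only: simp_thms if_True if_False scale_zero_right sum.neutral_const)
qed

text \<open>Each summand is a coefficient of (1 + x)^(-1 - \<beta> + N (k - r)), and the sum over r
  is the binomial expansion of ((1 + x)^N - 1)^k.\<close>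

lemma kappa_expand:
  assumes N: "N > 0"
  shows "(\<Sum>r\<le>k. (-1) ^ r * of_nat (k choose r) * ((-1) ^ a * (of_int (int a + (\<beta> - int N * int (k - r))) gchoose a)))
    = kappa N (- 1 - \<beta>) (int k) (int a)"
proof -
  have "(-1) ^ a * (of_int (int a + x) gchoose a) = (one_plus_X powi (- x - 1)) $$ int a" for x
    using gbinomial_negated_upper[of "of_int (- x - 1) :: complex" a]
    by (simp add: one_plus_X_powi algebra_simps)
  then have "(\<Sum>r\<le>k. (-1) ^ r * of_nat (k choose r) * ((-1) ^ a * (of_int (int a + (\<beta> - int N * int (k - r))) gchoose a)))
      = (\<Sum>r\<le>k. fls_const ((-1) ^ r * of_nat (k choose r)) * one_plus_X powi (- (\<beta> - int N * int (k - r)) - 1)) $$ int a"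
    by (simp only: fls_nth_sum fls_mult_const_nth)
  also have "(\<Sum>r\<le>k. fls_const ((-1) ^ r * of_nat (k choose r)) * one_plus_X powi (- (\<beta> - int N * int (k - r)) - 1))
      = one_plus_X powi (- 1 - \<beta>) * (\<Sum>r\<le>k. of_nat (k choose r) * (-1) ^ r * (one_plus_X ^ N) ^ (k - r))"
    unfolding sum_distrib_left
  proof (rule sum.cong)
    fix r
    have "- (\<beta> - int N * int (k - r)) - 1 = (- 1 - \<beta>) + int (N * (k - r))" by simp
    then have "one_plus_X powi (- (\<beta> - int N * int (k - r)) - 1) = one_plus_X powi (- 1 - \<beta>) * (one_plus_X ^ N) ^ (k - r)"
      by (simp only: power_int_add[OF disjI1[OF one_plus_X_nonzero]] power_int_of_nat power_mult)
    moreover have "fls_const ((-1) ^ r * of_nat (k choose r) :: complex) = of_nat (k choose r) * (-1) ^ r"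
      by (simp add: fls_of_nat fls_const_power fls_const_uminus mult.commute flip: fls_const_mult_const)
    ultimately show "fls_const ((-1) ^ r * of_nat (k choose r)) * one_plus_X powi (- (\<beta> - int N * int (k - r)) - 1) =
        one_plus_X powi (- 1 - \<beta>) * (of_nat (k choose r) * (-1) ^ r * (one_plus_X ^ N) ^ (k - r))"
      by (simp only: mult_ac)
  qed simp
  also have "(\<Sum>r\<le>k. of_nat (k choose r) * (-1) ^ r * (one_plus_X ^ N) ^ (k - r)) = power_minus_1 N ^ k"
    using binomial_ring[of "-1" "one_plus_X ^ N" k] by (simp add: power_minus_1_def)
  finally show ?thesis by (simp add: kappa_def)
qed

text \<open>The delta function puts x1 = x2 + x0. The polynomial becomes ((x2 + x0)^N - x2^N)^k, and
  extracting x1^\<beta> leaves (x2 + x0)^(-1 - \<beta>); \<open>kappa\<close> expands their product.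
  Truncation of h makes the sum over a finite for each r.\<close>

lemma formal_prod_10_2:
  assumes N: "N > 0" and trunc: "\<exists>a0. \<forall>a<a0. \<forall>c. h a c = 0"
  shows "formal_prod scale delta_10_2 (formal_prod scale (poly_series (difference_power N k)) (\<lambda>(a, b, c). if b = 0 then h a c else 0)) (\<alpha>, \<beta>, \<gamma>)
    = Sum_any (\<lambda>a::nat. scale (kappa N (- 1 - \<beta>) (int k) (int a)) (h (\<alpha> - int a) (\<gamma> + 1 + int a + \<beta> - int N * int k)))"
proof -
  define H where "H r = (\<lambda>(a, b, c). scale ((-1) ^ r * of_nat (k choose r)) (if b = int N * int (k - r) then h a (c - int N * int r) else 0))" for r
  have inner: "formal_prod scale (poly_series (difference_power N k)) (\<lambda>(a, b, c). if b = 0 then h a c else 0) = (\<lambda>e. \<Sum>r\<le>k. H r e)"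
    by (intro ext, clarify) (simp add: formal_prod_poly[OF N] H_def cong: if_cong)
  define b where "b r = \<beta> - int N * int (k - r)" for r
  define \<iota> where "\<iota> r a = (int a, b r, - 1 - int a - b r)" for r a
  define R where "R r a = scale ((-1) ^ r * of_nat (k choose r) * ((-1) ^ a * (of_int (int a + b r) gchoose a)))
      (h (\<alpha> - int a) (\<gamma> + 1 + int a + \<beta> - int N * int k))" for r a
  have inj: "inj (\<iota> r)" for r by (simp add: inj_def \<iota>_def)
  have outside: "scale (delta_10_2 d) (H r ((\<alpha>, \<beta>, \<gamma>) - d)) = 0" if "d \<notin> range (\<iota> r)" for d r
  proof (rule ccontr)
    assume nz: "\<not> ?thesis"
    obtain x y z where d: "d = (x, y, z)" by (cases d)
    have "y = b r" "x \<ge> 0" "z = - 1 - x - b r"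
      using nz by (auto simp: d delta_10_2_def H_def b_def binom_series_def split: if_splits)
    then have "d = \<iota> r (nat x)" by (simp add: d \<iota>_def)
    then show False using that by blast
  qed
  have summand: "scale (delta_10_2 (\<iota> r a)) (H r ((\<alpha>, \<beta>, \<gamma>) - \<iota> r a)) = R r a" if "r \<le> k" for r a
  proof -
    have "- (- 1 - int a - b r) - 1 = int a + b r" by simp
    then have 1: "delta_10_2 (\<iota> r a) = (-1) ^ a * (of_int (int a + b r) gchoose a)"
      by (simp add: delta_10_2_def \<iota>_def binom_series_def mult.commute add.commute)
    have "\<gamma> - (- 1 - int a - b r) - int N * int r = \<gamma> + 1 + int a + \<beta> - int N * int k"
      using that by (simp add: b_def of_nat_diff algebra_simps)
    moreover have "\<beta> - b r = int N * int (k - r)" by (simp add: b_def)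
    ultimately have 2: "H r ((\<alpha>, \<beta>, \<gamma>) - \<iota> r a) = scale ((-1) ^ r * of_nat (k choose r)) (h (\<alpha> - int a) (\<gamma> + 1 + int a + \<beta> - int N * int k))"
      by (simp only: H_def \<iota>_def diff_Pair prod.case) simp
    show ?thesis unfolding 1 2 by (simp add: R_def mult.commute)
  qed
  obtain a0 where a0: "\<forall>a<a0. \<forall>c. h a c = 0" using trunc by blast
  have finR: "finite {a. R r a \<noteq> 0}" for r
  proof (rule finite_subset)
    show "{a. R r a \<noteq> 0} \<subseteq> {..nat (\<alpha> - a0)}"
    proof clarify
      fix a assume "R r a \<noteq> 0"
      then have "\<not> \<alpha> - int a < a0" using a0 by (auto simp: R_def)
      then show "a \<le> nat (\<alpha> - a0)" by linarith
    qed
  qed simp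
  have finH: "finite {d. scale (delta_10_2 d) (H r ((\<alpha>, \<beta>, \<gamma>) - d)) \<noteq> 0}" if "r \<le> k" for r
  proof (rule finite_subset)
    show "{d. scale (delta_10_2 d) (H r ((\<alpha>, \<beta>, \<gamma>) - d)) \<noteq> 0} \<subseteq> \<iota> r ` {a. R r a \<noteq> 0}"
    proof clarify
      fix x y z assume nz: "scale (delta_10_2 (x, y, z)) (H r ((\<alpha>, \<beta>, \<gamma>) - (x, y, z))) \<noteq> 0"
      then obtain a where a: "(x, y, z) = \<iota> r a" using outside by blast
      then show "(x, y, z) \<in> \<iota> r ` {a. R r a \<noteq> 0}" using nz summand[OF that, of a] by auto
    qed
  qed (use finR in blast)
  have "formal_prod scale delta_10_2 (\<lambda>e. \<Sum>r\<le>k. H r e) (\<alpha>, \<beta>, \<gamma>)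
      = (\<Sum>r\<le>k. Sum_any (\<lambda>d. scale (delta_10_2 d) (H r ((\<alpha>, \<beta>, \<gamma>) - d))))"
    unfolding formal_prod_def scale_sum_right by (rule Sum_any_sum) (use finH in auto)
  also have "\<dots> = (\<Sum>r\<le>k. Sum_any (\<lambda>a. R r a))"
    by (rule sum.cong) (simp_all add: Sum_any_reindex_inj[OF inj outside] summand)
  also have "\<dots> = Sum_any (\<lambda>a. \<Sum>r\<le>k. R r a)"
    by (rule Sum_any_sum[symmetric]) (use finR in auto)
  also have "\<dots> = Sum_any (\<lambda>a::nat. scale (kappa N (- 1 - \<beta>) (int k) (int a)) (h (\<alpha> - int a) (\<gamma> + 1 + int a + \<beta> - int N * int k)))"
    unfolding R_def b_def scale_sum_left[symmetric] kappa_expand[OF N] ..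
  finally show ?thesis unfolding inner .
qed

end

lemma root_of_unity_power:
  assumes N: "N > 0"
  shows "root_of_unity N ^ N = 1" "root_of_unity N \<noteq> 0"
    and "inj_on (\<lambda>t. root_of_unity N ^ t) {..<N}"
proof -
  have cis: "root_of_unity N ^ t = cis (2 * pi * real t / real N)" for t
  proof -
    have "root_of_unity N = cis (2 * pi / real N)"
      by (simp add: root_of_unity_def cis_conv_exp mult.commute)
    then show ?thesis by (simp add: DeMoivre mult_ac)
  qed
  show "root_of_unity N ^ N = 1" using N by (simp add: cis)
  show "root_of_unity N \<noteq> 0" by (simp add: root_of_unity_def)
  show "inj_on (\<lambda>t. root_of_unity N ^ t) {..<N}"
    unfolding cis using bij_betw_roots_unity[OF N] by (rule bij_betw_imp_inj_on)
qed

lemma root_of_unity_power_eq_1: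
  assumes N: "N > 0" and "t < N"
  shows "root_of_unity N ^ t = 1 \<longleftrightarrow> t = 0"
  using inj_onD[OF root_of_unity_power(3)[OF N], of t 0] assms by auto

context complex_vector_space begin

text \<open>Turns the first term of a quasi Jacobi identity for the power n into first terms of
  twisted Jacobi identities for the power n'. The polynomial, reversed by the expansion in x2/x1, is
  restored by reindexing r to D - r.\<close>

lemma act_quot_poly:
  fixes n :: int and k :: nat
  assumes N: "N > 0" and F: "truncated F"
  defines "n' \<equiv> int k - int (nat (- n))" and "D \<equiv> degree (quot_poly N n)"
  shows "act (one_minus_X_powi n) (act (one_minus_XN_powi N (int k)) F) (b - n - int N * int k) c =
    (\<Sum>r\<le>D. scale (coeff (quot_poly N n) r) (act (one_minus_XN_powi N n') F (b - int r - int N * n') (c - int D + int r)))"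
proof -
  have D: "int D = n + int N * int k - int N * n'"
    using degree_quot_poly[OF N, of n] by (simp add: D_def n'_def algebra_simps)
  have "act (one_minus_X_powi n) (act (one_minus_XN_powi N (int k)) F) (b - n - int N * int k) c =
      act (fps_of_poly (reflect_poly (quot_poly N n)) * one_minus_XN_powi N n') F (b - n - int N * int k) c"
    by (simp only: act_mult[OF F, symmetric] one_minus_XN_powi_of_nat[OF N] one_minus_X_powi_quot_poly[OF N] n'_def mult.commute)
  also have "\<dots> = (\<Sum>r\<le>D. scale (coeff (reflect_poly (quot_poly N n)) r)
      (act (one_minus_XN_powi N n') F (b - n - int N * int k + int r) (c - int r)))"
    unfolding act_mult[OF F] by (rule act_poly) (simp add: coeff_reflect_poly D_def)
  also have "\<dots> = (\<Sum>r\<le>D. scale (coeff (quot_poly N n) r) (act (one_minus_XN_powi N n') F (b - int r - int N * n') (c - int D + int r)))"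
  proof (rule sum.reindex_bij_witness[of _ "\<lambda>r. D - r" "\<lambda>r. D - r"])
    fix r assume "r \<in> {..D}"
    then have r: "r \<le> D" by simp
    have "coeff (reflect_poly (quot_poly N n)) r = coeff (quot_poly N n) (D - r)"
      using r by (simp add: coeff_reflect_poly D_def)
    moreover have "b - n - int N * int k + int r = b - int (D - r) - int N * n'" "c - int r = c - int D + int (D - r)"
      using r D by (auto simp: of_nat_diff)
    ultimately show "scale (coeff (quot_poly N n) (D - r)) (act (one_minus_XN_powi N n') F (b - int (D - r) - int N * n') (c - int D + int (D - r))) =
        scale (coeff (reflect_poly (quot_poly N n)) r) (act (one_minus_XN_powi N n') F (b - n - int N * int k + int r) (c - int r))"
      by (simp only:)
  qed auto
  finally show ?thesis .
qed

text \<open>The second term, expanded in x1/x2. Coefficients and exponents agree with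
  \<open>act_quot_poly\<close>, so the two can be subtracted summand by summand.\<close>

lemma act_quot_poly':
  fixes n :: int and k :: nat
  assumes N: "N > 0" and F: "truncated F"
  defines "n' \<equiv> int k - int (nat (- n))" and "D \<equiv> degree (quot_poly N n)"
  shows "scale ((-1) powi n * (-1) ^ k) (act (one_minus_X_powi n) (act (one_minus_XN_powi N (int k)) F) (c - n - int N * int k) b) =
    (\<Sum>r\<le>D. scale (coeff (quot_poly N n) r) (scale ((-1) powi n') (act (one_minus_XN_powi N n') F (c - int D + int r - int N * n') (b - int r))))"
proof -
  have D: "int D = n + int N * int k - int N * n'"
    using degree_quot_poly[OF N, of n] by (simp add: D_def n'_def algebra_simps)
  have "scale ((-1) powi n * (-1) ^ k) (act (one_minus_X_powi n) (act (one_minus_XN_powi N (int k)) F) (c - n - int N * int k) b) =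
      act (fps_const ((-1) powi n') * (fps_of_poly (quot_poly N n) * one_minus_XN_powi N n')) F (c - n - int N * int k) b"
    by (simp only: act_mult[OF F, symmetric] act_const_mult[symmetric] one_minus_XN_powi_of_nat[OF N] one_minus_X_powi_quot_poly'[OF N] n'_def
        mult.commute[of "fps_of_poly _"])
  also have "\<dots> = scale ((-1) powi n') (\<Sum>r\<le>D. scale (coeff (quot_poly N n) r)
      (act (one_minus_XN_powi N n') F (c - n - int N * int k + int r) (b - int r)))"
    unfolding act_const_mult unfolding act_mult[OF F] by (subst act_poly[of D]) (simp_all add: coeff_eq_0 D_def)
  also have "\<dots> = (\<Sum>r\<le>D. scale (coeff (quot_poly N n) r) (scale ((-1) powi n') (act (one_minus_XN_powi N n') F (c - int D + int r - int N * n') (b - int r))))"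
  proof -
    have "c - n - int N * int k + int r = c - int D + int r - int N * n'" for r using D by simp
    then show ?thesis by (simp only: scale_sum_right scale_left_commute)
  qed
  finally show ?thesis .
qed

end

section \<open>From the twisted to the quasi Jacobi identity\<close>

locale voa_twisted = voa_change_module scale grade Y vac conf N a sW YW
  for scale :: "complex \<Rightarrow> 'v::ab_group_add \<Rightarrow> 'v" and grade Y vac conf N a
    and sW :: "complex \<Rightarrow> 'w::ab_group_add \<Rightarrow> 'w" and YW +
  fixes \<sigma> :: "'v \<Rightarrow> 'v"
  assumes twisted: "twisted_jacobi N sW Y \<sigma> YW u v"
    and vacuum_W: "YW vac n w = (if n = 0 then w else 0)"
begin

sublocale C: complex_vector_space sW ..

definition prod2 :: "('v \<Rightarrow> int \<Rightarrow> 'w \<Rightarrow> 'w) \<Rightarrow> 'v \<Rightarrow> 'v \<Rightarrow> 'w \<Rightarrow> int \<Rightarrow> int \<Rightarrow> 'w" where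
  "prod2 y u v w b c = y u b (y v c w)"

lemma vprod_12_eq: "vprod_12 y u v w = (\<lambda>(a, b, c). if a = 0 then prod2 y u v w b c else 0)"
  and vprod_21_eq: "vprod_21 y u v w = (\<lambda>(a, b, c). if a = 0 then prod2 y v u w c b else 0)"
  by (auto simp: fun_eq_iff vprod_12_def vprod_21_def prod2_def)

lemma truncated_prod2: "vertex_map scale sW y \<Longrightarrow> C.truncated (prod2 y u v w)"
proof -
  assume "vertex_map scale sW y"
  then interpret y: vertex_map_space scale sW y by unfold_locales
  obtain m where "\<forall>n<m. y v n w = 0" using y.Y_truncated by blast
  then have "\<forall>b c. c < m \<longrightarrow> prod2 y u v w b c = 0" by (simp add: prod2_def)
  then show ?thesis unfolding C.truncated_def by blast
qed

text \<open>By \<open>residue_binomial_power\<close> the fractional binomials of the delta function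
  are residues of (1 + x)^(-b - 1) ((1 + x)^N - 1)^(n + d). They vanish unless n + d < 0, so d may
  run over all integers, and polynomials in x1 can be applied under the residue.\<close>

lemma formal_prod_twisted:
  "sW (1 / of_nat N) (formal_prod sW (delta_twisted N t) (viter Y YW x y w) (- n - 1, b, c)) =
    Sum_any (\<lambda>d. sW (root_of_unity N powi (int t * (- b - int N)) * kappa N (- b - 1) (n + d) (-1))
      (YW (Y x d y) (c + b - int N * n - int N * d) w))"
proof -
  define m where "m = - b - int N"
  define \<iota> where "\<iota> i = (int i, b, m - int N * int i)" for i
  define R where "R d = sW (root_of_unity N powi (int t * m) * kappa N (- b - 1) (n + d) (-1))
      (YW (Y x d y) (c + b - int N * n - int N * d) w)" for d
  have outside: "sW (delta_twisted N t e) (viter Y YW x y w ((- n - 1, b, c) - e)) = 0" if "e \<notin> range \<iota>" for e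
  proof (rule ccontr)
    assume nz: "\<not> ?thesis"
    obtain p q r where e: "e = (p, q, r)" by (cases e)
    have "q = b" "p \<ge> 0" "r = - q - int N - int N * p"
      using nz by (auto simp: e delta_twisted_def viter_def Let_def split: if_splits)
    then have "e = \<iota> (nat p)" by (simp add: e \<iota>_def m_def)
    then show False using that by blast
  qed
  have term_eq: "sW (1 / of_nat N) (sW (delta_twisted N t (\<iota> i)) (viter Y YW x y w ((- n - 1, b, c) - \<iota> i))) = R (- n - 1 - int i)" for i
  proof -
    have 1: "delta_twisted N t (\<iota> i) = root_of_unity N powi (int t * m) * ((of_int m / of_nat N) gchoose i)"
      by (simp add: delta_twisted_def \<iota>_def m_def Let_def)
    have "c - (m - int N * int i) = c + b - int N * n - int N * (- n - 1 - int i)"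
      by (simp add: m_def algebra_simps)
    then have 2: "viter Y YW x y w ((- n - 1, b, c) - \<iota> i) = YW (Y x (- n - 1 - int i) y) (c + b - int N * n - int N * (- n - 1 - int i)) w"
      by (simp only: viter_def \<iota>_def diff_Pair prod.case) simp
    have 3: "kappa N (- b - 1) (n + (- n - 1 - int i)) (-1) = ((of_int m / of_nat N) gchoose i) / of_nat N"
      unfolding residue_binomial_power[OF N] by (simp add: m_def)
    show ?thesis unfolding 1 2 R_def 3 by (simp add: mult.commute)
  qed
  have "sW (1 / of_nat N) (formal_prod sW (delta_twisted N t) (viter Y YW x y w) (- n - 1, b, c)) =
      Sum_any (\<lambda>i. sW (1 / of_nat N) (sW (delta_twisted N t (\<iota> i)) (viter Y YW x y w ((- n - 1, b, c) - \<iota> i))))"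
    unfolding formal_prod_def W.W.scale_Sum_any[symmetric]
    by (subst Sum_any_reindex_inj[of \<iota>, OF _ outside]) (simp_all add: inj_def \<iota>_def)
  also have "\<dots> = Sum_any (\<lambda>i::nat. R (- n - 1 - int i))" by (simp only: term_eq)
  also have "\<dots> = Sum_any R"
  proof (rule Sum_any_reindex_inj[symmetric])
    fix d assume "d \<notin> range (\<lambda>i::nat. - n - 1 - int i)"
    moreover have "d \<in> range (\<lambda>i::nat. - n - 1 - int i)" if "d \<le> - n - 1"
      using that by (intro image_eqI[of _ _ "nat (- n - 1 - d)"]) auto
    ultimately have "\<not> n + d < 0" by linarith
    then show "R d = 0" unfolding R_def residue_binomial_power[OF N] by simp
  qed (simp add: inj_def)
  finally show ?thesis unfolding R_def m_def .
qed

lemma twisted_jacobi_act: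
  "C.act (one_minus_XN_powi N n) (prod2 YW x y w) (b - int N * n) c
    - sW ((-1) powi n) (C.act (one_minus_XN_powi N n) (prod2 YW y x w) (c - int N * n) b)
  = (\<Sum>t<N. Sum_any (\<lambda>d. sW (root_of_unity N powi (int t * (- b - int N)) * kappa N (- b - 1) (n + d) (-1))
      (YW (Y ((\<sigma> ^^ t) x) d y) (c + b - int N * n - int N * d) w)))"
proof -
  have n: "n = - (- n - 1) - 1" by simp
  have "C.act (one_minus_XN_powi N n) (prod2 YW x y w) (b - int N * n) c
    - sW ((-1) powi n) (C.act (one_minus_XN_powi N n) (prod2 YW y x w) (c - int N * n) b)
    = sW (1 / of_nat N) (\<Sum>t<N. formal_prod sW (delta_twisted N t) (viter Y YW ((\<sigma> ^^ t) x) y w) (- n - 1, b, c))"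
    using twisted[of x y, unfolded twisted_jacobi_def vprod_12_eq vprod_21_eq, rule_format, of w "(- n - 1, b, c)"]
    unfolding C.formal_prod_ramified_12[OF N n] C.formal_prod_ramified_21[OF N n] .
  then show ?thesis by (simp only: W.W.scale_sum_right formal_prod_twisted)
qed

definition change_supp :: "'v \<Rightarrow> int set" where "change_supp u = {m. change_op u m \<noteq> 0}"

lemma finite_change_supp: "finite (change_supp u)"
  by (simp add: change_supp_def finite_change_op)

lemma Yt_sum: "Yt u n w = (\<Sum>m\<in>change_supp u. YW (change_op u m) (n - m) w)"
  unfolding Yt_def by (rule Sum_any_eq_sum[OF finite_change_supp]) (simp add: change_supp_def)

lemma act_Yt:
  "C.act P (prod2 Yt u v w) b c =
    (\<Sum>m\<in>change_supp u. \<Sum>m'\<in>change_supp v. C.act P (prod2 YW (change_op u m) (change_op v m') w) (b - m) (c - m'))"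
proof -
  have tr: "C.truncated (\<lambda>b c. prod2 YW x y w (b + k) (c + l))" for x y k l
    by (rule C.truncated_shift[OF truncated_prod2[OF W.vmap]])
  have "prod2 Yt u v w = (\<lambda>b c. \<Sum>m\<in>change_supp u. \<Sum>m'\<in>change_supp v. prod2 YW (change_op u m) (change_op v m') w (b + - m) (c + - m'))"
    by (intro ext) (simp add: prod2_def Yt_sum W.Y_sum_right)
  then have "C.act P (prod2 Yt u v w) b c = (\<Sum>m\<in>change_supp u. \<Sum>m'\<in>change_supp v.
      C.act P (\<lambda>b c. prod2 YW (change_op u m) (change_op v m') w (b + - m) (c + - m')) b c)"
    using tr by (simp only: C.act_sum[OF finite_change_supp] C.truncated_sum[OF finite_change_supp])
  then show ?thesis unfolding C.act_shift by simp
qed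

text \<open>Multiplying an iterate by (1 + x)^b ((1 + x)^N - 1)^k only adds exponents in
  \<open>kappa\<close>, by \<open>kappa_add\<close>.\<close>

lemma iterate_term_convolution:
  "Sum_any (\<lambda>i::nat. sW (kappa N b (int k) (int i)) (iterate_term p m (\<alpha> - int i) w e x y)) =
    Sum_any (\<lambda>d. sW (kappa N (b + m) (int k + d) \<alpha>) (YW (Y x d y) (e - p - int N * d) w))"
  and finite_iterate_term_convolution:
  "finite {i::nat. sW (kappa N b (int k) (int i)) (iterate_term p m (\<alpha> - int i) w e x y) \<noteq> 0}"
proof -
  obtain d0 where d0: "\<forall>d<d0. Y x d y = 0" using Y_truncated by blast
  define t where "t i d = sW (kappa N b (int k) i) (sW (kappa N m d (\<alpha> - i)) (YW (Y x d y) (e - p - int N * d) w))" for i d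
  have nz: "d0 \<le> d \<and> d \<le> \<alpha> - i \<and> 0 \<le> i" if "t i d \<noteq> 0" for i d
  proof -
    have "\<not> d < d0" using that d0 by (auto simp: t_def)
    moreover have "\<not> \<alpha> - i < d" using that kappa_eq_0[OF N, of "\<alpha> - i" d m] by (auto simp: t_def)
    moreover have "\<not> i < int k" using that kappa_eq_0[OF N, of i "int k" b] by (auto simp: t_def)
    ultimately show ?thesis by auto
  qed
  have fin: "finite {(i, d). t i d \<noteq> 0}"
  proof (rule finite_subset)
    show "{(i, d). t i d \<noteq> 0} \<subseteq> {0..\<alpha> - d0} \<times> {d0..\<alpha>}" using nz by fastforce
  qed simp
  have it: "sW (kappa N b (int k) (int i)) (iterate_term p m (\<alpha> - int i) w e x y) = Sum_any (t (int i))" for i :: nat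
    by (simp add: iterate_term_def t_def W.W.scale_Sum_any)
  show "finite {i::nat. sW (kappa N b (int k) (int i)) (iterate_term p m (\<alpha> - int i) w e x y) \<noteq> 0}"
  proof (rule finite_subset)
    show "{i::nat. sW (kappa N b (int k) (int i)) (iterate_term p m (\<alpha> - int i) w e x y) \<noteq> 0} \<subseteq> {..nat (\<alpha> - d0)}"
    proof clarify
      fix i :: nat assume "sW (kappa N b (int k) (int i)) (iterate_term p m (\<alpha> - int i) w e x y) \<noteq> 0"
      then have "Sum_any (t (int i)) \<noteq> 0" by (simp only: it) simp
      then obtain d where "t (int i) d \<noteq> 0" by (rule Sum_any.not_neutral_obtains_not_neutral)
      then show "i \<le> nat (\<alpha> - d0)" using nz[of "int i" d] by linarith
    qed
  qed simp
  \<comment> \<open>\<open>kappa\<close> vanishes below degree k, so negative i contribute nothing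
    and the sum can be taken over all integers, as in \<open>kappa_add\<close>.\<close>
  have "Sum_any (\<lambda>i::nat. Sum_any (t (int i))) = Sum_any (\<lambda>i. Sum_any (t i))"
  proof (rule Sum_any_reindex_inj[symmetric])
    fix i assume "i \<notin> range int"
    then have "i < 0" by (metis nonneg_int_cases not_le rangeI)
    then have "t i d = 0" for d using nz[of i d] by force
    then show "Sum_any (t i) = 0" by simp
  qed simp
  also have "\<dots> = Sum_any (\<lambda>d. Sum_any (\<lambda>i. t i d))" by (rule Sum_any_swap_finite[OF fin])
  also have "\<dots> = Sum_any (\<lambda>d. sW (kappa N (b + m) (int k + d) \<alpha>) (YW (Y x d y) (e - p - int N * d) w))"
  proof (rule Sum_any.cong)
    fix d
    have "sW (kappa N (b + m) (int k + d) \<alpha>) (YW (Y x d y) (e - p - int N * d) w) =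
        Sum_any (\<lambda>i. sW (kappa N b (int k) i * kappa N m d (\<alpha> - i)) (YW (Y x d y) (e - p - int N * d) w))"
      unfolding kappa_add[OF N]
      by (rule Sum_any_additive[where f = "\<lambda>r. sW r (YW (Y x d y) (e - p - int N * d) w)", OF W.W.scale_left_distrib])
        (rule finite_subset[OF kappa_conv_subset[OF N]], simp)
    then show "Sum_any (\<lambda>i. t i d) = sW (kappa N (b + m) (int k + d) \<alpha>) (YW (Y x d y) (e - p - int N * d) w)"
      by (simp add: t_def)
  qed
  finally show "Sum_any (\<lambda>i::nat. sW (kappa N b (int k) (int i)) (iterate_term p m (\<alpha> - int i) w e x y)) =
      Sum_any (\<lambda>d. sW (kappa N (b + m) (int k + d) \<alpha>) (YW (Y x d y) (e - p - int N * d) w))"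
    unfolding it .
qed

text \<open>In the twisted Jacobi identity tested against \<open>(x\<^sub>1 - x\<^sub>2)\<^sup>n (x\<^sub>1\<^sup>N - x\<^sub>2\<^sup>N)\<^sup>k\<close>, for large \<open>k\<close> only the
  branch \<open>x\<^sub>1 = x\<^sub>2\<close> contributes a residue.\<close>

lemma branch_residues:
  fixes k :: nat and \<alpha> \<beta> e m :: int
  assumes k: "\<And>t d. t < N \<Longrightarrow> d < - int k \<Longrightarrow> Y ((\<sigma> ^^ t) x) d y = 0"
  defines "n \<equiv> - \<alpha> - 1" and "n' \<equiv> int k - int (nat (\<alpha> + 1))"
  shows "(\<Sum>r\<le>degree (quot_poly N n). sW (coeff (quot_poly N n) r) (\<Sum>t<N. Sum_any (\<lambda>d.
      sW (root_of_unity N powi (int t * (- (\<beta> - int r - m) - int N)) * kappa N (- (\<beta> - int r - m) - 1) (n' + d) (-1))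
        (YW (Y ((\<sigma> ^^ t) x) d y) (e - int N * d) w))))
    = Sum_any (\<lambda>d. sW (kappa N (- 1 - \<beta> + m) (int k + d) \<alpha>) (YW (Y x d y) (e - int N * d) w))"
proof -
  let ?Q = "quot_poly N n" and ?\<omega> = "root_of_unity N"
  define T where "T t d = YW (Y ((\<sigma> ^^ t) x) d y) (e - int N * d) w" for t d
  define q where "q t r d = coeff ?Q r * (?\<omega> powi (int t * (- (\<beta> - int r - m) - int N)) * kappa N (- (\<beta> - int r - m) - 1) (n' + d) (-1))" for t r d
  have fin: "finite {d. sW (q t r d) (T t d) \<noteq> 0}" for t r
  proof -
    obtain d0 where d0: "\<forall>d<d0. Y ((\<sigma> ^^ t) x) d y = 0" using Y_truncated by blast
    have "{d. sW (q t r d) (T t d) \<noteq> 0} \<subseteq> {d0..- n'}"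
    proof clarify
      fix d assume nz: "sW (q t r d) (T t d) \<noteq> 0"
      have "\<not> d < d0" using nz d0 by (auto simp: T_def)
      moreover have "\<not> -1 < n' + d" using nz kappa_eq_0[OF N, of "-1" "n' + d"] by (auto simp: q_def)
      ultimately show "d \<in> {d0..- n'}" by auto
    qed
    then show ?thesis by (rule finite_subset) simp
  qed
  \<comment> \<open>For t = 0 the residue is available for every d. For t \<noteq> 0 there is no
    pole if d \<ge> -k, and for d < -k the vector itself is 0 by the choice of k.\<close>
  have scal: "sW (\<Sum>r\<le>degree ?Q. q t r d) (T t d) = (if t = 0 then sW (kappa N (- 1 - \<beta> + m) (int k + d) \<alpha>) (T 0 d) else 0)"
    if t: "t < N" for t d
  proof (cases "t \<noteq> 0 \<and> d < - int k")
    case True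
    then show ?thesis using k[OF t] by (simp add: T_def)
  next
    case False
    define s where "s = - 1 - \<beta> + m"
    have one: "?\<omega> ^ t = 1 \<longleftrightarrow> t = 0" by (rule root_of_unity_power_eq_1[OF N t])
    have "(?\<omega> ^ t) ^ N = 1"
      using root_of_unity_power(1)[OF N] by (metis mult.commute power_mult power_one)
    then have res: "(\<Sum>r\<le>degree ?Q. coeff ?Q r * (?\<omega> ^ t) ^ r * kappa N (int r + s) (d + int k - int (nat (- n))) (-1))
        = (if ?\<omega> ^ t = 1 then kappa N s (int k + d) \<alpha> else 0)"
      unfolding n_def by (rule residue_quot_poly[OF N]) (use False one in auto)
    \<comment> \<open>The part of the root of unity that depends on r is (\<omega>^t)^r, which
      belongs to y^r on the branch y = \<omega>^t (1 + x); the rest leaves the sum over r.\<close>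
    have "q t r d = ?\<omega> powi (int t * (m - \<beta> - int N)) * (coeff ?Q r * (?\<omega> ^ t) ^ r * kappa N (int r + s) (d + int k - int (nat (- n))) (-1))" for r
    proof -
      have "int t * (- (\<beta> - int r - m) - int N) = int t * (m - \<beta> - int N) + int (t * r)" by (simp add: algebra_simps)
      then have "?\<omega> powi (int t * (- (\<beta> - int r - m) - int N)) = ?\<omega> powi (int t * (m - \<beta> - int N)) * (?\<omega> ^ t) ^ r"
        by (simp only: power_int_add[OF disjI1[OF root_of_unity_power(2)[OF N]]] power_int_of_nat power_mult)
      moreover have "- (\<beta> - int r - m) - 1 = int r + s" by (simp add: s_def)
      moreover have "n' + d = d + int k - int (nat (- n))" by (simp add: n'_def n_def)
      ultimately show ?thesis unfolding q_def by (simp only: mult_ac)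
    qed
    then have "(\<Sum>r\<le>degree ?Q. q t r d) = ?\<omega> powi (int t * (m - \<beta> - int N)) * (if ?\<omega> ^ t = 1 then kappa N s (int k + d) \<alpha> else 0)"
      by (simp only: res flip: sum_distrib_left)
    then show ?thesis using one by (simp add: s_def)
  qed
  have "(\<Sum>r\<le>degree ?Q. sW (coeff ?Q r) (\<Sum>t<N. Sum_any (\<lambda>d.
      sW (?\<omega> powi (int t * (- (\<beta> - int r - m) - int N)) * kappa N (- (\<beta> - int r - m) - 1) (n' + d) (-1))
        (YW (Y ((\<sigma> ^^ t) x) d y) (e - int N * d) w))))
    = (\<Sum>r\<le>degree ?Q. \<Sum>t<N. Sum_any (\<lambda>d. sW (q t r d) (T t d)))"
    by (simp add: W.W.scale_sum_right W.W.scale_Sum_any q_def T_def)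
  also have "\<dots> = (\<Sum>t<N. \<Sum>r\<le>degree ?Q. Sum_any (\<lambda>d. sW (q t r d) (T t d)))" by (rule sum.swap)
  also have "\<dots> = (\<Sum>t<N. Sum_any (\<lambda>d. \<Sum>r\<le>degree ?Q. sW (q t r d) (T t d)))"
    by (rule sum.cong[OF refl], rule Sum_any_sum[symmetric]) (use fin in auto)
  also have "\<dots> = (\<Sum>t<N. if t = 0 then Sum_any (\<lambda>d. sW (kappa N (- 1 - \<beta> + m) (int k + d) \<alpha>) (T 0 d)) else 0)"
  proof (rule sum.cong[OF refl])
    fix t assume "t \<in> {..<N}"
    then have "t < N" by simp
    then show "Sum_any (\<lambda>d. \<Sum>r\<le>degree ?Q. sW (q t r d) (T t d)) =
        (if t = 0 then Sum_any (\<lambda>d. sW (kappa N (- 1 - \<beta> + m) (int k + d) \<alpha>) (T 0 d)) else 0)"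
      unfolding W.W.scale_sum_left[symmetric] by (simp only: scal) simp
  qed
  also have "\<dots> = Sum_any (\<lambda>d. sW (kappa N (- 1 - \<beta> + m) (int k + d) \<alpha>) (YW (Y x d y) (e - int N * d) w))"
    using N by (simp add: T_def)
  finally show ?thesis .
qed

theorem Yt_quasi_jacobi:
  "\<exists>k. quasi_jacobi sW Y Yt (C.difference_power N k) u v"
proof -
  have "\<forall>m m' t. \<exists>k::nat. \<forall>d. d < - int k \<longrightarrow> Y ((\<sigma> ^^ t) (change_op u m)) d (change_op v m') = 0"
  proof (intro allI)
    fix m m' t
    obtain d0 where "\<forall>d<d0. Y ((\<sigma> ^^ t) (change_op u m)) d (change_op v m') = 0" using Y_truncated by blast
    then show "\<exists>k::nat. \<forall>d. d < - int k \<longrightarrow> Y ((\<sigma> ^^ t) (change_op u m)) d (change_op v m') = 0"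
      by (intro exI[of _ "nat (- d0)"]) auto
  qed
  then obtain f where f: "\<forall>m m' t. \<forall>d. d < - int (f m m' t) \<longrightarrow> Y ((\<sigma> ^^ t) (change_op u m)) d (change_op v m') = 0" by metis
  define S where "S = change_supp u \<times> change_supp v \<times> {..<N}"
  \<comment> \<open>One k bounds the pole orders for all components of \<Phi>(x) u and \<Phi>(x) v
    and all branches t at once; finite supports make the maximum exist.\<close>
  define k where "k = Max (insert 0 ((\<lambda>(m, m', t). f m m' t) ` S))"
  have finS: "finite S" by (simp add: S_def finite_change_supp)
  have k: "Y ((\<sigma> ^^ t) (change_op u m)) d (change_op v m') = 0"
    if "m \<in> change_supp u" "m' \<in> change_supp v" "t < N" "d < - int k" for m m' t d
  proof -
    have "f m m' t \<le> k"
      unfolding k_def using finS that by (intro Max_ge) (auto simp: S_def image_iff intro!: bexI[of _ "(m, m', t)"])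
    then have "d < - int (f m m' t)" using that by linarith
    then show ?thesis using f by blast
  qed
  have tr: "C.truncated (prod2 Yt u v w)" for u v w by (rule truncated_prod2[OF Yt_vertex_map])
  have "formal_prod sW delta_12_0 (formal_prod sW (poly_series (C.difference_power N k)) (vprod_12 Yt u v w)) (\<alpha>, \<beta>, \<gamma>)
      - formal_prod sW delta_21_0 (formal_prod sW (poly_series (C.difference_power N k)) (vprod_21 Yt u v w)) (\<alpha>, \<beta>, \<gamma>)
      = formal_prod sW delta_10_2 (formal_prod sW (poly_series (C.difference_power N k)) (viter Y Yt u v w)) (\<alpha>, \<beta>, \<gamma>)"
    for w \<alpha> \<beta> \<gamma>
  proof -
    define n where "n = - \<alpha> - 1"
    define n' where "n' = int k - int (nat (- n))"
    define D where "D = degree (quot_poly N n)"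
    define e where "e = \<gamma> + \<beta> - n - int N * int k"
    let ?Q = "coeff (quot_poly N n)"
    have D: "int D = n + int N * int k - int N * n'"
      using degree_quot_poly[OF N, of n] by (simp add: D_def n'_def algebra_simps)
    have "formal_prod sW delta_12_0 (formal_prod sW (poly_series (C.difference_power N k)) (vprod_12 Yt u v w)) (\<alpha>, \<beta>, \<gamma>) =
        C.act (one_minus_X_powi n) (\<lambda>b c. C.act (one_minus_XN_powi N (int k)) (prod2 Yt u v w) (b + - (int N * int k)) (c + 0)) (\<beta> - n) \<gamma>"
      unfolding vprod_12_eq C.formal_prod_poly_12[OF N] C.formal_prod_12[OF n_def] by simp
    also have "\<dots> = C.act (one_minus_X_powi n) (C.act (one_minus_XN_powi N (int k)) (prod2 Yt u v w)) (\<beta> - n - int N * int k) \<gamma>"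
      unfolding C.act_shift by simp
    finally have l12: "formal_prod sW delta_12_0 (formal_prod sW (poly_series (C.difference_power N k)) (vprod_12 Yt u v w)) (\<alpha>, \<beta>, \<gamma>) =
        (\<Sum>r\<le>D. sW (?Q r) (C.act (one_minus_XN_powi N n') (prod2 Yt u v w) (\<beta> - int r - int N * n') (\<gamma> - int D + int r)))"
      unfolding n'_def D_def by (simp only: C.act_quot_poly[OF N tr])
    have "formal_prod sW delta_21_0 (formal_prod sW (poly_series (C.difference_power N k)) (vprod_21 Yt u v w)) (\<alpha>, \<beta>, \<gamma>) =
        sW ((-1) powi n) (C.act (one_minus_X_powi n) (\<lambda>c b. sW ((-1) ^ k) (C.act (one_minus_XN_powi N (int k)) (prod2 Yt v u w) (c - int N * int k) b)) (\<gamma> - n) \<beta>)"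
      unfolding vprod_21_eq C.formal_prod_poly_21[OF N] C.formal_prod_21[OF n_def] ..
    also have "\<dots> = sW ((-1) powi n * (-1) ^ k) (C.act (one_minus_X_powi n) (\<lambda>c b. C.act (one_minus_XN_powi N (int k)) (prod2 Yt v u w) (c + - (int N * int k)) (b + 0)) (\<gamma> - n) \<beta>)"
      by (simp add: C.act_def[of "one_minus_X_powi n"] W.W.scale_Sum_any mult_ac)
    also have "\<dots> = sW ((-1) powi n * (-1) ^ k) (C.act (one_minus_X_powi n) (C.act (one_minus_XN_powi N (int k)) (prod2 Yt v u w)) (\<gamma> - n - int N * int k) \<beta>)"
      unfolding C.act_shift by simp
    finally have l21: "formal_prod sW delta_21_0 (formal_prod sW (poly_series (C.difference_power N k)) (vprod_21 Yt u v w)) (\<alpha>, \<beta>, \<gamma>) =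
        (\<Sum>r\<le>D. sW (?Q r) (sW ((-1) powi n') (C.act (one_minus_XN_powi N n') (prod2 Yt v u w) (\<gamma> - int D + int r - int N * n') (\<beta> - int r))))"
      unfolding n'_def D_def by (simp only: C.act_quot_poly'[OF N tr])
    \<comment> \<open>The left-hand side of a twisted Jacobi identity for the components m and m',
      with the power n'.\<close>
    define J where "J r m m' = C.act (one_minus_XN_powi N n') (prod2 YW (change_op u m) (change_op v m') w) ((\<beta> - int r - m) - int N * n') (\<gamma> - int D + int r - m')
        - sW ((-1) powi n') (C.act (one_minus_XN_powi N n') (prod2 YW (change_op v m') (change_op u m) w) ((\<gamma> - int D + int r - m') - int N * n') (\<beta> - int r - m))" for r m m'
    have "formal_prod sW delta_12_0 (formal_prod sW (poly_series (C.difference_power N k)) (vprod_12 Yt u v w)) (\<alpha>, \<beta>, \<gamma>)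
      - formal_prod sW delta_21_0 (formal_prod sW (poly_series (C.difference_power N k)) (vprod_21 Yt u v w)) (\<alpha>, \<beta>, \<gamma>)
      = (\<Sum>r\<le>D. sW (?Q r) (\<Sum>m\<in>change_supp u. \<Sum>m'\<in>change_supp v. J r m m'))"
      unfolding l12 l21 sum_subtractf[symmetric] W.W.scale_right_diff_distrib[symmetric]
    proof (rule sum.cong[OF refl], rule arg_cong[where f = "sW _"])
      fix r
      have c1: "\<beta> - int r - int N * n' - m = (\<beta> - int r - m) - int N * n'" for m by simp
      have c2: "\<gamma> - int D + int r - int N * n' - m' = (\<gamma> - int D + int r - m') - int N * n'" for m' by simp
      show "C.act (one_minus_XN_powi N n') (prod2 Yt u v w) (\<beta> - int r - int N * n') (\<gamma> - int D + int r) -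
          sW ((-1) powi n') (C.act (one_minus_XN_powi N n') (prod2 Yt v u w) (\<gamma> - int D + int r - int N * n') (\<beta> - int r)) =
          (\<Sum>m\<in>change_supp u. \<Sum>m'\<in>change_supp v. J r m m')"
        unfolding act_Yt W.W.scale_sum_right c1 c2 J_def sum_subtractf
        by (subst (2) sum.swap) (rule refl)
    qed
    also have "\<dots> = (\<Sum>m\<in>change_supp u. \<Sum>m'\<in>change_supp v. \<Sum>r\<le>D. sW (?Q r) (J r m m'))"
      unfolding W.W.scale_sum_right by (subst sum.swap, rule sum.cong[OF refl], rule sum.swap)
    also have "\<dots> = (\<Sum>m\<in>change_supp u. \<Sum>m'\<in>change_supp v.
        Sum_any (\<lambda>d. sW (kappa N (- 1 - \<beta> + m) (int k + d) \<alpha>) (YW (Y (change_op u m) d (change_op v m')) (e - (m + m') - int N * d) w)))"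
    proof (intro sum.cong[OF refl])
      fix m m' assume m: "m \<in> change_supp u" "m' \<in> change_supp v"
      \<comment> \<open>The exponent of the vertex operator does not depend on r, so the sum over r
        acts on residues alone.\<close>
      have ex: "(\<gamma> - int D + int r - m') + (\<beta> - int r - m) - int N * n' - int N * d = e - (m + m') - int N * d" for r d
        using D by (simp add: e_def)
      have n1: "n' = int k - int (nat (\<alpha> + 1))" by (simp add: n'_def n_def)
      show "(\<Sum>r\<le>D. sW (?Q r) (J r m m')) =
          Sum_any (\<lambda>d. sW (kappa N (- 1 - \<beta> + m) (int k + d) \<alpha>) (YW (Y (change_op u m) d (change_op v m')) (e - (m + m') - int N * d) w))"
        unfolding J_def twisted_jacobi_act ex unfolding D_def n_def n1
        by (rule branch_residues) (use k[OF m] in blast)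
    qed
    \<comment> \<open>The coefficient is split into that of the polynomial at x1 = x2 + x0 and that
      of the iterate, the form taken by the third term of the identity.\<close>
    also have "\<dots> = (\<Sum>m\<in>change_supp u. \<Sum>m'\<in>change_supp v. Sum_any (\<lambda>i::nat. sW (kappa N (- 1 - \<beta>) (int k) (int i))
        (iterate_term (m + m') m (\<alpha> - int i) w e (change_op u m) (change_op v m'))))"
      by (simp only: iterate_term_convolution)
    also have "\<dots> = Sum_any (\<lambda>i::nat. \<Sum>m\<in>change_supp u. \<Sum>m'\<in>change_supp v. sW (kappa N (- 1 - \<beta>) (int k) (int i))
        (iterate_term (m + m') m (\<alpha> - int i) w e (change_op u m) (change_op v m')))"
    proof -
      have fin: "finite {i::nat. (\<Sum>m'\<in>change_supp v. sW (kappa N (- 1 - \<beta>) (int k) (int i))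
        (iterate_term (m + m') m (\<alpha> - int i) w e (change_op u m) (change_op v m'))) \<noteq> 0}" for m
        by (intro finite_nonzero_sum finite_change_supp finite_iterate_term_convolution)
      show ?thesis
        by (simp only: Sum_any_sum[OF finite_change_supp fin] Sum_any_sum[OF finite_change_supp finite_iterate_term_convolution])
    qed
    also have "\<dots> = Sum_any (\<lambda>i::nat. sW (kappa N (- 1 - \<beta>) (int k) (int i)) (Yt (Y u (\<alpha> - int i) v) (\<gamma> + 1 + int i + \<beta> - int N * int k) w))"
    proof (rule Sum_any.cong)
      fix i :: nat
      have "\<gamma> + 1 + int i + \<beta> - int N * int k + (\<alpha> - int i) = e" by (simp add: e_def n_def)
      moreover have "Sum_any (\<lambda>m. Sum_any (\<lambda>m'. iterate_term (m + m') m c w e (change_op u m) (change_op v m')))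
          = (\<Sum>m\<in>change_supp u. \<Sum>m'\<in>change_supp v. iterate_term (m + m') m c w e (change_op u m) (change_op v m'))" for c
        by (subst Sum_any_eq_sum[OF finite_change_supp[of u]], simp add: change_supp_def,
            rule sum.cong[OF refl], rule Sum_any_eq_sum[OF finite_change_supp[of v]], simp add: change_supp_def)
      ultimately show "(\<Sum>m\<in>change_supp u. \<Sum>m'\<in>change_supp v. sW (kappa N (- 1 - \<beta>) (int k) (int i))
        (iterate_term (m + m') m (\<alpha> - int i) w e (change_op u m) (change_op v m'))) =
        sW (kappa N (- 1 - \<beta>) (int k) (int i)) (Yt (Y u (\<alpha> - int i) v) (\<gamma> + 1 + int i + \<beta> - int N * int k) w)"
        unfolding Yt_iterate by (simp only: W.W.scale_sum_right)
    qed
    also have "\<dots> = formal_prod sW delta_10_2 (formal_prod sW (poly_series (C.difference_power N k)) (viter Y Yt u v w)) (\<alpha>, \<beta>, \<gamma>)"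
    proof -
      obtain a0 where "\<forall>a<a0. Y u a v = 0" using Y_truncated by blast
      then have "\<exists>a0. \<forall>a<a0. \<forall>c. Yt (Y u a v) c w = 0"
        using Yt_add[of 0 0] by (intro exI[of _ a0]) simp
      then show ?thesis
        unfolding viter_def by (rule C.formal_prod_10_2[OF N, symmetric])
    qed
    finally show ?thesis .
  qed
  then have "quasi_jacobi sW Y Yt (C.difference_power N k) u v"
    unfolding quasi_jacobi_def by (metis prod_cases3)
  then show ?thesis by blast
qed

end

section \<open>Equivariance under the automorphism\<close>

lemma root_of_unity_orthogonality:
  assumes N: "N > 0" and "t < N" "s < N"
  shows "(\<Sum>c<N. root_of_unity N powi ((int t - int s) * int c)) = (if t = s then of_nat N else 0)"
proof -
  define z where "z = root_of_unity N powi (int t - int s)"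
  note nz = root_of_unity_power(2)[OF N]
  have "(\<Sum>c<N. root_of_unity N powi ((int t - int s) * int c)) = (\<Sum>c<N. z ^ c)"
    by (simp add: z_def power_int_mult)
  also have "\<dots> = (if t = s then of_nat N else 0)"
  proof (cases "t = s")
    case False
    have "z \<noteq> 1"
    proof
      assume "z = 1"
      then have "root_of_unity N ^ t = root_of_unity N ^ s"
        using nz by (simp add: z_def power_int_diff)
      with assms False show False
        using inj_onD[OF root_of_unity_power(3)[OF N], of t s] by simp
    qed
    moreover have "z ^ N = 1"
    proof -
      have "z ^ N = (root_of_unity N ^ N) powi (int t - int s)"
        by (simp add: z_def mult.commute flip: power_int_of_nat power_int_mult)
      then show ?thesis by (simp add: root_of_unity_power(1)[OF N])
    qed
    then have "(z - 1) * (\<Sum>c<N. z ^ c) = 0" by (simp flip: power_diff_1_eq)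
    ultimately show ?thesis using False by simp
  qed (simp add: z_def)
  finally show ?thesis .
qed

context voa_change begin

context
  fixes g :: "'v \<Rightarrow> 'v"
  assumes g: "voa_automorphism scale Y vac conf g"
begin

lemma automorphism_add: "g (u + v) = g u + g v"
  and automorphism_scale: "g (scale c u) = scale c (g u)"
proof -
  have "Vector_Spaces.linear scale scale g" using g by (simp add: voa_automorphism_def)
  then interpret g: Vector_Spaces.linear scale scale g .
  show "g (u + v) = g u + g v" "g (scale c u) = scale c (g u)" by (rule g.add, rule g.scale)
qed

lemma automorphism_L: "g (L n v) = L n (g v)"
  using g by (simp add: voa_automorphism_def virasoro_def)

lemma automorphism_zero: "g 0 = 0"
  using automorphism_add[of 0 0] by simp

text \<open>An automorphism fixes \<open>conf\<close>, so it commutes with L(0) and preserves the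
  eigenspaces.\<close>

lemma automorphism_grade: "u \<in> grade h \<Longrightarrow> g u \<in> grade h"
  unfolding grade_eigen by (metis automorphism_L automorphism_scale)

lemma automorphism_comp: "comp n (g u) = g (comp n u)"
  by (rule additive_eqI[of "\<lambda>u. comp n (g u)" "\<lambda>u. g (comp n u)"])
    (auto simp: automorphism_add comp_add comp_grade automorphism_zero dest: automorphism_grade)

lemma automorphism_X: "g (X v) = X (g v)"
proof -
  obtain M where M: "\<forall>n\<ge>M. L (int n - 1) v = 0" using L_vanishes by blast
  then have M': "\<forall>n\<ge>M. L (int n - 1) (g v) = 0"
    by (metis automorphism_L automorphism_zero)
  have "g (sum f A) = (\<Sum>i\<in>A. g (f i))" for f :: "nat \<Rightarrow> 'v" and A
    by (induction A rule: infinite_finite_induct) (simp_all add: automorphism_add automorphism_zero)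
  then show ?thesis
    unfolding rho_eq_sum[OF M] rho_eq_sum[OF M'] by (simp add: automorphism_scale automorphism_L)
qed

lemma automorphism_E: "g (E v) = E (g v)"
proof -
  have "g ((X ^^ k) v) = (X ^^ k) (g v)" for k by (induction k) (simp_all add: automorphism_X)
  then show ?thesis
    unfolding E_def Sum_any_additive[of g, OF automorphism_add finite_E] by (simp add: automorphism_scale)
qed

lemma automorphism_change_op: "change_op (g u) m = g (change_op u m)"
  unfolding change_op_eq Sum_any_additive[of g, OF automorphism_add change_op_finite_sum]
  by (simp add: automorphism_scale automorphism_comp automorphism_E[symmetric])

end

lemma scalar_pow_L0_add: "scalar_pow_L0 scale grade c (u + v) = scalar_pow_L0 scale grade c u + scalar_pow_L0 scale grade c v"
proof -
  have fin: "finite {n. scale (c powi n) (comp n v) \<noteq> 0}" for v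
    by (rule Sum_any_finite_image[OF finite_comp[of v]]) simp
  show ?thesis
    unfolding scalar_pow_L0_def comp_add scale_right_distrib by (rule Sum_any.distrib[OF fin fin])
qed

lemma scalar_pow_L0_grade: "u \<in> grade h \<Longrightarrow> scalar_pow_L0 scale grade c u = scale (c powi h) u"
  by (simp add: scalar_pow_L0_def comp_grade if_distrib[of "scale _"] cong: if_cong)

end

context voa_twisted begin

text \<open>The twisted Jacobi identity with v = \<open>vac\<close> and n = -1. The left-hand side
  is the difference of the two expansions of (x1 - x2)^-1, a delta function in integral powers;
  hence the divisibility by N. The right-hand side averages the operators of \<sigma>^t x against
  powers of the root of unity.\<close>

lemma twisted_vacuum:
  "(if int N dvd c then YW x m w else 0) =
    (\<Sum>t<N. sW (root_of_unity N powi (int t * (c - m)) / of_nat N) (YW ((\<sigma> ^^ t) x) m w))"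
proof -
  \<comment> \<open>Chosen so that the surviving vertex operator on the right has exponent c + b + N
    = m.\<close>
  define b where "b = m - c - int N"
  have if_0: "(if A then (if B then z else 0) else 0) = 0" if "\<not> (A \<and> B)" for A B and z :: 'w
    using that by auto
  have coef: "(of_int (- 1) gchoose q) * (-1) ^ q = (1 :: complex)" for q
    using gbinomial_negated_upper[of "- 1 :: complex" q]
    by (simp add: binomial_gbinomial[symmetric] flip: power_mult_distrib)
  \<comment> \<open>This expansion covers the nonnegative multiples of N, the opposite one below the
    negative multiples.\<close>
  have 1: "C.act (one_minus_XN_powi N (- 1)) (prod2 YW x vac w) (b + int N) c = (if int N dvd c \<and> c \<ge> 0 then YW x m w else 0)"
  proof -
    have "prod2 YW x vac w (b + int N + int N * int q) (c - int N * int q) =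
        (if q = nat (c div int N) then (if int N dvd c \<and> c \<ge> 0 then YW x m w else 0) else 0)" for q
    proof (cases "c = int N * int q")
      case True
      then show ?thesis using N by (simp add: prod2_def vacuum_W b_def)
    next
      case False
      have "\<not> (q = nat (c div int N) \<and> (int N dvd c \<and> c \<ge> 0))"
      proof
        assume c: "q = nat (c div int N) \<and> (int N dvd c \<and> c \<ge> 0)"
        then have "int q = c div int N" using N by (simp add: pos_imp_zdiv_nonneg_iff)
        then show False using False c by simp
      qed
      note if_0[OF this]
      moreover have "prod2 YW x vac w (b + int N + int N * int q) (c - int N * int q) = 0"
        using False by (simp add: prod2_def vacuum_W)
      ultimately show ?thesis by (simp only:)
    qed
    then show ?thesis unfolding C.act_one_minus_XN_powi[OF N] coef by simp
  qed
  have 2: "C.act (one_minus_XN_powi N (- 1)) (prod2 YW vac x w) (c + int N) b = (if int N dvd c \<and> c < 0 then YW x m w else 0)"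
  proof -
    have "prod2 YW vac x w (c + int N + int N * int q) (b - int N * int q) =
        (if q = nat (- (c div int N) - 1) then (if int N dvd c \<and> c < 0 then YW x m w else 0) else 0)" for q
    proof (cases "c + int N + int N * int q = 0")
      case True
      then have c: "c = int N * (- 1 - int q)" by (simp add: algebra_simps)
      then have "b - int N * int q = m" by (simp add: b_def algebra_simps)
      then have "prod2 YW vac x w (c + int N + int N * int q) (b - int N * int q) = YW x m w"
        using True by (simp only: prod2_def vacuum_W) simp
      moreover have "q = nat (- (c div int N) - 1)" "int N dvd c" "c < 0"
        using N c by (simp_all add: mult_less_0_iff)
      ultimately show ?thesis by simp
    next
      case False
      have "\<not> (q = nat (- (c div int N) - 1) \<and> (int N dvd c \<and> c < 0))"
      proof
        assume c: "q = nat (- (c div int N) - 1) \<and> (int N dvd c \<and> c < 0)"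
        then have "c div int N < 0" using N by (simp add: div_neg_pos_less0)
        then have q: "int q = - (c div int N) - 1" using c by simp
        have "int N * int q = - (int N * (c div int N)) - int N"
          unfolding q by (simp add: algebra_simps)
        moreover have "int N * (c div int N) = c" using c by simp
        ultimately have "c + int N + int N * int q = 0" by linarith
        then show False using False by blast
      qed
      note if_0[OF this]
      moreover have "prod2 YW vac x w (c + int N + int N * int q) (b - int N * int q) = 0"
        using False by (simp add: prod2_def vacuum_W)
      ultimately show ?thesis by (simp only:)
    qed
    then show ?thesis unfolding C.act_one_minus_XN_powi[OF N] coef by simp
  qed
  have 3: "Sum_any (\<lambda>d. sW (root_of_unity N powi (int t * (- b - int N)) * kappa N (- b - 1) (- 1 + d) (-1))
      (YW (Y ((\<sigma> ^^ t) x) d vac) (c + b - int N * (- 1) - int N * d) w))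
    = sW (root_of_unity N powi (int t * (c - m)) / of_nat N) (YW ((\<sigma> ^^ t) x) m w)" for t
  proof -
    \<comment> \<open>Creation kills d < 0 and the residue kills d > 0; at d = 0 the residue is
      1/N.\<close>
    have "sW (root_of_unity N powi (int t * (- b - int N)) * kappa N (- b - 1) (- 1 + d) (-1))
        (YW (Y ((\<sigma> ^^ t) x) d vac) (c + b - int N * (- 1) - int N * d) w)
      = (if d = 0 then sW (root_of_unity N powi (int t * (c - m)) / of_nat N) (YW ((\<sigma> ^^ t) x) m w) else 0)" for d
    proof -
      consider "d < 0" | "d = 0" | "d > 0" by linarith
      then show ?thesis
      proof cases
        case 1
        then show ?thesis by (simp add: creation)
      next
        case 2
        have e: "- b - int N = c - m" "c + b - int N * (- 1) - int N * 0 = m" by (simp_all add: b_def)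
        show ?thesis unfolding 2 e by (simp add: creation residue_binomial_power[OF N])
      next
        case 3
        then show ?thesis by (simp add: residue_binomial_power[OF N])
      qed
    qed
    then show ?thesis by simp
  qed
  have "C.act (one_minus_XN_powi N (- 1)) (prod2 YW x vac w) (b - int N * (- 1)) c
    - sW ((-1) powi (- 1)) (C.act (one_minus_XN_powi N (- 1)) (prod2 YW vac x w) (c - int N * (- 1)) b)
    = (\<Sum>t<N. sW (root_of_unity N powi (int t * (c - m)) / of_nat N) (YW ((\<sigma> ^^ t) x) m w))"
    unfolding twisted_jacobi_act[of "- 1"] 3 ..
  then have "(if int N dvd c \<and> c \<ge> 0 then YW x m w else 0) + (if int N dvd c \<and> c < 0 then YW x m w else 0)
    = (\<Sum>t<N. sW (root_of_unity N powi (int t * (c - m)) / of_nat N) (YW ((\<sigma> ^^ t) x) m w))"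
    by (simp add: 1 2 power_int_minus)
  then show ?thesis by (auto split: if_splits)
qed

text \<open>Fourier inversion of \<open>twisted_vacuum\<close> over Z/N: among 0, ..., N - 1 only c
  = 0 is divisible by N, and summing over c against the character of s isolates t = s.\<close>

lemma YW_equivariant:
  assumes s: "s < N"
  shows "YW ((\<sigma> ^^ s) x) m w = sW (root_of_unity N powi (int s * m)) (YW x m w)"
proof -
  let ?\<omega> = "root_of_unity N"
  note nz = root_of_unity_power(2)[OF N]
  have "YW x m w = (\<Sum>c<N. if c = 0 then YW x m w else 0)" using N by simp
  also have "\<dots> = (\<Sum>c<N. sW (?\<omega> powi (- (int s * int c))) (if int N dvd int c then YW x m w else 0))"
    by (rule sum.cong) (auto dest: nat_dvd_not_less)
  also have "\<dots> = (\<Sum>c<N. \<Sum>t<N. sW (?\<omega> powi ((int t - int s) * int c) * (?\<omega> powi (- (int t * m)) / of_nat N)) (YW ((\<sigma> ^^ t) x) m w))"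
  proof (rule sum.cong[OF refl])
    fix c
    have "?\<omega> powi (- (int s * int c)) * (?\<omega> powi (int t * (int c - m)) / of_nat N) =
        ?\<omega> powi ((int t - int s) * int c) * (?\<omega> powi (- (int t * m)) / of_nat N)" for t
    proof -
      have "- (int s * int c) + int t * (int c - m) = (int t - int s) * int c + - (int t * m)"
        by (simp add: algebra_simps)
      then show ?thesis using nz by (simp add: power_int_add[symmetric])
    qed
    then show "sW (?\<omega> powi (- (int s * int c))) (if int N dvd int c then YW x m w else 0) =
        (\<Sum>t<N. sW (?\<omega> powi ((int t - int s) * int c) * (?\<omega> powi (- (int t * m)) / of_nat N)) (YW ((\<sigma> ^^ t) x) m w))"
      unfolding twisted_vacuum W.W.scale_sum_right by (simp only: W.W.scale_scale)
  qed
  also have "\<dots> = (\<Sum>t<N. sW ((\<Sum>c<N. ?\<omega> powi ((int t - int s) * int c)) * (?\<omega> powi (- (int t * m)) / of_nat N)) (YW ((\<sigma> ^^ t) x) m w))"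
    by (subst sum.swap) (simp only: W.W.scale_sum_left sum_distrib_right)
  also have "\<dots> = (\<Sum>t<N. if t = s then sW (?\<omega> powi (- (int s * m))) (YW ((\<sigma> ^^ s) x) m w) else 0)"
    using N s by (intro sum.cong) (auto simp: root_of_unity_orthogonality)
  also have "\<dots> = sW (?\<omega> powi (- (int s * m))) (YW ((\<sigma> ^^ s) x) m w)" using s by simp
  finally show ?thesis using nz by (simp add: power_int_minus)
qed

text \<open>On weight h the exponents of \<Phi>(x) are m = N k - h. The factor \<omega>^(-s h) from
  the power of L(0) and \<omega>^(s (n - m)) from \<open>YW_equivariant\<close> multiply to
  \<omega>^(s n), since \<omega>^(s N k) = 1.\<close>

lemma Yt_equivariant:
  assumes s: "s < N" and g: "voa_automorphism scale Y vac conf (\<sigma> ^^ s)"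
  shows "Yt (scalar_pow_L0 scale grade (inverse (root_of_unity N ^ s)) ((\<sigma> ^^ s) u)) n w =
    sW ((root_of_unity N ^ s) powi n) (Yt u n w)"
proof -
  let ?\<omega> = "root_of_unity N"
  note nz = root_of_unity_power(2)[OF N]
  show ?thesis
  proof (rule additive_eqI[of "\<lambda>u. Yt (scalar_pow_L0 scale grade (inverse (?\<omega> ^ s)) ((\<sigma> ^^ s) u)) n w"
        "\<lambda>u. sW ((?\<omega> ^ s) powi n) (Yt u n w)"])
    fix h u assume u: "u \<in> grade h"
    have gu: "(\<sigma> ^^ s) u \<in> grade h" by (rule automorphism_grade[OF g u])
    have "sW (inverse (?\<omega> ^ s) powi h) (YW (change_op ((\<sigma> ^^ s) u) m) (n - m) w) = sW ((?\<omega> ^ s) powi n) (YW (change_op u m) (n - m) w)" for m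
    proof (cases "m \<in> range (\<lambda>k. int N * k - h)")
      case True
      then obtain k where m: "m = int N * k - h" by blast
      have "inverse (?\<omega> ^ s) powi h = ?\<omega> powi (- (int s * h))"
        by (simp add: power_int_minus power_int_inverse power_int_mult flip: power_int_of_nat)
      moreover have "?\<omega> powi (int s * int N * k) = 1"
        using root_of_unity_power(1)[OF N] by (simp add: power_int_mult mult.commute[of "int s"])
      moreover have "- (int s * h) + int s * (n - m) = int s * n + - (int s * int N * k)"
        by (simp add: m algebra_simps)
      ultimately have "inverse (?\<omega> ^ s) powi h * ?\<omega> powi (int s * (n - m)) = (?\<omega> ^ s) powi n"
        using nz by (simp add: power_int_add[symmetric])
          (simp add: power_int_diff power_int_mult)
      then show ?thesis
        by (simp add: automorphism_change_op[OF g] YW_equivariant[OF s])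
    next
      case False
      then show ?thesis by (simp add: change_op_grade(2)[OF u] change_op_grade(2)[OF gu])
    qed
    then show "Yt (scalar_pow_L0 scale grade (inverse (?\<omega> ^ s)) ((\<sigma> ^^ s) u)) n w = sW ((?\<omega> ^ s) powi n) (Yt u n w)"
      unfolding scalar_pow_L0_grade[OF gu] Yt_scale unfolding Yt_def W.W.scale_Sum_any by simp
  qed (simp_all add: automorphism_add[OF g] scalar_pow_L0_add Yt_add W.W.scale_right_distrib)
qed

lemma Yt_vac: "Yt vac n w = (if n = 0 then w else 0)"
proof -
  have "YW (change_op vac m) (n - m) w = (if m = 0 then YW vac n w else 0)" for m
    by (simp add: change_op_vac)
  then show ?thesis by (simp add: Yt_def vacuum_W)
qed

lemma Yt_quasi_module: "quasi_module scale Y vac sW Yt"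
  unfolding quasi_module_def
proof (intro conjI allI)
  show "vector_space sW" ..
  show "vertex_map scale sW Yt" by (rule Yt_vertex_map)
  show "Yt vac n w = (if n = 0 then w else 0)" for n w by (rule Yt_vac)
  fix u v
  obtain k where k: "quasi_jacobi sW Y Yt (C.difference_power N k) u v" using Yt_quasi_jacobi by blast
  \<comment> \<open>The coefficient of x1^N shows that the base is nonzero, hence so are its
    powers.\<close>
  have "coeff (coeff (C.difference_power N 1) 0) N = 1"
    unfolding C.coeff_difference_power using N by simp
  then have "C.difference_power N 1 \<noteq> 0" by auto
  then have "C.difference_power N k \<noteq> 0" by (simp add: C.difference_power_def)
  with k show "\<exists>p. p \<noteq> 0 \<and> quasi_jacobi sW Y Yt p u v" by blast
qed

end

theorem theorem2p7:
  fixes sV :: "complex \<Rightarrow> 'v::ab_group_add \<Rightarrow> 'v"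
    and grade :: "int \<Rightarrow> 'v set"
    and Y :: "'v \<Rightarrow> int \<Rightarrow> 'v \<Rightarrow> 'v"
    and vac conf :: 'v
    and \<sigma> :: "'v \<Rightarrow> 'v"
    and N :: nat
    and G :: "('v \<Rightarrow> 'v) set"
    and \<phi> :: "('v \<Rightarrow> 'v) \<Rightarrow> complex"
    and sW :: "complex \<Rightarrow> 'w::ab_group_add \<Rightarrow> 'w"
    and YW :: "'v \<Rightarrow> int \<Rightarrow> 'w \<Rightarrow> 'w"
    and a :: "nat \<Rightarrow> complex"
  assumes "vertex_operator_algebra sV grade Y vac conf"
    and "\<sigma> \<in> carrier (voa_Aut sV Y vac conf)"
    and "N > 0" and "group.ord (voa_Aut sV Y vac conf) \<sigma> = N"
    and "G = generate (voa_Aut sV Y vac conf) {\<sigma>}"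
    and "\<phi> \<in> hom ((voa_Aut sV Y vac conf)\<lparr>carrier := G\<rparr>) complex_units"
    and "inj_on \<phi> G"
    and "\<forall>j<N. \<phi> (\<sigma> ^^ j) = root_of_unity N ^ j"
    and "weak_twisted_module sV Y vac N \<sigma> sW YW"
    and "change_of_variable_coeffs N a"
  shows "G_phi_quasi_module sV grade Y vac N G \<phi> sW (Y_tilde sV grade Y conf N a YW)"
proof -
  interpret vertex_operator_algebra sV grade Y vac conf by fact
  interpret Aut: group "voa_Aut sV Y vac conf" by (rule group_voa_Aut)
  have W: "vector_space sW" "vertex_map sV sW YW" "\<And>n w. YW vac n w = (if n = 0 then w else 0)"
    "\<And>u v. twisted_jacobi N sW Y \<sigma> YW u v"
    using assms(9) by (auto simp: weak_twisted_module_def)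
  interpret W: vector_space sW by (rule W)
  interpret voa_twisted sV grade Y vac conf N a sW YW \<sigma>
    by unfold_locales (use assms W in auto)
  have pow: "\<sigma> [^]\<^bsub>voa_Aut sV Y vac conf\<^esub> (k :: nat) = \<sigma> ^^ k" for k
  proof (induction k)
    case (Suc k)
    then show ?case by (simp add: voa_Aut_def funpow_Suc_right del: funpow.simps)
  qed (simp add: voa_Aut_def)
  \<comment> \<open>G is cyclic; exponents are reduced modulo N because both the formula for
    \<open>\<phi>\<close> and \<open>Yt_equivariant\<close> concern exponents below N.\<close>
  have "\<exists>s<N. g = \<sigma> ^^ s \<and> voa_automorphism sV Y vac conf (\<sigma> ^^ s)" if "g \<in> G" for g
  proof -
    have "g \<in> {\<sigma> [^]\<^bsub>voa_Aut sV Y vac conf\<^esub> k | k. k \<in> (UNIV :: nat set)}"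
      using that Aut.generate_pow_nat[OF assms(2)] assms(3-5) by simp
    then obtain k where "g = \<sigma> ^^ k" by (auto simp: pow)
    moreover have "\<sigma> ^^ k = \<sigma> ^^ (k mod N)"
    proof -
      have "\<sigma> ^^ N = id"
        using Aut.pow_ord_eq_1[OF assms(2)] assms(4) pow[of N] by (simp add: voa_Aut_def)
      then show ?thesis by (intro ext) (simp add: funpow_mod_eq)
    qed
    moreover have "\<sigma> ^^ (k mod N) \<in> carrier (voa_Aut sV Y vac conf)"
      using Aut.nat_pow_closed[OF assms(2), of "k mod N"] by (simp add: pow)
    ultimately show ?thesis using assms(3)
      by (intro exI[of _ "k mod N"]) (simp add: voa_Aut_def)
  qed
  then have "\<forall>g\<in>G. \<forall>u n w. Yt (scalar_pow_L0 sV grade (inverse (\<phi> g)) (g u)) n w = sW (\<phi> g powi n) (Yt u n w)"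
    using Yt_equivariant assms(8) by metis
  then show ?thesis
    unfolding G_phi_quasi_module_def Yt_eq
    using Yt_quasi_module Yt_quasi_jacobi unfolding C.difference_power_def by blast
qed

end
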